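(* Let $\theta\in\{1,\epsilon,\varpi\}$, $\beta\in k^\times$, $X^*=\beta\cdot\sqrt\theta\in\mathfrak t_\theta^*$, and let $s,\theta'\in k^\times$, $Y=s\cdot\sqrt{\theta'}\in\mathfrak t_{\theta'}$. Then $$\hat\mu^G_{X^*}(Y)=M^G_{X^*}(Y),$$ where the invariant measure $d\dot g$ on $G/C_G(X^* )$ used to define $\hat\mu^G_{X^*}$ is normalised so that $$\mathrm{meas}_{d\dot g}(\dot K)=\begin{cases}q^{-1}(q+1),& X^*\text{ split},\\ q^{-1}(q-1),&X^*\text{ unramified},\\ \tfrac12q^{-2}(q^2-1),&X^*\text{ ramified},\end{cases}$$ and $\dot K$ is the image in $G/C_G(X^* )$ of $\mathrm{SL}_2(\mathcal O)$.
   Context: $k$ is a non-discrete non-Archimedean local field of residual characteristic $\ne 2$, with ring of integers $\mathcal O$, maximal ideal $\mathfrak p$, valuation $\operatorname{ord}$ with value group $\mathbb Z$, residue field of order $q$, $|x|=q^{-\operatorname{ord}(x)}$. $\epsilon\in\mathcal O^\times$ is a lift of a non-square of the residue field; $\varpi$ is a uniformiser. $dx$ (or $dt$) is the Haar measure on $k$ giving $\mathcal O$ measure $1$, and $d^\times x=|x|^{-1}dx$. $\Phi$ is a non-trivial additive character of $k$. For $\theta\in k^\times$, $k_\theta=k\oplus k\sqrt\theta$ is the $k$-algebra $k[x]/(x^2-\theta)$ and $N_\theta(a+b\sqrt\theta)=a^2-b^2\theta$. $G=\mathrm{SL}_2(k)$, $\mathfrak g=\mathfrak{sl}_2(k)$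 with dual $\mathfrak g^*$ and pairing $\langle\cdot,\cdot\rangle$. $\mathfrak t_\theta=k\cdot\sqrt\theta$, where here $\sqrt\theta$ denotes the matrix $\begin{pmatrix}0&1\\ \theta&0\end{pmatrix}$. $X^*=\beta\sqrt\theta$ means the functional $Z\mapsto\mathrm{Tr}(\beta\sqrt\theta Z)$ on $\mathfrak g$. $X^*$ is split, unramified, ramified according as $\theta=1,\epsilon,\varpi$. Orbital integral: $\mu^G_{X^*}(f^* )=\int_{G/C_G(X^* )}f^*(\mathrm{Ad}^*(g)X^* )\,d\dot g$ for $f^*\in C_c^\infty(\mathfrak g^* )$; for $f\in C_c^\infty(\mathfrak g)$, $\hat\mu^G_{X^*}(f)=\mu^G_{X^*}(\hat f)$ with $\hat f(Y^* )=\int_{\mathfrak g}f(Y)\Phi(\langle Y^*,Y\rangle)\,dY$, $dY$ a Haar measure on $\mathfrak g$. By Harish-Chandra there is a locally integrable function on $\mathfrak g$, locally constant on the set $\mathfrak g^{\mathrm{rss}}$ of regular semisimple elements, such that integration against it with respect to the same $dY$ gives the distribution $\hat\mu^G_{X^*}$; its restriction to $\mathfrak g^{\mathrm{rss}}$ is again denoted $\hat\mu^G_{X^*}$. Mock Fourier transform: $$M^G_{X^*}(Y)=\sum_{n\in\mathbb Z}\int_{\operatorname{ord}(x)=n}\mathbf 1_{N_\theta(k_\theta^\times)}(x)\Bigl(\sum_{l\in\mathbb Z}\int_{\operatorname{ord}(t)=l}\Phi\bigl(\beta s(x\theta'+x^{-1}\theta-x^{-1}t^2)\bigr)\,dt\Bigr)d^\times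 x,$$ where $\mathbf 1_S$ is the characteristic function of $S$ (the integrals are principal-value integrals, i.e. sums over shells). *)

theory Defs
  imports
    "HOL-Analysis.Analysis"
    "HOL-Computational_Algebra.Polynomial"
begin

section \<open>Non-Archimedean local fields\<close>

text \<open>The value of \<open>val\<close> at 0 is unspecified; every use is guarded by \<open>x \<noteq> 0\<close>.\<close>

class discrete_valued_field = field +
  fixes val :: "'a \<Rightarrow> int"
  assumes val_mult: "x \<noteq> 0 \<Longrightarrow> y \<noteq> 0 \<Longrightarrow> val (x * y) = val x + val y"
    and val_add: "x \<noteq> 0 \<Longrightarrow> y \<noteq> 0 \<Longrightarrow> x + y \<noteq> 0 \<Longrightarrow> min (val x) (val y) \<le> val (x + y)"
    and val_surj: "\<exists>x. x \<noteq> 0 \<and> val x = n"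
begin

definition integer_ring :: "'a set" where
  "integer_ring = {x. x = 0 \<or> 0 \<le> val x}"

definition maximal_ideal :: "'a set" where
  "maximal_ideal = {x. x = 0 \<or> 1 \<le> val x}"

definition residue_field :: "'a set set" where
  "residue_field =
     integer_ring // {(x, y). x \<in> integer_ring \<and> y \<in> integer_ring \<and> x - y \<in> maximal_ideal}"

definition abs_val :: "'a \<Rightarrow> real" where
  "abs_val x = (if x = 0 then 0 else real (card residue_field) powi (- val x))"

end

text \<open>
  Completeness comes from \<open>complete_space\<close>, and the axiom \<open>dist_eq_abs_val\<close> says that the topology
  of the type is the one defined by the absolute value.
\<close>

class nonarch_local_field = discrete_valued_field + complete_space +
  assumes finite_residue_field: "finite residue_field"
    and dist_eq_abs_val: "dist x y = abs_val (x - y)"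

definition shell :: "int \<Rightarrow> 'k::discrete_valued_field set" where
  "shell n = {x. x \<noteq> 0 \<and> val x = n}"

definition uniformiser :: "'k::discrete_valued_field \<Rightarrow> bool" where
  "uniformiser \<pi> \<longleftrightarrow> \<pi> \<noteq> 0 \<and> val \<pi> = 1"

definition nonsquare_unit :: "'k::discrete_valued_field \<Rightarrow> bool" where
  "nonsquare_unit e \<longleftrightarrow> e \<noteq> 0 \<and> val e = 0 \<and>
     \<not> (\<exists>y\<in>integer_ring. e - y\<^sup>2 \<in> maximal_ideal)"

definition nontrivial_additive_character :: "('k::nonarch_local_field \<Rightarrow> complex) \<Rightarrow> bool" where
  "nontrivial_additive_character \<Phi> \<longleftrightarrow>
     continuous_on UNIV \<Phi> \<and> (\<forall>x. cmod (\<Phi> x) = 1) \<and>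
     (\<forall>x y. \<Phi> (x + y) = \<Phi> x * \<Phi> y) \<and> (\<exists>x. \<Phi> x \<noteq> 1)"

section \<open>The quadratic algebra \<open>k_\<theta> = k[x]/(x^2 - \<theta>)\<close>\<close>

text \<open>The pair \<open>(a, b)\<close> stands for \<open>a + b \<surd>\<theta>\<close>. For a square \<open>\<theta>\<close> this is not a field.\<close>

definition quad_mult :: "'k::field \<Rightarrow> 'k \<times> 'k \<Rightarrow> 'k \<times> 'k \<Rightarrow> 'k \<times> 'k" where
  "quad_mult \<theta> z w =
     (fst z * fst w + \<theta> * (snd z * snd w), fst z * snd w + snd z * fst w)"

definition quad_units :: "'k::field \<Rightarrow> ('k \<times> 'k) set" where
  "quad_units \<theta> = {z. \<exists>w. quad_mult \<theta> z w = (1, 0)}"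

definition quad_norm :: "'k::field \<Rightarrow> 'k \<times> 'k \<Rightarrow> 'k" where
  "quad_norm \<theta> z = (fst z)\<^sup>2 - (snd z)\<^sup>2 * \<theta>"

section \<open>Haar measures\<close>

text \<open>Haar measures on a closed additive subgroup \<open>A\<close>, as Borel measures with space \<open>A\<close>.\<close>

definition haar_measure_on ::
    "'a::{ab_group_add, topological_space} set \<Rightarrow> 'a measure \<Rightarrow> bool" where
  "haar_measure_on A \<nu> \<longleftrightarrow>
     space \<nu> = A \<and> sets \<nu> = sets (restrict_space borel A) \<and>
     (\<forall>a\<in>A. \<forall>S\<in>sets \<nu>. emeasure \<nu> ((+) a ` S) = emeasure \<nu> S) \<and>
     (\<forall>C. compact C \<and> C \<subseteq> A \<longrightarrow> emeasure \<nu> C < \<infinity>) \<and>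
     emeasure \<nu> A \<noteq> 0"

text \<open>The measure \<open>|x|^(-1) dx\<close>; the origin gets density 0, and every shell avoids it.\<close>

definition mult_measure :: "'k::nonarch_local_field measure \<Rightarrow> 'k measure" where
  "mult_measure dx = density dx (\<lambda>x. ennreal (inverse (abs_val x)))"

section \<open>\<open>SL_2\<close>, its Lie algebra and the coadjoint action\<close>

definition SL2 :: "('k::field ^ 2 ^ 2) set" where
  "SL2 = {g. det g = 1}"

definition SL2_integers :: "('k::discrete_valued_field ^ 2 ^ 2) set" where
  "SL2_integers = {g \<in> SL2. \<forall>i j. g $ i $ j \<in> integer_ring}"

definition sl2 :: "('k::field ^ 2 ^ 2) set" where
  "sl2 = {Z. trace Z = 0}"

definition char_poly2 :: "'k::field ^ 2 ^ 2 \<Rightarrow> 'k poly" where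
  "char_poly2 Z = det (\<chi> i j. (if i = j then [:0, 1:] else 0) - [:Z $ i $ j:])"

text \<open>
  An element is regular semisimple if it has distinct eigenvalues in an algebraic closure, that is,
  if its characteristic polynomial is separable.
\<close>

definition sl2_rss :: "('k::field ^ 2 ^ 2) set" where
  "sl2_rss = {Z \<in> sl2. coprime (char_poly2 Z) (pderiv (char_poly2 Z))}"

text \<open>The element \<open>\<beta> \<surd>\<theta>\<close> of the Cartan subalgebra \<open>t_\<theta>\<close>.\<close>

definition torus_elt :: "'k::field \<Rightarrow> 'k \<Rightarrow> 'k ^ 2 ^ 2" where
  "torus_elt \<beta> \<theta> = vector [vector [0, \<beta>], vector [\<beta> * \<theta>, 0]]"

text \<open>
  Elements of the dual of \<open>sl2\<close> are functions restricted to \<open>sl2\<close> (arbitrary but fixed elsewhere),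
  so that equality of functionals is equality in HOL and the pairing is application.
\<close>

type_synonym 'k functional = "'k ^ 2 ^ 2 \<Rightarrow> 'k"

definition trace_functional :: "'k::field ^ 2 ^ 2 \<Rightarrow> 'k functional" where
  "trace_functional X = (\<lambda>Z\<in>sl2. trace (X ** Z))"

definition coAd :: "'k::field ^ 2 ^ 2 \<Rightarrow> 'k functional \<Rightarrow> 'k functional" where
  "coAd g X = (\<lambda>Z\<in>sl2. X (matrix_inv g ** Z ** g))"

definition centraliser :: "'k::field functional \<Rightarrow> ('k ^ 2 ^ 2) set" where
  "centraliser X = {g \<in> SL2. coAd g X = X}"

section \<open>The homogeneous space \<open>G/H\<close> and its invariant measures\<close>

definition translate :: "'k::field ^ 2 ^ 2 \<Rightarrow> ('k ^ 2 ^ 2) set \<Rightarrow> ('k ^ 2 ^ 2) set" where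
  "translate g c = (\<lambda>h. g ** h) ` c"

definition cosets :: "('k::field ^ 2 ^ 2) set \<Rightarrow> ('k ^ 2 ^ 2) set set" where
  "cosets H = (\<lambda>g. translate g H) ` SL2"

text \<open>The quotient topology for \<open>g \<mapsto> gH\<close>.\<close>

definition coset_topology ::
    "('k::{field, topological_space} ^ 2 ^ 2) set \<Rightarrow> ('k ^ 2 ^ 2) set topology" where
  "coset_topology H = topology (\<lambda>U. U \<subseteq> cosets H \<and>
     openin (top_of_set SL2) {g \<in> SL2. translate g H \<in> U})"

lemma openin_coset_topology:
  "openin (coset_topology H) U \<longleftrightarrow>
     U \<subseteq> cosets H \<and> openin (top_of_set SL2) {g \<in> SL2. translate g H \<in> U}"
proof -
  have "istopology (\<lambda>U. U \<subseteq> cosets H \<and>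
          openin (top_of_set SL2) {g \<in> SL2. translate g H \<in> U})" (is "istopology ?P")
    unfolding istopology_def
  proof (intro conjI allI impI)
    fix S T assume "?P S" "?P T"
    moreover have "{g \<in> SL2. translate g H \<in> S \<inter> T} =
        {g \<in> SL2. translate g H \<in> S} \<inter> {g \<in> SL2. translate g H \<in> T}" by blast
    ultimately show "S \<inter> T \<subseteq> cosets H"
      and "openin (top_of_set SL2) {g \<in> SL2. translate g H \<in> S \<inter> T}"
      by (auto intro: openin_Int)
  next
    fix \<K> assume K: "\<forall>S\<in>\<K>. ?P S"
    then show "\<Union>\<K> \<subseteq> cosets H" by blast
    have "{g \<in> SL2. translate g H \<in> \<Union>\<K>} = (\<Union>S\<in>\<K>. {g \<in> SL2. translate g H \<in> S})" by blast
    then show "openin (top_of_set SL2) {g \<in> SL2. translate g H \<in> \<Union>\<K>}"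
      using K by auto
  qed
  then show ?thesis
    by (simp add: coset_topology_def topology_inverse')
qed

definition invariant_measure ::
    "('k::{field, topological_space} ^ 2 ^ 2) set \<Rightarrow> ('k ^ 2 ^ 2) set measure \<Rightarrow> bool" where
  "invariant_measure H \<mu> \<longleftrightarrow>
     space \<mu> = cosets H \<and>
     sets \<mu> = sigma_sets (cosets H) {U. openin (coset_topology H) U} \<and>
     (\<forall>g\<in>SL2. \<forall>S\<in>sets \<mu>. emeasure \<mu> (translate g ` S) = emeasure \<mu> S) \<and>
     (\<forall>C\<in>sets \<mu>. compactin (coset_topology H) C \<longrightarrow> emeasure \<mu> C < \<infinity>)"

section \<open>Fourier transforms of orbital integrals\<close>

definition locally_constant_on :: "'a::topological_space set \<Rightarrow> ('a \<Rightarrow> 'b) \<Rightarrow> bool" where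
  "locally_constant_on S f \<longleftrightarrow>
     (\<forall>x\<in>S. \<exists>U. openin (top_of_set S) U \<and> x \<in> U \<and> (\<forall>y\<in>U. f y = f x))"

definition test_functions :: "('k::nonarch_local_field ^ 2 ^ 2 \<Rightarrow> complex) set" where
  "test_functions =
     {f. locally_constant_on sl2 f \<and> compact (closure {Z \<in> sl2. f Z \<noteq> 0})}"

definition fourier ::
    "('k::nonarch_local_field \<Rightarrow> complex) \<Rightarrow> ('k ^ 2 ^ 2) measure \<Rightarrow>
     ('k ^ 2 ^ 2 \<Rightarrow> complex) \<Rightarrow> 'k functional \<Rightarrow> complex" where
  "fourier \<Phi> dY f Z = (LINT Y|dY. f Y * \<Phi> (Z Y))"

text \<open>
  The integrand is constant on each coset of \<open>centraliser X\<close>, so the choice of the representative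
  is irrelevant.
\<close>

definition orbital_integral ::
    "('k::nonarch_local_field ^ 2 ^ 2) set measure \<Rightarrow> 'k functional \<Rightarrow>
     ('k functional \<Rightarrow> complex) \<Rightarrow> complex" where
  "orbital_integral \<mu> X f = (LINT c|\<mu>. f (coAd (SOME g. g \<in> c) X))"

text \<open>
  \<open>F\<close> is the function that Harish-Chandra attaches to the distribution
  \<open>f \<mapsto> orbital_integral \<mu> X (fourier \<Phi> dY f)\<close>. These conditions determine \<open>F\<close> on \<open>sl2_rss\<close>,
  and nowhere else.
\<close>

definition represents_orbital_fourier ::
    "('k::nonarch_local_field \<Rightarrow> complex) \<Rightarrow> ('k ^ 2 ^ 2) measure \<Rightarrow>
     ('k ^ 2 ^ 2) set measure \<Rightarrow> 'k functional \<Rightarrow> ('k ^ 2 ^ 2 \<Rightarrow> complex) \<Rightarrow> bool" where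
  "represents_orbital_fourier \<Phi> dY \<mu> X F \<longleftrightarrow>
     (\<forall>C. compact C \<and> C \<subseteq> sl2 \<longrightarrow> set_integrable dY C F) \<and>
     locally_constant_on sl2_rss F \<and>
     (\<forall>f\<in>test_functions. (LINT Y|dY. F Y * f Y) = orbital_integral \<mu> X (fourier \<Phi> dY f))"

section \<open>The mock Fourier transform\<close>

text \<open>The value at \<open>X = \<beta> \<surd>\<theta>\<close> and \<open>Y = s \<surd>\<theta>'\<close>.\<close>

definition mock_fourier ::
    "('k::nonarch_local_field \<Rightarrow> complex) \<Rightarrow> 'k measure \<Rightarrow> 'k \<Rightarrow> 'k \<Rightarrow> 'k \<Rightarrow> 'k \<Rightarrow> complex" where
  "mock_fourier \<Phi> dx \<beta> \<theta> s \<theta>' =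
     (\<Sum>\<^sub>\<infinity>n::int. LINT x:shell n|mult_measure dx.
        indicator (quad_norm \<theta> ` quad_units \<theta>) x *
        (\<Sum>\<^sub>\<infinity>l::int. LINT t:shell l|dx.
           \<Phi> (\<beta> * s * (x * \<theta>' + inverse x * \<theta> - inverse x * t\<^sup>2))))"

end

theory Submission
  imports Defs
begin

text \<open>
  Write \<open>g \<surd>\<theta> g\<^sup>-\<^sup>1\<close> as the matrix with rows \<open>(a, b)\<close> and \<open>(c, -a)\<close>, so that \<open>a\<^sup>2 + b c = \<theta>\<close>, and
  \<open>b = N(g\<^sub>1\<^sub>1 + g\<^sub>1\<^sub>2 \<surd>\<theta>)\<close> is a norm if it is non-zero. The pairing with \<open>Y\<close> is
  \<open>\<beta> s (b \<theta>' + c) = \<beta> s (b \<theta>' + b\<^sup>-\<^sup>1 \<theta> - b\<^sup>-\<^sup>1 a\<^sup>2)\<close>, which is the exponent of the mock Fourier transform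
  for \<open>x = b\<close> and \<open>t = a\<close>, and the invariant measure of the orbit is \<open>|b|\<^sup>-\<^sup>1 da db\<close>: the Borel subgroup
  determines it up to a constant on each square class of \<open>b\<close>, the Weyl element exchanges \<open>b\<close> with
  \<open>(a\<^sup>2 - \<theta>) / b\<close> and so relates all classes of norms, and the volume of the integral points fixes the
  constant.

  Since \<open>F\<close> is constant on \<open>Y + L\<close> for every small lattice \<open>L\<close>, testing against the indicator of \<open>Y + L\<close>
  expresses \<open>F Y\<close> as the integral of \<open>\<Phi>(\<langle>X, Y\<rangle>)\<close> over the part of the orbit in the annihilator of \<open>L\<close>, a
  region \<open>|a| \<le> A\<close>, \<open>|b| \<le> B\<close>, \<open>|c| \<le> C\<close>. Cutting it along the shells of \<open>b\<close>, oscillation in \<open>a\<close> removes the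
  dependence on \<open>A\<close> and \<open>C\<close>, and the neighbourhood of \<open>b = 0\<close> contributes nothing. So \<open>F Y\<close> is a partial sum
  of the outer series of the mock Fourier transform for all large \<open>B\<close> and \<open>C\<close>; as these partial sums do
  not depend on \<open>B\<close> and \<open>C\<close>, the remaining terms vanish.
\<close>

section \<open>Valuations and balls\<close>

text \<open>\<open>\<mu>\<close> is known only through its invariance, so its shape must be
  recovered by evaluating its image in \<open>k^3\<close> on cells \<open>b \<in> vball r x\<close>,
  \<open>a \<in> vball i t\<close>. Since \<open>1 + p\<close> consists of squares in odd residual
  characteristic, every small ball of \<open>b\<close> lies in one square class, which is why
  unipotent shifts of \<open>a\<close> and the diagonal torus suffice to fix the density. Values
  stay in \<open>ennreal\<close>, as finiteness of \<open>kappa\<close> is known only after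
  normalisation. The three constants are the volumes of the integral points of
  \<open>a^2 + b c = \<theta>\<close> for \<open>|b|^-1 da db\<close>; the factor 1/2 in the
  ramified case says that half of the unit classes are norms. The neighbourhood of
  \<open>b = 0\<close> is harmless for two different reasons. For non-split \<open>\<theta>\<close>
  it misses the orbit, because \<open>\<theta>\<close> cannot be too close to a square. For
  \<open>\<theta> = 1\<close> it lies near \<open>a = 1\<close> and \<open>a = -1\<close>, where a
  lower unipotent moves \<open>c\<close> and makes the character average out. The bounds
  \<open>A\<close>, \<open>B\<close>, \<open>C\<close> must vary independently, since
  \<open>A\<close> is chosen after \<open>B\<close>; hence the lattices have three separate
  radii.\<close>

definition pideal :: "int \<Rightarrow> 'k::discrete_valued_field set" where
  "pideal n = {x. x = 0 \<or> n \<le> val x}"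

text \<open>Cosets of \<open>pideal n\<close>. Balls are described by valuations rather than by
  \<open>dist\<close>, so that counting and refining them is pure algebra.\<close>

definition vball :: "int \<Rightarrow> 'k::discrete_valued_field \<Rightarrow> 'k set" where
  "vball n x = {y. y - x \<in> pideal n}"

lemma val_one [simp]: "val (1::'k::discrete_valued_field) = 0"
  using val_mult[of "1::'k" 1] by simp

lemma val_minus [simp]: "val (- x :: 'k::discrete_valued_field) = val x"
proof (cases "x = 0")
  case False
  have "val (-1::'k) = 0"
    using val_mult[of "-1::'k" "-1"] by simp
  then show ?thesis using val_mult[of "-1" x] False by simp
qed simp

lemma val_inverse: "x \<noteq> 0 \<Longrightarrow> val (inverse x :: 'k::discrete_valued_field) = - val x"
  using val_mult[of x "inverse x"] by (simp add: right_inverse)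

lemma val_divide: "x \<noteq> 0 \<Longrightarrow> y \<noteq> 0 \<Longrightarrow> val (x / y :: 'k::discrete_valued_field) = val x - val y"
  by (simp add: divide_inverse val_mult val_inverse)

lemma val_power2: "x \<noteq> 0 \<Longrightarrow> val (x\<^sup>2 :: 'k::discrete_valued_field) = 2 * val x"
  by (simp add: power2_eq_square val_mult)

lemma pideal_0 [simp]: "0 \<in> pideal n"
  by (simp add: pideal_def)

lemma pideal_mono: "m \<le> n \<Longrightarrow> x \<in> pideal n \<Longrightarrow> x \<in> pideal m"
  by (auto simp: pideal_def)

lemma pideal_add: "x \<in> pideal n \<Longrightarrow> y \<in> pideal n \<Longrightarrow> x + y \<in> pideal n"
  using val_add[of x y] by (cases "x = 0"; cases "y = 0"; cases "x + y = 0") (auto simp: pideal_def)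

lemma pideal_uminus [simp]: "- x \<in> pideal n \<longleftrightarrow> x \<in> pideal n"
  by (auto simp: pideal_def)

lemma pideal_diff: "x \<in> pideal n \<Longrightarrow> y \<in> pideal n \<Longrightarrow> x - y \<in> pideal n"
  using pideal_add[of x n "- y"] by simp

lemma pideal_diff_commute: "x - y \<in> pideal n \<longleftrightarrow> y - x \<in> pideal n"
  by (metis minus_diff_eq pideal_uminus)

lemma pideal_mult: "x \<in> pideal m \<Longrightarrow> y \<in> pideal n \<Longrightarrow> x * y \<in> pideal (m + n)"
  by (cases "x = 0"; cases "y = 0") (auto simp: pideal_def val_mult)

lemma pideal_mult': "x \<in> pideal m \<Longrightarrow> y \<in> pideal n \<Longrightarrow> l \<le> m + n \<Longrightarrow> x * y \<in> pideal l"
  using pideal_mult pideal_mono by blast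

lemma pideal_mult_iff: "x \<noteq> 0 \<Longrightarrow> x * y \<in> pideal n \<longleftrightarrow> y \<in> pideal (n - val x)"
  by (cases "y = 0") (auto simp: pideal_def val_mult)

lemma pideal_square_iff: "x\<^sup>2 \<in> pideal n \<longleftrightarrow> x = 0 \<or> n \<le> 2 * val x"
  by (cases "x = 0") (auto simp: pideal_def val_power2)

lemma integer_ring_eq: "integer_ring = pideal 0"
  by (simp add: integer_ring_def pideal_def)

lemma maximal_ideal_eq: "maximal_ideal = pideal 1"
  by (simp add: maximal_ideal_def pideal_def)

lemma shell_eq: "shell n = pideal n - pideal (n + 1)"
  by (auto simp: shell_def pideal_def)

lemma pideal_self: "x \<in> pideal (val x)"
  by (simp add: pideal_def)

text \<open>Strict ultrametric inequality: the reverse estimate applies \<open>val_add\<close> to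
  \<open>(x + y) + (- y)\<close>, where the minimum cannot be \<open>val y\<close>.\<close>

lemma val_add_eq:
  assumes "x \<noteq> 0" "y \<in> pideal (val x + 1)"
  shows "x + y \<noteq> 0" "val (x + y) = val x"
proof -
  show *: "x + y \<noteq> 0"
    using assms by (auto simp: pideal_def add_eq_0_iff)
  show "val (x + y) = val x"
  proof (cases "y = 0")
    case False
    then have "val x < val y" using assms by (simp add: pideal_def)
    moreover have "min (val x) (val y) \<le> val (x + y)" using assms False * by (intro val_add)
    moreover have "min (val (x + y)) (val (-y)) \<le> val (x + y + - y)"
      using assms False * by (intro val_add) auto
    ultimately show ?thesis by (auto simp: min_def split: if_splits)
  qed simp
qed

lemma vball_iff: "y \<in> vball n x \<longleftrightarrow> y - x \<in> pideal n"
  by (simp add: vball_def)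

lemma vball_self [simp]: "x \<in> vball n x"
  by (simp add: vball_def)

lemma vball_zero: "vball n 0 = pideal n"
  by (simp add: vball_def)

lemma vball_eq_iff: "vball n x = vball n y \<longleftrightarrow> x - y \<in> pideal n"
proof
  assume "vball n x = vball n y"
  then show "x - y \<in> pideal n" using vball_self[of x n] by (simp add: vball_def)
next
  assume *: "x - y \<in> pideal n"
  have "z - x \<in> pideal n \<longleftrightarrow> z - y \<in> pideal n" for z
    using pideal_add[OF _ *, of "z - x"] pideal_diff[OF _ *, of "z - y"] by auto
  then show "vball n x = vball n y" by (auto simp: vball_def)
qed

lemma vball_eqI: "y \<in> vball n x \<Longrightarrow> vball n y = vball n x"
  by (simp add: vball_eq_iff vball_iff)

lemma vball_disjoint: "vball n x \<noteq> vball n y \<Longrightarrow> vball n x \<inter> vball n y = {}"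
  using vball_eqI by (metis disjoint_iff)

lemma vball_subset: "m \<le> n \<Longrightarrow> vball n x \<subseteq> vball m x"
  using pideal_mono by (auto simp: vball_def)

lemma vball_subset': "y \<in> vball m x \<Longrightarrow> m \<le> n \<Longrightarrow> vball n y \<subseteq> vball m x"
  using vball_subset vball_eqI by blast

lemma vball_image_plus: "(+) a ` vball n x = vball n (a + x)"
proof -
  have "y \<in> (+) a ` vball n x" if "y \<in> vball n (a + x)" for y
    using that by (intro image_eqI[of _ _ "y - a"]) (auto simp: vball_def algebra_simps)
  then show ?thesis by (auto simp: vball_def)
qed

lemma vball_val:
  assumes "x \<noteq> 0" "y \<in> vball (val x + 1) x"
  shows "y \<noteq> 0" "val y = val x"
  using val_add_eq[OF assms(1), of "y - x"] assms(2) by (auto simp: vball_iff)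

lemma shell_vball: "x \<in> shell n \<Longrightarrow> n < r \<Longrightarrow> vball r x \<subseteq> shell n"
  using vball_val[of x] vball_subset[of "n+1" r x] by (auto simp: shell_def)

lemma pideal_vball: "x \<in> pideal n \<Longrightarrow> n \<le> r \<Longrightarrow> vball r x \<subseteq> pideal n"
  using vball_subset'[of x n 0 r] by (simp add: vball_zero)

lemma UN_vball: "(\<And>x. x \<in> S \<Longrightarrow> vball r x \<subseteq> S) \<Longrightarrow> \<Union> (vball r ` S) = S"
  by auto

lemma residue_field_eq: "(residue_field :: 'k::discrete_valued_field set set) = vball 1 ` pideal 0"
proof -
  have "{(x, y). x \<in> pideal 0 \<and> y \<in> pideal 0 \<and> x - y \<in> pideal 1} `` {x} = vball 1 x"
    if "x \<in> (pideal 0 :: 'k set)" for x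
    using that pideal_vball[of x 0 1] by (auto simp: vball_def pideal_diff_commute)
  then show ?thesis
    unfolding residue_field_def quotient_def integer_ring_eq maximal_ideal_eq by auto
qed

lemma vball_image_affine:
  assumes "c \<noteq> 0"
  shows "(\<lambda>y. x + c * y) ` vball n y = vball (n + val c) (x + c * y)"
proof -
  have "z \<in> (\<lambda>y. x + c * y) ` vball n y" if "z \<in> vball (n + val c) (x + c * y)" for z
  proof (intro image_eqI[of _ _ "(z - x) / c"])
    have "c * ((z - x) / c - y) = z - (x + c * y)"
      using assms by (simp add: field_simps)
    then show "(z - x) / c \<in> vball n y"
      using that pideal_mult_iff[OF assms, of "(z - x) / c - y" "n + val c"]
      by (simp add: vball_iff)
  qed (use assms in auto)
  moreover have "x + c * z \<in> vball (n + val c) (x + c * y)" if "z \<in> vball n y" for z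
  proof -
    have "c * (z - y) \<in> pideal (n + val c)"
      using pideal_mult_iff[OF assms, of "z - y" "n + val c"] that by (simp add: vball_iff)
    then show ?thesis by (simp add: vball_iff algebra_simps)
  qed
  ultimately show ?thesis by blast
qed

text \<open>An affine map \<open>y \<mapsto> x + c y\<close> with \<open>val c = n\<close> carries
  the cosets of \<open>pideal 1\<close> in \<open>pideal 0\<close>, which form the residue field,
  onto the subballs of \<open>vball n x\<close>.\<close>

lemma card_subballs:
  "card (vball (n + 1) ` vball n (x :: 'k::discrete_valued_field)) = card (residue_field :: 'k set set)"
  (is ?A)
  and finite_subballs_1: "finite (residue_field :: 'k set set) \<Longrightarrow> finite (vball (n + 1) ` vball n x)"
proof -
  obtain c :: 'k where c: "c \<noteq> 0" "val c = n" using val_surj by blast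
  let ?f = "\<lambda>y. x + c * y"
  have inj: "inj ?f" using c by (auto simp: inj_def)
  have "vball n x = ?f ` pideal 0"
    using vball_image_affine[OF c(1), of x 0 0] c by (simp add: vball_zero)
  then have "vball (n + 1) ` vball n x = (\<lambda>y. vball (n + 1) (?f y)) ` pideal 0"
    by (simp add: image_image)
  also have "\<dots> = (\<lambda>A. ?f ` A) ` residue_field"
    unfolding residue_field_eq image_image
    by (intro image_cong refl) (use vball_image_affine[OF c(1), of x 1] c in \<open>simp add: add.commute\<close>)
  finally have eq: "vball (n + 1) ` vball n x = (\<lambda>A. ?f ` A) ` residue_field" .
  have "inj_on (\<lambda>A. ?f ` A) (residue_field :: 'k set set)"
    using inj by (auto simp: inj_on_def inj_image_eq_iff)
  then show ?A unfolding eq by (rule card_image)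
  show "finite (residue_field :: 'k set set) \<Longrightarrow> finite (vball (n + 1) ` vball n x)"
    unfolding eq by simp
qed

lemma finite_subballs:
  fixes x :: "'k::nonarch_local_field"
  shows "finite (vball m ` vball n x)"
proof (cases "n \<le> m")
  case True
  then show ?thesis
  proof (induction m rule: int_ge_induct)
    case base
    have "vball n ` vball n x \<subseteq> {vball n x}" by (auto simp: vball_eqI)
    then show ?case using finite_subset by blast
  next
    case (step m)
    have "vball (m + 1) ` vball n x \<subseteq> (\<Union>P\<in>vball m ` vball n x. vball (m + 1) ` P)"
      by auto
    moreover have "finite (vball (m + 1) ` P)" if "P \<in> vball m ` vball n x" for P
      using that finite_subballs_1[OF finite_residue_field] by auto
    ultimately show ?case using step.IH by (meson finite_UN finite_subset)
  qed
next
  case False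
  have "vball m ` vball n x \<subseteq> {vball m x}"
    using False vball_subset[of m n x] by (auto simp: vball_eqI)
  then show ?thesis using finite_subset by blast
qed

lemma finite_vball_image:
  fixes S :: "'k::nonarch_local_field set"
  assumes "S \<subseteq> vball n x"
  shows "finite (vball m ` S)"
  using finite_subset[OF image_mono[OF assms] finite_subballs] .

lemma card_residue_field_ge2:
  "card (residue_field :: 'k::nonarch_local_field set set) \<ge> 2"
proof -
  have "card {vball 1 (0::'k), vball 1 1} = 2" by (simp add: vball_eq_iff pideal_def)
  moreover have "{vball 1 (0::'k), vball 1 1} \<subseteq> residue_field"
    unfolding residue_field_eq by (auto simp: pideal_def)
  ultimately show ?thesis using card_mono[OF finite_residue_field] by metis
qed

abbreviation qres :: "'k::nonarch_local_field itself \<Rightarrow> real" where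
  "qres _ \<equiv> real (card (residue_field :: 'k set set))"

text \<open>The bridge from the metric to valuations; it holds because powers of
  \<open>qres > 1\<close> are strictly monotone in the exponent.\<close>

lemma dist_le_iff_pideal:
  fixes x y :: "'k::nonarch_local_field"
  shows "dist x y \<le> qres TYPE('k) powi (- n) \<longleftrightarrow> x - y \<in> pideal n"
proof (cases "x = y")
  case False
  have q: "qres TYPE('k) > 1" using card_residue_field_ge2[where ?'k = 'k] by linarith
  have "qres TYPE('k) powi (- val (x - y)) \<le> qres TYPE('k) powi (- n) \<longleftrightarrow> n \<le> val (x - y)"
    using power_int_strict_increasing[of "- n" "- val (x - y)", OF _ q]
      power_int_increasing[of "- val (x - y)" "- n" "qres TYPE('k)"] q
    by (metis less_eq_real_def neg_le_iff_le not_le)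
  then show ?thesis using False
    by (simp add: dist_eq_abs_val abs_val_def pideal_def)
qed simp

section \<open>The topology of a local field\<close>

lemma qres_gt_1: "qres TYPE('k::nonarch_local_field) > 1"
  using card_residue_field_ge2[where ?'k = 'k] by linarith

lemma qres_powi_small:
  assumes "e > 0"
  obtains n :: int where "qres TYPE('k::nonarch_local_field) powi (- n) < e" "n \<ge> n0"
proof -
  obtain k where k: "inverse (qres TYPE('k)) ^ k < e"
    using real_arch_pow_inv[OF assms, of "inverse (qres TYPE('k))"] qres_gt_1[where ?'k = 'k]
    by (auto simp: inverse_less_1_iff)
  have "qres TYPE('k) powi (- max (int k) n0) \<le> qres TYPE('k) powi (- int k)"
    using qres_gt_1[where ?'k = 'k] by (intro power_int_increasing) auto
  also have "\<dots> = inverse (qres TYPE('k)) ^ k"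
    by (simp add: power_int_minus power_inverse)
  finally show ?thesis using k that[of "max (int k) n0"] by auto
qed

lemma open_iff_vball:
  fixes S :: "'k::nonarch_local_field set"
  shows "open S \<longleftrightarrow> (\<forall>x\<in>S. \<exists>n. vball n x \<subseteq> S)"
proof
  assume S: "open S"
  show "\<forall>x\<in>S. \<exists>n. vball n x \<subseteq> S"
  proof
    fix x assume "x \<in> S"
    then obtain e where e: "e > 0" "\<And>y. dist y x < e \<Longrightarrow> y \<in> S"
      using S by (auto simp: open_dist)
    obtain n :: int where n: "qres TYPE('k) powi (- n) < e"
      using qres_powi_small[OF e(1)] by blast
    have "y \<in> S" if "y \<in> vball n x" for y
      using that dist_le_iff_pideal[of y x n] n by (intro e(2)) (simp add: vball_iff)
    then show "\<exists>n. vball n x \<subseteq> S" by blast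
  qed
next
  assume *: "\<forall>x\<in>S. \<exists>n. vball n x \<subseteq> S"
  show "open S" unfolding open_dist
  proof
    fix x assume "x \<in> S"
    then obtain n where n: "vball n x \<subseteq> S" using * by blast
    have "0 < qres TYPE('k) powi (- n)"
      using qres_gt_1[where ?'k = 'k] by (intro zero_less_power_int) auto
    moreover have "y \<in> S" if "dist y x < qres TYPE('k) powi (- n)" for y
      using that dist_le_iff_pideal[of y x n] n by (auto simp: vball_iff)
    ultimately show "\<exists>e>0. \<forall>y. dist y x < e \<longrightarrow> y \<in> S" by blast
  qed
qed

lemma open_vball [simp]: "open (vball n (x::'k::nonarch_local_field))"
  unfolding open_iff_vball using vball_eqI by blast

lemma open_pideal [simp]: "open (pideal n :: 'k::nonarch_local_field set)"
  by (metis open_vball vball_zero)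

lemma closed_vball [simp]: "closed (vball n (x::'k::nonarch_local_field))"
  unfolding closed_def open_iff_vball using vball_disjoint vball_eqI
  by (metis ComplD disjoint_eq_subset_Compl vball_self)

lemma closed_pideal [simp]: "closed (pideal n :: 'k::nonarch_local_field set)"
  by (metis closed_vball vball_zero)

lemma open_shell [simp]: "open (shell n :: 'k::nonarch_local_field set)"
  unfolding shell_eq by (intro open_Diff) simp_all

lemma closed_shell [simp]: "closed (shell n :: 'k::nonarch_local_field set)"
  unfolding shell_eq by (intro closed_Diff) simp_all

lemma tendsto_vball:
  fixes f :: "'a \<Rightarrow> 'k::nonarch_local_field"
  shows "(f \<longlongrightarrow> l) F \<longleftrightarrow> (\<forall>n. eventually (\<lambda>x. f x - l \<in> pideal n) F)"
proof
  assume *: "(f \<longlongrightarrow> l) F"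
  show "\<forall>n. eventually (\<lambda>x. f x - l \<in> pideal n) F"
  proof
    fix n show "eventually (\<lambda>x. f x - l \<in> pideal n) F"
      using topological_tendstoD[OF * open_vball[of n l]] by (simp add: vball_iff)
  qed
next
  assume *: "\<forall>n. eventually (\<lambda>x. f x - l \<in> pideal n) F"
  show "(f \<longlongrightarrow> l) F"
  proof (rule topological_tendstoI)
    fix S assume "open S" "l \<in> S"
    then obtain n where "vball n l \<subseteq> S" by (auto simp: open_iff_vball)
    then show "eventually (\<lambda>x. f x \<in> S) F"
      using spec[OF *, of n] by (auto simp: vball_iff elim!: eventually_mono)
  qed
qed

lemma eventually_nhds_pideal: "eventually (\<lambda>x. x - a \<in> pideal n) (nhds (a::'k::nonarch_local_field))"
  using tendsto_vball[of "\<lambda>x. x" a "nhds a"] by (simp add: filterlim_ident)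

instance nonarch_local_field \<subseteq> topological_ab_group_add
proof
  fix a b :: "'a::nonarch_local_field"
  have "eventually (\<lambda>x. fst x + snd x - (a + b) \<in> pideal n) (nhds a \<times>\<^sub>F nhds b)" for n
  proof -
    have "eventually (\<lambda>x. (fst x - a \<in> pideal n) \<and> (snd x - b \<in> pideal n)) (nhds a \<times>\<^sub>F nhds b)"
      unfolding eventually_prod_filter
      using eventually_nhds_pideal[of a n] eventually_nhds_pideal[of b n] by auto
    then show ?thesis
    proof (rule eventually_mono)
      fix x :: "'a \<times> 'a" assume "fst x - a \<in> pideal n \<and> snd x - b \<in> pideal n"
      then show "fst x + snd x - (a + b) \<in> pideal n"
        using pideal_add[of "fst x - a" n "snd x - b"] by (simp add: algebra_simps)
    qed
  qed
  then show "((\<lambda>x. fst x + snd x) \<longlongrightarrow> a + b) (nhds a \<times>\<^sub>F nhds b)"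
    by (simp add: tendsto_vball)
  show "(uminus \<longlongrightarrow> - a) (nhds a)"
    unfolding tendsto_vball
  proof
    fix n
    show "eventually (\<lambda>x. - x - - a \<in> pideal n) (nhds a)"
      using eventually_nhds_pideal[of a n] by (simp add: pideal_diff_commute)
  qed
qed

instance nonarch_local_field \<subseteq> topological_semigroup_mult
proof
  fix a b :: "'a::nonarch_local_field"
  have "eventually (\<lambda>x. fst x * snd x - a * b \<in> pideal n) (nhds a \<times>\<^sub>F nhds b)" for n
  proof -
    \<comment> \<open>With \<open>x y - a b = (x - a) (y - b) + a (y - b) + b (x - a)\<close>, this
      radius puts each of the three products into \<open>pideal n\<close>.\<close>
    define r where "r = max (max n 0) (max (n - val a) (n - val b))"
    then have r: "n \<le> r" "0 \<le> r" "n - val a \<le> r" "n - val b \<le> r" by auto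
    have "eventually (\<lambda>x. (fst x - a \<in> pideal r) \<and> (snd x - b \<in> pideal r)) (nhds a \<times>\<^sub>F nhds b)"
      unfolding eventually_prod_filter
      using eventually_nhds_pideal[of a r] eventually_nhds_pideal[of b r] by auto
    then show ?thesis
    proof (rule eventually_mono)
      fix x :: "'a \<times> 'a" assume "fst x - a \<in> pideal r \<and> snd x - b \<in> pideal r"
      then have *: "fst x - a \<in> pideal r" "snd x - b \<in> pideal r" by auto
      have "(fst x - a) * (snd x - b) + (a * (snd x - b) + b * (fst x - a)) \<in> pideal n"
        by (intro pideal_add pideal_mult'[OF *] pideal_mult'[OF pideal_self *(1)]
            pideal_mult'[OF pideal_self *(2)]) (use r in auto)
      then show "fst x * snd x - a * b \<in> pideal n" by (simp add: algebra_simps)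
    qed
  qed
  then show "((\<lambda>x. fst x * snd x) \<longlongrightarrow> a * b) (nhds a \<times>\<^sub>F nhds b)"
    by (simp add: tendsto_vball)
qed

lemma continuous_on_power2 [continuous_intros]:
  fixes f :: "_ \<Rightarrow> 'k::nonarch_local_field"
  shows "continuous_on S f \<Longrightarrow> continuous_on S (\<lambda>x. (f x)\<^sup>2)"
  unfolding power2_eq_square by (intro continuous_on_mult')

text \<open>Closed in a complete space, and totally bounded because every smaller radius needs
  finitely many subballs.\<close>

lemma compact_vball: "compact (vball n (x::'k::nonarch_local_field))"
  unfolding compact_eq_totally_bounded
proof (intro conjI allI impI)
  show "complete (vball n x)" by (simp add: complete_eq_closed)
next
  fix e :: real assume e: "e > 0"
  obtain m where m: "qres TYPE('k) powi (- m) < e"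
    using qres_powi_small[OF e] by blast
  obtain K where K: "finite K" "vball m ` vball n x = vball m ` K"
    using finite_subballs[of m n x] by (metis finite_subset_image subset_refl)
  have "y \<in> (\<Union>x\<in>K. ball x e)" if y: "y \<in> vball n x" for y
  proof -
    obtain z where z: "z \<in> K" "vball m y = vball m z" using K(2) y by blast
    then have "dist z y < e"
      using m dist_le_iff_pideal[of z y m] by (simp add: vball_eq_iff pideal_diff_commute)
    then show ?thesis using z by auto
  qed
  then show "\<exists>k. finite k \<and> vball n x \<subseteq> (\<Union>x\<in>k. ball x e)" using K(1) by blast
qed

lemma pideal_exhaust: "\<exists>n::nat. (x::'k::discrete_valued_field) \<in> pideal (- int n)"
  by (intro exI[of _ "nat (- val x)"]) (auto simp: pideal_def)

text \<open>\<open>k\<close> is exhausted by the ideals \<open>pideal (- m)\<close>, each a finite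
  union of balls. The covering argument for Haar measure on \<open>sl2\<close> rests on
  this.\<close>

lemma countable_vballs: "countable (range (vball n) :: 'k::nonarch_local_field set set)"
proof -
  have "range (vball n) \<subseteq> (\<Union>m::nat. vball n ` (pideal (- int m) :: 'k set))"
    using pideal_exhaust by blast
  moreover have "countable (vball n ` (pideal (- int m) :: 'k set))" for m
    by (intro countable_finite finite_vball_image[of _ "- int m" 0]) (simp add: vball_zero)
  ultimately show ?thesis by (meson countable_UN countable_subset uncountable_def countableI_type)
qed

section \<open>Square roots in odd residual characteristic\<close>

lemma val_two:
  assumes "(2::'k::discrete_valued_field) \<notin> maximal_ideal"
  shows "(2::'k) \<noteq> 0" "val (2::'k) = 0"
proof -
  show *: "(2::'k) \<noteq> 0" using assms by (auto simp: maximal_ideal_def)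
  have "(1::'k) + 1 \<in> pideal 0" by (intro pideal_add) (auto simp: pideal_def)
  then show "val (2::'k) = 0" using assms * by (auto simp: maximal_ideal_def pideal_def)
qed

text \<open>Hensel's lemma by Banach iteration: for a root \<open>1 + w\<close> the equation reads
  \<open>w = ((y - 1) - w^2) / 2\<close>, and on \<open>pideal 1\<close> the right side contracts by
  \<open>1 / q\<close> because 2 is a unit.\<close>

lemma unit_square_root:
  fixes y :: "'k::nonarch_local_field"
  assumes two: "(2::'k) \<notin> maximal_ideal" and y: "y \<in> vball 1 1"
  obtains d where "d\<^sup>2 = y" "d \<in> vball 1 1"
proof -
  note two' = val_two[OF two]
  define f where "f = (\<lambda>w::'k. ((y - 1) - w\<^sup>2) / 2)"
  have half: "x / 2 \<in> pideal n \<longleftrightarrow> x \<in> pideal n" for x :: 'k and n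
    using pideal_mult_iff[of "1/2::'k" x n] two' by (simp add: val_divide)
  have "\<exists>!w\<in>pideal 1. f w = w"
  proof (rule Banach_fix)
    show "complete (pideal 1 :: 'k set)" by (simp add: complete_eq_closed)
    show "(pideal 1 :: 'k set) \<noteq> {}" using pideal_0 by blast
    show "0 \<le> 1 / qres TYPE('k)" "1 / qres TYPE('k) < 1"
      using qres_gt_1[where ?'k = 'k] by auto
    show "f ` pideal 1 \<subseteq> pideal 1"
    proof safe
      fix w :: 'k assume w: "w \<in> pideal 1"
      have "w * w \<in> pideal 1" by (rule pideal_mult'[OF w w]) simp
      then show "f w \<in> pideal 1" unfolding f_def half
        using y pideal_diff[of "y - 1" 1 "w * w"] by (simp add: vball_iff power2_eq_square)
    qed
    fix v w :: 'k assume vw: "v \<in> pideal 1" "w \<in> pideal 1"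
    show "dist (f v) (f w) \<le> 1 / qres TYPE('k) * dist v w"
    \<comment> \<open>In both special cases \<open>f v = f w\<close>; otherwise \<open>v - w\<close>
      and \<open>v + w\<close> are non-zero, so that their valuations are meaningful.\<close>
    proof (cases "v = w \<or> v = - w")
      case True
      then show ?thesis by (auto simp: f_def)
    next
      case False
      then have nz: "v - w \<noteq> 0" "v + w \<noteq> 0" by (auto simp: add_eq_0_iff2)
      have eq: "f v - f w = - ((v - w) * (v + w) / 2)"
        unfolding f_def diff_divide_distrib[symmetric] minus_divide_left
        by (rule arg_cong[of _ _ "\<lambda>x. x / 2"]) (simp add: algebra_simps power2_eq_square)
      have "v + w \<in> pideal 1" using vw by (intro pideal_add) auto
      then have 1: "1 \<le> val (v + w)" using nz by (simp add: pideal_def)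
      have "val (f v - f w) = val (v - w) + val (v + w)"
        unfolding eq using nz two' by (simp add: val_divide val_mult)
      then have "- val (f v - f w) \<le> - val (v - w) + - 1" using 1 by simp
      then have "qres TYPE('k) powi (- val (f v - f w)) \<le> qres TYPE('k) powi (- val (v - w) + - 1)"
        using qres_gt_1[where ?'k = 'k] by (intro power_int_increasing) auto
      also have "\<dots> = 1 / qres TYPE('k) * qres TYPE('k) powi (- val (v - w))"
        using qres_gt_1[where ?'k = 'k] by (subst power_int_add) (auto simp: field_simps)
      finally show ?thesis using nz by (auto simp: dist_eq_abs_val abs_val_def)
    qed
  qed
  then obtain w where w: "w \<in> pideal 1" "f w = w" by blast
  have "y - 1 - w\<^sup>2 = w * 2"
    using w(2) two' by (simp add: f_def divide_eq_eq)
  then have "(1 + w)\<^sup>2 = y" by (simp add: algebra_simps power2_eq_square)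
  then show ?thesis using that[of "1 + w"] w by (simp add: vball_iff)
qed

text \<open>The quotient \<open>y / x\<close> lies in \<open>1 + p\<close> and so is a square. This
  is how the hypothesis on the residual characteristic reaches the norm groups and the orbit
  measure.\<close>

lemma square_multiple:
  fixes x y :: "'k::nonarch_local_field"
  assumes "(2::'k) \<notin> maximal_ideal" "x \<noteq> 0" "y \<in> vball (val x + 1) x"
  obtains d where "y = x * d\<^sup>2" "d \<noteq> 0" "val d = 0"
proof -
  have "x * (y / x - 1) = y - x" using assms by (simp add: field_simps)
  then have "x * (y / x - 1) \<in> pideal (val x + 1)" using assms by (simp add: vball_iff)
  then have "y / x \<in> vball 1 1"
    using pideal_mult_iff[OF assms(2), of "y / x - 1"] by (simp add: vball_iff)
  then obtain d where d: "d\<^sup>2 = y / x" "d \<in> vball 1 1"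
    using unit_square_root[OF assms(1)] by blast
  show ?thesis
    using that[of d] d assms vball_val[of 1 d] by simp
qed

section \<open>Haar measure and additive characters\<close>

lemma haar_sets_borel: "haar_measure_on UNIV \<nu> \<Longrightarrow> sets \<nu> = sets borel"
  by (simp add: haar_measure_on_def)

text \<open>Formulated for a set \<open>A\<close> so that it serves both \<open>k\<close> and
  \<open>sl2\<close>; invariance for image sets is turned into invariance under
  \<open>distr\<close>.\<close>

lemma haar_integral_translate:
  fixes f :: "'a::{ab_group_add, topological_space} \<Rightarrow> complex"
  assumes haar: "haar_measure_on A \<nu>" and a: "a \<in> A"
    and cont: "continuous_on UNIV ((+) a)" "continuous_on UNIV ((+) (-a))"
    and add: "\<And>x. a + x \<in> A \<longleftrightarrow> x \<in> A"
    and f: "f \<in> borel_measurable \<nu>"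
  shows "(LINT x|\<nu>. f (a + x)) = (LINT x|\<nu>. f x)"
proof -
  have sp: "space \<nu> = A" and sets: "sets \<nu> = sets (restrict_space borel A)"
    and inv: "\<And>S. S \<in> sets \<nu> \<Longrightarrow> emeasure \<nu> ((+) a ` S) = emeasure \<nu> S"
    using haar a unfolding haar_measure_on_def by auto
  have "(+) a \<in> measurable borel borel"
    using cont(1) by (rule borel_measurable_continuous_onI)
  then have "(+) a \<in> measurable (restrict_space borel A) (restrict_space borel A)"
    using add by (intro measurable_restrict_space3) auto
  then have meas: "(+) a \<in> measurable \<nu> \<nu>"
    using measurable_cong_sets[OF sets sets] by blast
  have "distr \<nu> \<nu> ((+) a) = \<nu>"
  proof (rule measure_eqI)
    fix S assume S: "S \<in> sets (distr \<nu> \<nu> ((+) a))"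
    let ?T = "(+) a -` S \<inter> space \<nu>"
    have T: "?T \<in> sets \<nu>" using meas S by (simp add: measurable_sets)
    have "S \<subseteq> A" using S sets.sets_into_space[of S \<nu>] sp by auto
    then have "(+) a ` ?T = S"
    proof -
      have "x \<in> (+) a ` ?T" if "x \<in> S" for x
        using that \<open>S \<subseteq> A\<close> add[of "x - a"] by (intro image_eqI[of _ _ "x - a"]) (auto simp: sp)
      then show ?thesis by auto
    qed
    then show "emeasure (distr \<nu> \<nu> ((+) a)) S = emeasure \<nu> S"
      using inv[OF T] S meas by (simp add: emeasure_distr)
  qed simp
  then show ?thesis
    using integral_distr[OF meas f] by simp
qed

text \<open>Translation by \<open>a\<close> multiplies the integral by \<open>c\<close> and yet
  preserves it: the source of the cancellations over \<open>k\<close> and over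
  \<open>sl2\<close>.\<close>

lemma additive_character_integral_eq_0:
  fixes f :: "'a::{ab_group_add, topological_space} \<Rightarrow> complex"
  assumes haar: "haar_measure_on A \<nu>" and a: "a \<in> A"
    and cont: "continuous_on UNIV ((+) a)" "continuous_on UNIV ((+) (-a))"
    and add: "\<And>x. a + x \<in> A \<longleftrightarrow> x \<in> A"
    and f: "f \<in> borel_measurable \<nu>"
    and eq: "\<And>x. x \<in> A \<Longrightarrow> f (a + x) = c * f x" and c: "c \<noteq> 1"
  shows "(LINT x|\<nu>. f x) = 0"
proof -
  have sp: "space \<nu> = A" using haar by (simp add: haar_measure_on_def)
  have "(LINT x|\<nu>. f x) = (LINT x|\<nu>. f (a + x))"
    using haar_integral_translate[OF haar a cont add f] by simp
  also have "\<dots> = (LINT x|\<nu>. c * f x)"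
    by (intro Bochner_Integration.integral_cong refl) (simp add: eq sp)
  finally show ?thesis using c by simp
qed

lemma continuous_on_plus_left: "continuous_on UNIV ((+) (a::'k::topological_ab_group_add))"
  by (intro continuous_intros)

locale haar_field =
  fixes dx :: "'k::nonarch_local_field measure" and q :: real
  assumes q_eq: "q = qres TYPE('k)"
    and haar: "haar_measure_on UNIV dx" and normal: "emeasure dx integer_ring = 1"
begin

lemma q_gt_1: "q > 1" using qres_gt_1[where ?'k = 'k] by (simp add: q_eq)

lemma q_powi_pos [simp]: "q powi n > 0"
  using q_gt_1 by (intro zero_less_power_int) auto

lemma q_powi_Suc: "q powi (n + 1) = q * q powi n"
  using q_gt_1 by (subst power_int_add) (auto simp: mult.commute)

lemma q_mult_powi: "q * q powi (- (n + 1)) = q powi (- n)"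
  using q_powi_Suc[of "- (n + 1)"] by simp

lemma sets_dx [measurable_cong]: "sets dx = sets borel" using haar by (rule haar_sets_borel)

lemma space_dx [simp]: "space dx = UNIV" using haar by (simp add: haar_measure_on_def)

lemma open_in_dx: "open S \<Longrightarrow> S \<in> sets dx" by (simp add: sets_dx)

lemma emeasure_vball_translate: "emeasure dx (vball n x) = emeasure dx (vball n 0)"
proof -
  have "vball n x = (+) x ` vball n 0" by (simp add: vball_image_plus)
  then show ?thesis using haar by (simp add: haar_measure_on_def sets_dx)
qed

text \<open>\<open>pideal n\<close> is the disjoint union of \<open>q\<close> translates of
  \<open>pideal (n + 1)\<close>.\<close>

lemma emeasure_pideal_step: "emeasure dx (pideal n) = ennreal q * emeasure dx (pideal (n + 1))"
proof -
  let ?P = "vball (n + 1) ` vball n (0::'k)"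
  have "emeasure dx (\<Union>P\<in>?P. P) = (\<Sum>P\<in>?P. emeasure dx P)"
  proof (intro sum_emeasure[symmetric])
    show "disjoint_family_on (\<lambda>P. P) ?P"
      using vball_disjoint by (auto simp: disjoint_family_on_def)
  qed (auto simp: finite_subballs sets_dx)
  also have "(\<Union>P\<in>?P. P) = pideal n"
    by (simp add: vball_zero, rule UN_vball, rule pideal_vball) auto
  also have "(\<Sum>P\<in>?P. emeasure dx P) = (\<Sum>P\<in>?P. emeasure dx (vball (n + 1) 0))"
    using emeasure_vball_translate by (intro sum.cong) auto
  finally show ?thesis using card_subballs[of n "0::'k"] by (simp add: vball_zero q_eq ennreal_of_nat_eq_real_of_nat)
qed

lemma emeasure_pideal: "emeasure dx (pideal n) = ennreal (q powi (- n))"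
proof (induction n rule: int_induct[where k = 0])
  case base
  then show ?case using normal by (simp add: integer_ring_eq)
next
  case (step1 i)
  have "ennreal q * emeasure dx (pideal (i + 1)) = ennreal q * ennreal (q powi (- (i + 1)))"
    using step1 emeasure_pideal_step[of i] q_gt_1
    by (simp only: ennreal_mult'[symmetric] q_mult_powi less_imp_le)
  then show ?case using q_gt_1 by (simp add: ennreal_mult_cancel_left)
next
  case (step2 i)
  then show ?case
    using emeasure_pideal_step[of "i - 1"] q_gt_1 q_powi_Suc[of "- i"]
    by (simp add: ennreal_mult'[symmetric])
qed

lemma emeasure_vball [simp]: "emeasure dx (vball n x) = ennreal (q powi (- n))"
  using emeasure_vball_translate emeasure_pideal by (simp add: vball_zero)

lemma measure_vball: "measure dx (vball n x) = q powi (- n)"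
  by (simp add: measure_def less_imp_le[OF q_powi_pos])

lemma integral_eq_0:
  fixes f :: "'k \<Rightarrow> complex"
  assumes "f \<in> borel_measurable borel" "\<And>x. f (a + x) = c * f x" "c \<noteq> 1"
  shows "(LINT x|dx. f x) = 0"
  using assms by (intro additive_character_integral_eq_0[OF haar, of a f c] continuous_on_plus_left)
    (auto simp: measurable_cong_sets[OF sets_dx refl])

lemma integrable_bounded:
  fixes f :: "'k \<Rightarrow> complex"
  assumes "f \<in> borel_measurable borel" "\<And>x. cmod (f x) \<le> B" "\<And>x. x \<notin> pideal n \<Longrightarrow> f x = 0"
  shows "integrable dx f"
proof (rule integrableI_bounded_set[of "pideal n" _ _ B])
  show "f \<in> borel_measurable dx" using assms(1) by (simp add: measurable_cong_sets[OF sets_dx refl])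
  show "emeasure dx (pideal n) < \<infinity>" by (simp add: emeasure_pideal)
qed (use assms in \<open>auto simp: sets_dx\<close>)

end

text \<open>Continuity makes \<open>\<Phi>\<close> close to 1 on some \<open>pideal n\<close>. If
  \<open>\<Phi>\<close> were non-trivial on this subgroup, its integral there would vanish, although
  its real part is at least 1/2. Enlarging the ideal as far as triviality permits gives
  \<open>m\<close>.\<close>

lemma conductor_exists:
  fixes \<Phi> :: "'k::nonarch_local_field \<Rightarrow> complex"
  assumes "haar_field (dx::'k measure) q" and char: "nontrivial_additive_character \<Phi>"
  obtains m where "\<And>x. x \<in> pideal m \<Longrightarrow> \<Phi> x = 1" "\<exists>z\<in>pideal (m - 1). \<Phi> z \<noteq> 1"
proof -
  interpret haar_field dx q by fact
  have cont: "continuous_on UNIV \<Phi>" and hom: "\<And>x y. \<Phi> (x + y) = \<Phi> x * \<Phi> y"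
    and nontriv: "\<exists>x. \<Phi> x \<noteq> 1" and norm: "\<And>x. cmod (\<Phi> x) = 1"
    using char by (auto simp: nontrivial_additive_character_def)
  have "\<Phi> 0 = 1" using hom[of 0 0] norm[of 0] by auto
  have "open (\<Phi> -` ball 1 (1/2))" using cont by (intro open_vimage) auto
  moreover have "0 \<in> \<Phi> -` ball 1 (1/2)" using \<open>\<Phi> 0 = 1\<close> by simp
  ultimately obtain n where n: "vball n 0 \<subseteq> \<Phi> -` ball 1 (1/2)"
    unfolding open_iff_vball by blast
  have triv: "\<Phi> y = 1" if y: "y \<in> pideal n" for y
  proof (rule ccontr)
    assume *: "\<Phi> y \<noteq> 1"
    let ?f = "\<lambda>x. indicator (pideal n) x * \<Phi> x"
    have meas: "?f \<in> borel_measurable borel"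
      using borel_measurable_continuous_onI[OF cont] by (intro borel_measurable_times borel_measurable_indicator) auto
    have int: "integrable dx ?f"
      using norm by (intro integrable_bounded[OF meas, of 1 n]) (auto simp: indicator_def)
    have "?f (y + x) = \<Phi> y * ?f x" for x
      using y pideal_add[of y n x] pideal_diff[of "y + x" n y] by (auto simp: indicator_def hom)
    then have "(LINT x|dx. ?f x) = 0" by (rule integral_eq_0[OF meas _ *])
    moreover have "Re (LINT x|dx. ?f x) \<ge> (LINT x|dx. indicator (pideal n) x * (1/2))"
      unfolding integral_Re[OF int, symmetric]
    proof (intro integral_mono)
      show "integrable dx (\<lambda>x. indicator (pideal n) x * (1 / 2) :: real)"
        by (intro integrable_mult_left integrable_real_indicator) (auto simp: emeasure_pideal sets_dx)
      show "integrable dx (\<lambda>x. Re (?f x))" using int by (rule integrable_Re)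
      fix x
      show "indicator (pideal n) x * (1 / 2) \<le> Re (?f x)"
      proof (cases "x \<in> pideal n")
        case True
        then have "cmod (1 - \<Phi> x) < 1/2" using n by (auto simp: vball_zero dist_norm)
        then have "\<bar>Re (1 - \<Phi> x)\<bar> < 1/2" using abs_Re_le_cmod le_less_trans by blast
        then show ?thesis using True by (simp add: abs_if split: if_splits)
      qed simp
    qed
    moreover have "(LINT x|dx. indicator (pideal n) x * (1/2)) = q powi (-n) * (1/2)"
      using measure_vball[of n 0] by (simp add: vball_zero sets_dx)
    ultimately show False using q_powi_pos[of "-n"] by simp
  qed
  obtain y where y: "\<Phi> y \<noteq> 1" using nontriv by blast
  \<comment> \<open>\<open>i\<close> counts how far \<open>pideal n\<close> can be enlarged; an
    element \<open>y\<close> with \<open>\<Phi> y \<noteq> 1\<close> bounds it, so a maximum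
    exists.\<close>
  define S where "S = {i::nat. \<forall>x\<in>pideal (n - int i). \<Phi> x = 1}"
  have "i \<le> nat (n - val y)" if "i \<in> S" for i
  proof (rule ccontr)
    assume "\<not> ?thesis"
    then have "n - int i \<le> val y" by linarith
    then have "y \<in> pideal (n - int i)" by (simp add: pideal_def)
    then show False using that y by (auto simp: S_def)
  qed
  then have fin: "finite S" by (meson finite_nat_set_iff_bounded_le)
  have "0 \<in> S" using triv by (simp add: S_def)
  then have "Max S \<in> S" "Suc (Max S) \<notin> S"
    using Max_in[OF fin] Max_ge[OF fin, of "Suc (Max S)"] by auto
  then show ?thesis using that[of "n - int (Max S)"] by (auto simp: S_def algebra_simps)
qed

section \<open>Oscillation of the quadratic phase\<close>

lemma pideal_diff_iff: "y \<in> pideal n \<Longrightarrow> x - y \<in> pideal n \<longleftrightarrow> x \<in> pideal n"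
  using pideal_diff[of x n y] pideal_add[of "x - y" n y] by auto

section \<open>Step functions on balls of a fixed radius\<close>

text \<open>Sums run over balls as sets, so that each ball is counted once; a centre has to be
  chosen back from the set.\<close>

definition ball_rep :: "'a set \<Rightarrow> 'a" where
  "ball_rep P = (SOME x. x \<in> P)"

lemma ball_rep_vball: "ball_rep (vball r x) \<in> vball r x"
  unfolding ball_rep_def by (rule someI[of _ x]) simp

lemma sum_indicator_vballs:
  assumes "finite (vball r ` S)" "\<And>x. x \<in> S \<Longrightarrow> vball r x \<subseteq> S"
  shows "(\<Sum>P\<in>vball r ` S. indicator P x * g P) =
    indicator S x * (g (vball r x) :: 'b::semiring_1)"
proof (cases "x \<in> S")
  case True
  have "indicator P x * g P = 0" if "P \<in> vball r ` S - {vball r x}" for P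
    using that vball_eqI by (auto simp: indicator_def)
  then have "(\<Sum>P\<in>vball r ` S. indicator P x * g P) = (\<Sum>P\<in>{vball r x}. indicator P x * g P)"
    using True assms by (intro sum.mono_neutral_right) auto
  then show ?thesis using True by simp
next
  case False
  then have "indicator P x * g P = 0" if "P \<in> vball r ` S" for P
    using that assms(2) by (auto simp: indicator_def)
  then show ?thesis using False by simp
qed

text \<open>Only the ball around \<open>x\<close> contributes, and there \<open>f\<close> may be
  read off at the chosen centre. Integrals of locally constant functions over \<open>k\<close>
  become finite sums in this way.\<close>

lemma step_decomposition:
  fixes f :: "'k::discrete_valued_field \<Rightarrow> complex"
  assumes "finite (vball r ` S)" "\<And>x. x \<in> S \<Longrightarrow> vball r x \<subseteq> S"
    and "\<And>x y. x \<in> S \<Longrightarrow> y \<in> vball r x \<Longrightarrow> f y = f x"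
  shows "indicator S x * f x = (\<Sum>P\<in>vball r ` S. indicator P x * f (ball_rep P))"
  unfolding sum_indicator_vballs[OF assms(1,2), of x "\<lambda>P. f (ball_rep P)", simplified]
  using assms(3)[of x "ball_rep (vball r x)"] ball_rep_vball[of r x]
  by (cases "x \<in> S") auto

lemma has_bochner_integral_indicator_times:
  assumes "A \<in> sets M" "emeasure M A < \<infinity>"
  shows "has_bochner_integral M (\<lambda>x. indicator A x * (c::complex)) (complex_of_real (measure M A) * c)"
proof -
  have "(\<lambda>x. indicator A x * c) = (\<lambda>x. indicator A x *\<^sub>R c)" by (auto simp: indicator_def)
  then show ?thesis
    using has_bochner_integral_indicator[of A M c] assms by (simp add: scaleR_conv_of_real)
qed

context haar_field
begin

lemma norm_integral_pideal_le:
  fixes g :: "'k \<Rightarrow> complex"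
  assumes "g \<in> borel_measurable borel" "\<And>x. cmod (g x) \<le> 1" "S \<in> sets borel" "S \<subseteq> pideal l"
  shows "cmod (LINT x|dx. indicator S x * g x) \<le> q powi (- l)"
proof -
  have "cmod (LINT x|dx. indicator S x * g x) \<le> (LINT x|dx. cmod (indicator S x * g x))"
    by (rule integral_norm_bound)
  also have "\<dots> \<le> (LINT x|dx. indicator (pideal l) x)"
  proof (intro integral_mono integrable_norm)
    show "integrable dx (\<lambda>x. indicator S x * g x)"
      using assms by (intro integrable_bounded[of _ 1 l]) (auto simp: indicator_def)
    show "integrable dx (indicator (pideal l) :: _ \<Rightarrow> real)"
      by (intro integrable_real_indicator) (auto simp: emeasure_pideal sets_dx)
  qed (use assms in \<open>auto simp: indicator_def\<close>)
  finally show ?thesis using measure_vball[of l 0] by (simp add: vball_zero sets_dx)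
qed

lemma vball_integral:
  "has_bochner_integral dx (\<lambda>x. indicator (vball r y) x * (c::complex)) (complex_of_real (q powi (- r)) * c)"
  using has_bochner_integral_indicator_times[of "vball r y" dx c] by (simp add: open_in_dx measure_vball)

lemma integral_step:
  "has_bochner_integral dx (\<lambda>x. \<Sum>P\<in>vball r ` S. indicator P x * (g P :: complex))
     (\<Sum>P\<in>vball r ` S. complex_of_real (q powi (- r)) * g P)"
  by (rule has_bochner_integral_sum) (use vball_integral in auto)

lemma integral_locally_constant:
  fixes f :: "'k \<Rightarrow> complex"
  assumes "finite (vball r ` S)" "\<And>x. x \<in> S \<Longrightarrow> vball r x \<subseteq> S"
    and "\<And>x y. x \<in> S \<Longrightarrow> y \<in> vball r x \<Longrightarrow> f y = f x"
  shows "(LINT x|dx. indicator S x * f x) =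
     (\<Sum>P\<in>vball r ` S. complex_of_real (q powi (- r)) * f (ball_rep P))"
proof -
  have "indicator S x * f x = (\<Sum>P\<in>vball r ` S. indicator P x * f (ball_rep P))" for x
    by (rule step_decomposition[OF assms])
  then show ?thesis using has_bochner_integral_integral_eq[OF integral_step] by simp
qed

lemma borel_measurable_step:
  "(\<lambda>x. \<Sum>P\<in>vball r ` S. indicator P (x::'k) * (g P :: complex)) \<in> borel_measurable borel"
  by (intro borel_measurable_sum borel_measurable_times borel_measurable_indicator) auto

text \<open>The density \<open>|x|^-1\<close> equals \<open>q^n\<close> on the whole shell;
  constancy at radius \<open>r\<close> supplies the measurability that the change of density asks
  for.\<close>

lemma integral_mult_measure_shell:
  fixes f :: "'k \<Rightarrow> complex"
  assumes "n < r" "\<And>x y. x \<in> shell n \<Longrightarrow> y \<in> vball r x \<Longrightarrow> f y = f x"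
  shows "(LINT x:shell n|mult_measure dx. f x) = 
     complex_of_real (q powi n) * (LINT x|dx. indicator (shell n) x * f x)"
proof -
  have fin: "finite (vball r ` (shell n :: 'k set))"
    by (rule finite_vball_image[of _ n 0]) (simp add: vball_zero shell_eq)
  have step: "indicator (shell n) x * f x = (\<Sum>P\<in>vball r ` shell n. indicator P x * f (ball_rep P))" for x
    by (rule step_decomposition[OF fin shell_vball[OF _ assms(1)] assms(2)])
  have meas: "(\<lambda>x. indicator (shell n) x * f x) \<in> borel_measurable dx"
    unfolding step by (simp add: measurable_cong_sets[OF sets_dx refl] borel_measurable_step)
  have eq: "indicator (shell n) x *\<^sub>R f x = indicator (shell n) x * f x" for x
    by (simp add: indicator_def)
  have abs: "abs_val \<in> borel_measurable dx"
  proof -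
    have "abs_val = (\<lambda>x::'k. dist x 0)" by (simp add: dist_eq_abs_val fun_eq_iff)
    moreover have "(\<lambda>x::'k. dist x 0) \<in> borel_measurable borel"
      by (intro borel_measurable_continuous_onI continuous_intros)
    ultimately show ?thesis by (simp add: measurable_cong_sets[OF sets_dx refl])
  qed
  have "(LINT x:shell n|mult_measure dx. f x) =
      (LINT x|density dx (\<lambda>x. ennreal (inverse (abs_val x))). indicator (shell n) x * f x)"
    by (simp add: set_lebesgue_integral_def eq mult_measure_def)
  also have "\<dots> = (LINT x|dx. inverse (abs_val x) *\<^sub>R (indicator (shell n) x * f x))"
  proof (rule integral_density[OF meas])
    show "(\<lambda>x. inverse (abs_val x)) \<in> borel_measurable dx" using abs by measurable
  qed (simp add: abs_val_def)
  also have "\<dots> = (LINT x|dx. complex_of_real (q powi n) * (indicator (shell n) x * f x))"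
    by (intro Bochner_Integration.integral_cong refl)
      (auto simp: indicator_def shell_def abs_val_def q_eq power_int_minus scaleR_conv_of_real)
  finally show ?thesis by simp
qed

end

section \<open>The quadratic phase\<close>

text \<open>In the theorem \<open>\<psi> y = \<Phi> (\<beta> * s * y)\<close>, so that the scalars
  disappear from the phase; \<open>m\<close> is the conductor exponent of
  \<open>\<psi>\<close>.\<close>

locale orbit_phase = haar_field dx q for dx :: "'k::nonarch_local_field measure" and q +
  fixes \<psi> :: "'k \<Rightarrow> complex" and m :: int and \<theta> \<theta>' :: 'k
  assumes two: "(2::'k) \<notin> maximal_ideal"
    and psi_cont: "continuous_on UNIV \<psi>"
    and psi_norm: "cmod (\<psi> x) = 1"
    and psi_add: "\<psi> (x + y) = \<psi> x * \<psi> y"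
    and psi_trivial: "x \<in> pideal m \<Longrightarrow> \<psi> x = 1"
    and psi_nontrivial: "\<exists>z\<in>pideal (m - 1). \<psi> z \<noteq> 1"
    and theta: "\<theta> \<noteq> 0" "0 \<le> val \<theta>"
begin

definition phase :: "'k \<Rightarrow> 'k \<Rightarrow> complex" where
  "phase x t = \<psi> (x * \<theta>' + inverse x * \<theta> - inverse x * t\<^sup>2)"

lemma psi_meas [measurable]: "\<psi> \<in> borel_measurable borel"
  using psi_cont by (rule borel_measurable_continuous_onI)

lemma psi_cong: "x - y \<in> pideal m \<Longrightarrow> \<psi> x = \<psi> y"
  using psi_add[of "x - y" y] psi_trivial by simp

lemma phase_meas [measurable]: "phase x \<in> borel_measurable borel"
proof -
  have "continuous_on UNIV (\<psi> \<circ> (\<lambda>t. x * \<theta>' + inverse x * \<theta> - inverse x * t\<^sup>2))"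
    by (intro continuous_on_compose continuous_intros continuous_on_subset[OF psi_cont]) auto
  then show ?thesis
    by (intro borel_measurable_continuous_onI) (simp add: phase_def[abs_def] comp_def)
qed

lemma phase_norm [simp]: "cmod (phase x t) = 1" by (simp add: phase_def psi_norm)

lemma psi_witness: obtains z where "z \<noteq> 0" "val z = m - 1" "\<psi> z \<noteq> 1"
proof -
  obtain z where z: "z \<in> pideal (m - 1)" "\<psi> z \<noteq> 1" using psi_nontrivial by blast
  then have "z \<notin> pideal m" using psi_trivial by blast
  then show ?thesis using z that[of z] by (auto simp: pideal_def)
qed

text \<open>
  A shift of \<open>t\<close> by \<open>h\<close> with \<open>val h = m - 1 + n - l\<close> changes the phase by the character value
  \<open>\<psi> (- 2 t h / x)\<close>, which is constant and can be made different from 1 on each ball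
  \<open>vball (l + 1) t\<close>.
\<close>

lemma phase_oscillation:
  assumes x: "x \<in> shell n" and l: "2 * l \<le> m + n - 2" and T: "T \<in> sets borel"
    and stable: "\<And>t h. t \<in> shell l \<Longrightarrow> h \<in> pideal (m - 1 + n - l) \<Longrightarrow> h + t \<in> T \<longleftrightarrow> t \<in> T"
  shows "(LINT t|dx. indicator (shell l \<inter> T) t * phase x t) = 0"
proof -
  note two' = val_two[OF two]
  have x': "x \<noteq> 0" "val x = n" using x by (auto simp: shell_def)
  obtain z where z: "z \<noteq> 0" "val z = m - 1" "\<psi> z \<noteq> 1" by (rule psi_witness)
  have zero: "(LINT t|dx. indicator (vball (l + 1) t0 \<inter> T) t * phase x t) = 0"
    if t0: "t0 \<in> shell l" for t0
  proof -
    define h where "h = - (x * z) / (2 * t0)"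
    have t0': "t0 \<noteq> 0" "val t0 = l" using t0 by (auto simp: shell_def)
    have h: "h \<noteq> 0" "val h = m - 1 + n - l"
      using x' z t0' two' by (auto simp: h_def val_divide val_mult)
    \<comment> \<open>The bound \<open>2 l \<le> m + n - 2\<close> says exactly that
      \<open>m - 1 + n - l \<ge> l + 1\<close>, so the shift by \<open>h\<close> maps the ball to
      itself.\<close>
    have hl: "h \<in> pideal (l + 1)" using h l by (simp add: pideal_def)
    have hh: "h \<in> pideal (m - 1 + n - l)" using h by (simp add: pideal_def)
    have shift: "indicator (vball (l + 1) t0 \<inter> T) (h + t) * phase x (h + t) =
        \<psi> z * (indicator (vball (l + 1) t0 \<inter> T) t * phase x t)" for t
    proof (cases "t \<in> vball (l + 1) t0")
      case True
      have "t \<in> shell l" using shell_vball[OF t0, of "l + 1"] True by auto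
      then have "h + t \<in> T \<longleftrightarrow> t \<in> T" using stable hh by blast
      moreover have "h + t \<in> vball (l + 1) t0"
        using True pideal_add[OF hl, of "t - t0"] by (simp add: vball_iff algebra_simps)
      moreover have "phase x (h + t) = \<psi> z * phase x t"
      proof -
        have inv: "inverse x \<in> pideal (- n)" using x' by (simp add: pideal_def val_inverse)
        have 1: "2 * (t - t0) + h \<in> pideal (l + 1)"
          using True hl two' by (intro pideal_add pideal_mult'[of 2 0]) (auto simp: vball_iff pideal_def)
        \<comment> \<open>Beyond the linear term at \<open>t0\<close> the error has valuation at
          least \<open>- n + (m - 1 + n - l) + (l + 1) = m\<close>, invisible to
          \<open>\<psi>\<close>.\<close>
        have "inverse x * (h * (2 * (t - t0) + h)) \<in> pideal m"
          by (rule pideal_mult'[OF inv pideal_mult'[OF hh 1 order_refl]]) simp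
        moreover have "x * \<theta>' + inverse x * \<theta> - inverse x * (h + t)\<^sup>2 -
            (z + (x * \<theta>' + inverse x * \<theta> - inverse x * t\<^sup>2)) =
            - (inverse x * (h * (2 * (t - t0) + h))) - inverse x * (2 * t0 * h) - z"
          by (simp add: power2_eq_square algebra_simps)
        moreover have "inverse x * (2 * t0 * h) = - z"
          using x' t0' two' by (simp add: h_def field_simps)
        ultimately show ?thesis
          unfolding phase_def psi_add[symmetric] by (intro psi_cong) simp
      qed
      ultimately show ?thesis using True by (simp add: indicator_def)
    next
      case False
      then have "h + t \<notin> vball (l + 1) t0"
        using pideal_diff[OF _ hl, of "h + t - t0"] by (auto simp: vball_iff algebra_simps)
      then show ?thesis using False by simp
    qed
    show ?thesis
      by (rule integral_eq_0[where f = "\<lambda>t. indicator (vball (l + 1) t0 \<inter> T) t * phase x t", OF _ shift z(3)])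
        (use T in \<open>auto intro!: borel_measurable_times borel_measurable_indicator\<close>)
  qed
  have fin: "finite (vball (l + 1) ` (shell l :: 'k set))"
    by (rule finite_vball_image[of _ l 0]) (simp add: vball_zero shell_eq)
  have int: "integrable dx (\<lambda>t. indicator (P \<inter> T) t * phase x t)" if "P \<in> vball (l + 1) ` shell l" for P
  proof (rule integrable_bounded[of _ 1 l])
    have "P \<subseteq> pideal l" using that shell_vball[of _ l "l + 1"] by (auto simp: shell_eq)
    then show "indicator (P \<inter> T) t * phase x t = 0" if "t \<notin> pideal l" for t
      using that by (auto simp: indicator_def)
    show "(\<lambda>t. indicator (P \<inter> T) t * phase x t) \<in> borel_measurable borel"
      using T \<open>P \<in> _\<close> by (intro borel_measurable_times borel_measurable_indicator) auto
  qed (simp add: indicator_def)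
  have "indicator (shell l \<inter> T) t * phase x t =
      (\<Sum>P\<in>vball (l + 1) ` shell l. indicator (P \<inter> T) t * phase x t)" for t
    unfolding indicator_inter_arith mult.assoc
    by (rule sum_indicator_vballs[OF fin, symmetric], rule shell_vball) auto
  then have "(LINT t|dx. indicator (shell l \<inter> T) t * phase x t) =
      (\<Sum>P\<in>vball (l + 1) ` shell l. LINT t|dx. indicator (P \<inter> T) t * phase x t)"
    using Bochner_Integration.integral_sum[OF int] by simp
  also have "\<dots> = 0" using zero by (intro sum.neutral) auto
  finally show ?thesis .
qed

text \<open>The least \<open>l\<close> not reached by oscillation, that is, the least with
  \<open>2 l \<ge> m + n - 1\<close>.\<close>

definition shell_start :: "int \<Rightarrow> int" where
  "shell_start n = (m + n) div 2"

lemma shell_start_iff: "l < shell_start n \<longleftrightarrow> 2 * l \<le> m + n - 2"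
  unfolding shell_start_def by linarith

lemma indicator_pideal_split:
  assumes "i \<le> j"
  shows "(indicator (pideal i) t :: complex) =
    indicator (pideal j) t + (\<Sum>l\<in>{i..<j}. indicator (shell l) (t::'k))"
proof (cases "t \<in> pideal i \<and> t \<notin> pideal j")
  case True
  then have "t \<noteq> 0" "val t \<in> {i..<j}" by (auto simp: pideal_def)
  then have "(\<Sum>l\<in>{i..<j}. indicator (shell l) t :: complex) = (\<Sum>l\<in>{val t}. 1)"
    by (intro sum.mono_neutral_cong_right) (auto simp: shell_def indicator_def)
  then show ?thesis using True by simp
next
  case False
  then have "(\<Sum>l\<in>{i..<j}. indicator (shell l) t :: complex) = 0"
    by (intro sum.neutral) (auto simp: shell_def indicator_def pideal_def)
  then show ?thesis using False assms pideal_mono[of i j t] by (auto simp: indicator_def)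
qed

lemma integrable_phase:
  assumes "S \<in> sets borel" "S \<subseteq> pideal i"
  shows "integrable dx (\<lambda>t. indicator S t * phase x t)"
  using assms by (intro integrable_bounded[of _ 1 i] borel_measurable_times borel_measurable_indicator)
    (auto simp: indicator_def)

lemma integral_phase_split:
  assumes "i \<le> j" "T \<in> sets borel"
  shows "(LINT t|dx. indicator (pideal i \<inter> T) t * phase x t) =
    (LINT t|dx. indicator (pideal j \<inter> T) t * phase x t) +
    (\<Sum>l\<in>{i..<j}. LINT t|dx. indicator (shell l \<inter> T) t * phase x t)"
proof -
  have "indicator (pideal i \<inter> T) t * phase x t = indicator (pideal j \<inter> T) t * phase x t +
      (\<Sum>l\<in>{i..<j}. indicator (shell l \<inter> T) t * phase x t)" for t
    unfolding indicator_inter_arith indicator_pideal_split[OF assms(1)]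
    by (simp only: ring_distribs sum_distrib_right)
  moreover have 1: "integrable dx (\<lambda>t. indicator (shell l \<inter> T) t * phase x t)" for l
    using assms by (intro integrable_phase[of _ l]) (auto simp: shell_eq[of l])
  moreover have 2: "integrable dx (\<lambda>t. indicator (pideal j \<inter> T) t * phase x t)"
    using assms by (intro integrable_phase[of _ j]) auto
  ultimately show ?thesis
    by (simp only: Bochner_Integration.integral_add[OF 2 Bochner_Integration.integrable_sum[OF 1]]
        Bochner_Integration.integral_sum[OF 1])
qed

text \<open>For \<open>b = x\<close> in the shell \<open>n\<close>, the equation
  \<open>b c = \<theta> - a^2\<close> turns a bound on the third coordinate into
  \<open>\<theta> - t^2 \<in> pideal (n - c)\<close>. This condition holds throughout
  \<open>pideal (shell_start n)\<close> and is stable under the oscillating shifts on the shells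
  outside, so those cancel even after truncation.\<close>

lemma truncated_inner_integral:
  assumes x: "x \<in> shell n" and c: "1 - m \<le> c" and n: "n \<le> c + val \<theta>" and a: "- a \<le> shell_start n"
  shows "(LINT t|dx. indicator (pideal (- a) \<inter> {t. \<theta> - t\<^sup>2 \<in> pideal (n - c)}) t * phase x t) =
    (LINT t|dx. indicator (pideal (shell_start n)) t * phase x t)"
proof -
  let ?T = "{t. \<theta> - t\<^sup>2 \<in> pideal (n - c)}"
  have "open ((\<lambda>t. \<theta> - t\<^sup>2) -` pideal (n - c))"
    by (intro open_vimage continuous_intros) auto
  then have T: "?T \<in> sets borel" by (simp add: vimage_def)
  have "pideal (shell_start n) \<inter> ?T = pideal (shell_start n)"
  proof -
    have "\<theta> - t\<^sup>2 \<in> pideal (n - c)" if "t \<in> pideal (shell_start n)" for t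
    proof (rule pideal_diff)
      show "\<theta> \<in> pideal (n - c)" using n theta by (simp add: pideal_def)
      have "t = 0 \<or> \<not> val t < shell_start n" using that by (auto simp: pideal_def)
      then show "t\<^sup>2 \<in> pideal (n - c)" using c by (auto simp: pideal_square_iff shell_start_iff)
    qed
    then show ?thesis by blast
  qed
  moreover have "(LINT t|dx. indicator (shell l \<inter> ?T) t * phase x t) = 0"
    if "l \<in> {- a..<shell_start n}" for l
  proof (rule phase_oscillation[OF x _ T])
    show l: "2 * l \<le> m + n - 2" using that by (simp add: shell_start_iff[symmetric])
    fix t h :: 'k assume t: "t \<in> shell l" and h: "h \<in> pideal (m - 1 + n - l)"
    have hl: "h \<in> pideal l" using pideal_mono[OF _ h, of l] l by simp
    have "2 * t + h \<in> pideal l"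
      using t hl val_two[OF two] by (intro pideal_add pideal_mult'[of 2 0]) (auto simp: shell_eq pideal_def)
    then have "h * (2 * t + h) \<in> pideal (n - c)"
      using h c by (intro pideal_mult'[OF h]) auto
    then have "\<theta> - t\<^sup>2 - h * (2 * t + h) \<in> pideal (n - c) \<longleftrightarrow> \<theta> - t\<^sup>2 \<in> pideal (n - c)"
      by (rule pideal_diff_iff)
    moreover have "\<theta> - (h + t)\<^sup>2 = \<theta> - t\<^sup>2 - h * (2 * t + h)"
      by (simp add: power2_eq_square algebra_simps)
    ultimately show "h + t \<in> ?T \<longleftrightarrow> t \<in> ?T" by (simp only: mem_Collect_eq)
  qed
  ultimately show ?thesis using integral_phase_split[OF a T] by simp
qed

text \<open>The shells below \<open>shell_start n\<close> cancel; the others telescope with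
  remainder \<open>g\<close>, an integral over an ideal of vanishing volume. The geometric volume
  bound also gives the absolute summability that an unordered sum demands.\<close>

lemma inner_sum:
  assumes x: "x \<in> shell n"
  shows "(\<Sum>\<^sub>\<infinity>l::int. LINT t:shell l|dx. phase x t) =
    (LINT t|dx. indicator (pideal (shell_start n)) t * phase x t)"
proof -
  define l0 where "l0 = shell_start n"
  define f where "f l = (LINT t|dx. indicator (shell l) t * phase x t)" for l
  define g where "g l = (LINT t|dx. indicator (pideal l) t * phase x t)" for l
  have f: "(LINT t:shell l|dx. phase x t) = f l" for l
    unfolding set_lebesgue_integral_def f_def
    by (intro Bochner_Integration.integral_cong) (auto simp: indicator_def)
  have zero: "f l = 0" if "l < l0" for l
    using phase_oscillation[OF x, of l UNIV] that by (simp add: f_def l0_def shell_start_iff)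
  have partial: "(\<Sum>k<K. f (l0 + int k)) = g l0 - g (l0 + int K)" for K
  proof (induction K)
    case (Suc K)
    have "g (l0 + int K) = g (l0 + int (Suc K)) + (\<Sum>l\<in>{l0 + int K..<l0 + int (Suc K)}. f l)"
      using integral_phase_split[of "l0 + int K" "l0 + int (Suc K)" UNIV x] by (simp add: g_def f_def)
    moreover have "{l0 + int K..<l0 + int (Suc K)} = {l0 + int K}" by auto
    ultimately show ?case using Suc by simp
  qed simp
  have small: "cmod (f l) \<le> q powi (- l)" "cmod (g l) \<le> q powi (- l)" for l
    unfolding f_def g_def by (intro norm_integral_pideal_le; auto simp: shell_eq[of l])+
  have powi: "q powi (- (l0 + int k)) = q powi (- l0) * inverse q ^ k" for k
    using q_gt_1 by (simp add: power_int_add power_int_diff power_int_minus field_simps)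
  have geom: "(\<lambda>k. q powi (- (l0 + int k))) \<longlonglongrightarrow> 0"
    unfolding powi using q_gt_1
    by (intro tendsto_mult_right_zero LIMSEQ_realpow_zero) (auto simp: inverse_less_1_iff)
  have "(\<lambda>k. g (l0 + int k)) \<longlonglongrightarrow> 0"
    by (rule Lim_null_comparison[OF _ geom]) (intro always_eventually allI small(2))
  then have "(\<lambda>k. f (l0 + int k)) sums g l0"
    unfolding sums_def partial using tendsto_diff[of "\<lambda>_. g l0" "g l0" sequentially "\<lambda>k. g (l0 + int k)" 0]
    by simp
  moreover have "summable (\<lambda>k. norm (f (l0 + int k)))"
  proof (rule summable_comparison_test')
    show "summable (\<lambda>k. q powi (- (l0 + int k)))"
      unfolding powi using q_gt_1 by (intro summable_mult summable_geometric) (auto simp: inverse_less_1_iff)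
    show "norm (norm (f (l0 + int k))) \<le> q powi (- (l0 + int k))" if "k \<ge> 0" for k
      using small(1)[of "l0 + int k"] by simp
  qed
  ultimately have "((\<lambda>k. f (l0 + int k)) has_sum g l0) UNIV"
    by (rule norm_summable_imp_has_sum[rotated])
  then have "(f has_sum g l0) ((\<lambda>k. l0 + int k) ` UNIV)"
    by (subst has_sum_reindex) (auto simp: inj_def comp_def)
  moreover have "(\<lambda>k. l0 + int k) ` UNIV = {l0..}"
  proof -
    have "l \<in> (\<lambda>k. l0 + int k) ` UNIV" if "l0 \<le> l" for l
      using that by (intro image_eqI[of _ _ "nat (l - l0)"]) auto
    then show ?thesis by auto
  qed
  ultimately have "(f has_sum g l0) UNIV"
    using has_sum_cong_neutral[of UNIV "{l0..}" f f "g l0"] zero by (auto simp: not_le)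
  then show ?thesis unfolding f by (simp add: infsumI g_def l0_def)
qed

end

section \<open>Invariant measures on the orbit\<close>

definition norm_group :: "'k::field \<Rightarrow> 'k set" where
  "norm_group \<theta> = quad_norm \<theta> ` quad_units \<theta>"

text \<open>Multiplicativity shows that a unit has non-zero norm; conversely the conjugate divided
  by the norm is an inverse. Both arguments cover square \<open>\<theta>\<close>.\<close>

lemma norm_group_iff: "x \<in> norm_group \<theta> \<longleftrightarrow> x \<noteq> 0 \<and> (\<exists>a b. x = a\<^sup>2 - b\<^sup>2 * \<theta>)"
proof
  assume "x \<in> norm_group \<theta>"
  then obtain z w where z: "x = quad_norm \<theta> z" "quad_mult \<theta> z w = (1, 0)"
    by (auto simp: norm_group_def quad_units_def)
  have "quad_norm \<theta> z * quad_norm \<theta> w = quad_norm \<theta> (quad_mult \<theta> z w)"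
    by (simp add: quad_norm_def quad_mult_def power2_eq_square algebra_simps)
  then have "x * quad_norm \<theta> w = 1" by (simp add: z quad_norm_def)
  then show "x \<noteq> 0 \<and> (\<exists>a b. x = a\<^sup>2 - b\<^sup>2 * \<theta>)"
    using z(1) by (auto simp: quad_norm_def)
next
  assume "x \<noteq> 0 \<and> (\<exists>a b. x = a\<^sup>2 - b\<^sup>2 * \<theta>)"
  then obtain a b where ab: "x \<noteq> 0" "x = a\<^sup>2 - b\<^sup>2 * \<theta>" by blast
  have "quad_mult \<theta> (a, b) (a / x, - b / x) = ((a\<^sup>2 - b\<^sup>2 * \<theta>) / x, 0)"
    by (simp add: quad_mult_def power2_eq_square diff_divide_distrib algebra_simps)
  then have "(a, b) \<in> quad_units \<theta>" using ab by (auto simp: quad_units_def)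
  then show "x \<in> norm_group \<theta>" using ab by (auto simp: norm_group_def quad_norm_def intro!: image_eqI)
qed

lemma norm_group_square: "d \<noteq> 0 \<Longrightarrow> x * d\<^sup>2 \<in> norm_group \<theta> \<longleftrightarrow> x \<in> norm_group \<theta>"
proof -
  have *: "x * d\<^sup>2 \<in> norm_group \<theta>" if "x \<in> norm_group \<theta>" "d \<noteq> 0" for x d
  proof -
    obtain a b where ab: "x \<noteq> 0" "x = a\<^sup>2 - b\<^sup>2 * \<theta>"
      using \<open>x \<in> _\<close> by (auto simp: norm_group_iff)
    have "(a\<^sup>2 - b\<^sup>2 * \<theta>) * d\<^sup>2 = (a * d)\<^sup>2 - (b * d)\<^sup>2 * \<theta>"
      by (simp add: power_mult_distrib algebra_simps)
    then have "x * d\<^sup>2 = (a * d)\<^sup>2 - (b * d)\<^sup>2 * \<theta>" using ab(2) by simp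
    moreover have "x * d\<^sup>2 \<noteq> 0" using ab(1) \<open>d \<noteq> 0\<close> by simp
    ultimately show ?thesis unfolding norm_group_iff by blast
  qed
  assume d: "d \<noteq> 0"
  then show ?thesis using *[of x d] *[of "x * d\<^sup>2" "inverse d"]
    by (auto simp: field_simps)
qed

text \<open>The difference of squares factors: the two terms have sum \<open>x\<close> and
  difference 1. So for \<open>\<theta> = 1\<close> every non-zero element is a norm.\<close>

lemma split_norm:
  assumes "(2::'k::field) \<noteq> 0"
  shows "x = ((x + 1) / 2)\<^sup>2 - ((x - 1) / 2)\<^sup>2 * (1::'k)"
proof -
  have "(x + 1) / 2 - (x - 1) / 2 = 1" "(x + 1) / 2 + (x - 1) / 2 = x"
    using assms by (simp_all add: diff_divide_distrib[symmetric] add_divide_distrib[symmetric])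
  then show ?thesis unfolding power2_eq_square mult_1_right square_diff_square_factored by simp
qed

lemma norm_group_one: "(2::'k::field) \<noteq> 0 \<Longrightarrow> (x::'k) \<noteq> 0 \<Longrightarrow> x \<in> norm_group 1"
  unfolding norm_group_iff using split_norm[of x] by blast

lemma square_in_norm_group: "x \<noteq> 0 \<Longrightarrow> x\<^sup>2 \<in> norm_group \<theta>"
  unfolding norm_group_iff by (intro conjI exI[of _ x] exI[of _ 0]) auto

lemma norm_group_vball:
  fixes x :: "'k::nonarch_local_field"
  assumes "(2::'k) \<notin> maximal_ideal" "x \<noteq> 0" "y \<in> vball (val x + 1) x"
  shows "y \<in> norm_group \<theta> \<longleftrightarrow> x \<in> norm_group \<theta>"
  using square_multiple[OF assms] norm_group_square by metis

lemma one_unit_mult: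
  assumes "u \<in> vball 1 1" "u * v \<in> vball 1 1"
  shows "v \<in> vball 1 (1::'k::discrete_valued_field)"
proof -
  have u: "u \<noteq> 0" "val u = 0" using vball_val[of 1 u] assms by auto
  have "u * (v - 1) \<in> pideal 1"
    using pideal_diff[of "u * v - 1" 1 "u - 1"] assms by (simp add: vball_iff algebra_simps)
  then show ?thesis using pideal_mult_iff[OF u(1)] u(2) by (simp add: vball_iff)
qed

lemma vball_ratio: "x \<noteq> 0 \<Longrightarrow> b \<in> vball (val x + 1) x \<longleftrightarrow> b / x \<in> vball 1 (1::'k::discrete_valued_field)"
  using pideal_mult_iff[of x "b / x - 1" "val x + 1"] by (simp add: vball_iff right_diff_distrib)

text \<open>The product of \<open>b / x\<close> and \<open>c / y\<close> lies in the group
  \<open>1 + p\<close>, so one factor lies there iff the other does. Used where the Weyl element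
  trades \<open>b\<close> for \<open>- c\<close>.\<close>

lemma vball_product_iff:
  fixes x y :: "'k::discrete_valued_field"
  assumes "x \<noteq> 0" "y \<noteq> 0" "b * c \<in> vball (val (x * y) + 1) (x * y)"
  shows "b \<in> vball (val x + 1) x \<longleftrightarrow> c \<in> vball (val y + 1) y"
proof -
  have "b / x * (c / y) \<in> vball 1 1"
    using vball_ratio[of "x * y" "b * c"] assms by (simp add: field_simps)
  then show ?thesis
    using one_unit_mult[of "b / x" "c / y"] one_unit_mult[of "c / y" "b / x"] assms
    by (auto simp: vball_ratio mult.commute)
qed

text \<open>The triple \<open>(a, b, c)\<close> stands for the matrix with rows \<open>(a, b)\<close> and \<open>(c, -a)\<close>.\<close>

definition sl2_act :: "'k \<Rightarrow> 'k \<Rightarrow> 'k \<Rightarrow> 'k \<Rightarrow> 'k \<times> 'k \<times> 'k \<Rightarrow> 'k::comm_ring_1 \<times> 'k \<times> 'k" where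
  "sl2_act g1 g2 g3 g4 p = (let a = fst p; b = fst (snd p); c = snd (snd p) in
     (a * (g1 * g4 + g2 * g3) + c * (g2 * g4) - b * (g1 * g3),
      b * g1\<^sup>2 - 2 * g1 * g2 * a - c * g2\<^sup>2,
      c * g4\<^sup>2 + 2 * g3 * g4 * a - b * g3\<^sup>2))"

lemma continuous_on_sl2_act: "continuous_on UNIV (sl2_act g1 g2 g3 (g4::'k::nonarch_local_field))"
  unfolding sl2_act_def[abs_def] Let_def
  by (intro continuous_on_Pair continuous_intros)

text \<open>\<open>\<nu>\<close> will be the image of \<open>\<mu>\<close> in \<open>k^3\<close>:
  \<open>orbit\<close> records where it is concentrated, \<open>invariant\<close> what becomes of
  the action of the group.\<close>

locale orbit_measure = haar_field dx q for dx :: "'k::nonarch_local_field measure" and q +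
  fixes \<nu> :: "('k \<times> 'k \<times> 'k) measure" and \<theta> :: 'k
  assumes two: "(2::'k) \<notin> maximal_ideal"
    and sets_nu: "sets \<nu> = sets borel"
    and orbit: "AE p in \<nu>. (fst p)\<^sup>2 + fst (snd p) * snd (snd p) = \<theta> \<and>
      (fst (snd p) \<noteq> 0 \<longrightarrow> fst (snd p) \<in> norm_group \<theta>)"
    and invariant: "g1 * g4 - g2 * g3 = 1 \<Longrightarrow> distr \<nu> borel (sl2_act g1 g2 g3 g4) = \<nu>"
begin

lemma sl2_act_meas: "sl2_act g1 g2 g3 g4 \<in> measurable \<nu> borel"
  using borel_measurable_continuous_onI[OF continuous_on_sl2_act]
  by (simp add: measurable_cong_sets[OF sets_nu refl])

lemma space_nu [simp]: "space \<nu> = UNIV"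
  using sets_eq_imp_space_eq[OF sets_nu] by simp

lemma open_in_nu: "open S \<Longrightarrow> S \<in> sets \<nu>" by (simp add: sets_nu)

lemma emeasure_act:
  assumes "g1 * g4 - g2 * g3 = 1" "S \<in> sets \<nu>"
  shows "emeasure \<nu> (sl2_act g1 g2 g3 g4 -` S) = emeasure \<nu> S"
proof -
  have "emeasure (distr \<nu> borel (sl2_act g1 g2 g3 g4)) S = emeasure \<nu> (sl2_act g1 g2 g3 g4 -` S)"
    using assms sl2_act_meas by (subst emeasure_distr) (auto simp: sets_nu)
  then show ?thesis using invariant[OF assms(1)] by simp
qed

text \<open>A set and a preimage need to agree only on the orbit, where the equation
  \<open>a^2 + b c = \<theta>\<close> is available.\<close>

lemma emeasure_act_AE:
  assumes "g1 * g4 - g2 * g3 = 1" "S \<in> sets \<nu>" "S' \<in> sets \<nu>"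
    and "\<And>a b c. a\<^sup>2 + b * c = \<theta> \<Longrightarrow> (b \<noteq> 0 \<Longrightarrow> b \<in> norm_group \<theta>) \<Longrightarrow>
      (a, b, c) \<in> S' \<longleftrightarrow> sl2_act g1 g2 g3 g4 (a, b, c) \<in> S"
  shows "emeasure \<nu> S' = emeasure \<nu> S"
proof -
  have "sl2_act g1 g2 g3 g4 -` S \<in> sets \<nu>"
    using measurable_sets[OF sl2_act_meas] assms(2) by (auto simp: sets_nu)
  moreover have "AE p in \<nu>. p \<in> S' \<longleftrightarrow> p \<in> sl2_act g1 g2 g3 g4 -` S"
    using orbit
  proof eventually_elim
    case (elim p)
    then show ?case using assms(4)[of "fst p" "fst (snd p)" "snd (snd p)"] by simp
  qed
  ultimately have "emeasure \<nu> S' = emeasure \<nu> (sl2_act g1 g2 g3 g4 -` S)"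
    using assms by (intro emeasure_eq_AE) auto
  then show ?thesis using emeasure_act assms by simp
qed

lemma emeasure_cong_orbit:
  assumes "S \<in> sets \<nu>" "S' \<in> sets \<nu>"
    and "\<And>a b c. a\<^sup>2 + b * c = \<theta> \<Longrightarrow> (b \<noteq> 0 \<Longrightarrow> b \<in> norm_group \<theta>) \<Longrightarrow>
      (a, b, c) \<in> S' \<longleftrightarrow> (a, b, c) \<in> S"
  shows "emeasure \<nu> S' = emeasure \<nu> S"
  using assms by (intro emeasure_act_AE[of 1 1 0 0 S S']) (auto simp: sl2_act_def)

section \<open>Evaluation of the measure on cells\<close>

text \<open>The coordinate \<open>c\<close> is left free, since \<open>a\<close> and
  \<open>b \<noteq> 0\<close> determine it on the orbit; the first argument restricts
  \<open>b\<close>, the second \<open>a\<close>.\<close>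

definition cell :: "'k set \<Rightarrow> 'k set \<Rightarrow> ('k \<times> 'k \<times> 'k) set" where
  "cell P Q = Q \<times> P \<times> UNIV"

lemma cell_iff [simp]: "(a, b, c) \<in> cell P Q \<longleftrightarrow> a \<in> Q \<and> b \<in> P"
  by (auto simp: cell_def)

lemma cell_sets [simp]: "open P \<Longrightarrow> open Q \<Longrightarrow> cell P Q \<in> sets \<nu>"
  unfolding cell_def by (intro open_in_nu open_Times) auto

lemma emeasure_cell_partition:
  assumes "finite (vball j ` S)" "\<And>x. x \<in> S \<Longrightarrow> vball j x \<subseteq> S" "open Q"
  shows "emeasure \<nu> (cell S Q) = (\<Sum>P\<in>vball j ` S. emeasure \<nu> (cell P Q))"
    and "emeasure \<nu> (cell Q S) = (\<Sum>P\<in>vball j ` S. emeasure \<nu> (cell Q P))"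
proof -
  have "cell S Q = (\<Union>P\<in>vball j ` S. cell P Q)" "cell Q S = (\<Union>P\<in>vball j ` S. cell Q P)"
    using UN_vball[OF assms(2)] by (auto simp: cell_def)
  moreover have 1: "disjoint_family_on (\<lambda>P. cell P Q) (vball j ` S)"
      "disjoint_family_on (\<lambda>P. cell Q P) (vball j ` S)"
    using vball_disjoint by (fastforce simp: disjoint_family_on_def cell_def)+
  moreover have 2: "(\<lambda>P. cell P Q) ` vball j ` S \<subseteq> sets \<nu>" "(\<lambda>P. cell Q P) ` vball j ` S \<subseteq> sets \<nu>"
    using assms(3) by auto
  ultimately show "emeasure \<nu> (cell S Q) = (\<Sum>P\<in>vball j ` S. emeasure \<nu> (cell P Q))"
    and "emeasure \<nu> (cell Q S) = (\<Sum>P\<in>vball j ` S. emeasure \<nu> (cell Q P))"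
    using sum_emeasure[OF 2(1) 1(1) assms(1)] sum_emeasure[OF 2(2) 1(2) assms(1)] by simp_all
qed

lemma emeasure_cell_vball_partition:
  assumes "r \<le> j" "open Q"
  shows "emeasure \<nu> (cell (vball r x) Q) = (\<Sum>P\<in>vball j ` vball r x. emeasure \<nu> (cell P Q))"
    and "emeasure \<nu> (cell Q (vball r x)) = (\<Sum>P\<in>vball j ` vball r x. emeasure \<nu> (cell Q P))"
  by (rule emeasure_cell_partition[OF finite_subballs vball_subset'[OF _ assms(1)] assms(2)]; assumption)+

text \<open>The lower unipotent with entry \<open>u\<close> moves \<open>a\<close> by
  \<open>- b u\<close>; while \<open>b\<close> runs through \<open>vball r x\<close>, this is
  \<open>- u x\<close> up to an error in \<open>pideal i\<close>.\<close>

lemma emeasure_cell_shift_small: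
  assumes "u \<in> pideal (i - r)"
  shows "emeasure \<nu> (cell (vball r x) (vball i (t + u * x))) = emeasure \<nu> (cell (vball r x) (vball i t))"
proof (rule emeasure_act_AE[of 1 1 0 u])
  fix a b c
  have "a - b * u \<in> vball i t \<longleftrightarrow> a \<in> vball i (t + u * x)" if "b \<in> vball r x"
  proof -
    have "u * (b - x) \<in> pideal i"
      using that assms by (intro pideal_mult'[of u "i - r" _ r]) (auto simp: vball_iff)
    moreover have "a - b * u - t = a - (t + u * x) - u * (b - x)" by (simp add: algebra_simps)
    ultimately show ?thesis using pideal_diff_iff[of "u * (b - x)" i "a - (t + u * x)"]
      by (simp only: vball_iff)
  qed
  then show "(a, b, c) \<in> cell (vball r x) (vball i (t + u * x)) \<longleftrightarrow>
      sl2_act 1 0 u 1 (a, b, c) \<in> cell (vball r x) (vball i t)"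
    by (auto simp: sl2_act_def)
qed auto

lemma emeasure_cell_shift:
  assumes "x \<noteq> 0" "val x < r"
  shows "emeasure \<nu> (cell (vball r x) (vball i t)) = emeasure \<nu> (cell (vball r x) (vball i t'))"
proof (cases "t = t'")
  case False
  \<comment> \<open>The ball of \<open>b\<close> is refined until, for each centre \<open>y\<close>,
    the entry \<open>(t - t') / y\<close> that effects the shift lies in
    \<open>pideal (i - j)\<close>.\<close>
  define j where "j = max r (i - (val (t - t') - val x))"
  have "emeasure \<nu> (cell P (vball i t)) = emeasure \<nu> (cell P (vball i t'))"
    if P: "P \<in> vball j ` vball r x" for P
  proof -
    obtain y where y: "y \<in> vball r x" "P = vball j y" using P by blast
    then have y': "y \<noteq> 0" "val y = val x"
      using vball_val[OF assms(1), of y] subsetD[OF vball_subset[of "val x + 1" r x]] assms(2) by simp_all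
    have "(t - t') / y \<in> pideal (i - j)"
      using False y' by (simp add: pideal_def val_divide j_def)
    from emeasure_cell_shift_small[OF this, of y t'] show ?thesis using y y' by simp
  qed
  then show ?thesis
    using emeasure_cell_vball_partition(1)[of r j _ x] by (simp add: j_def)
qed simp

text \<open>The diagonal element with entries \<open>d^-1\<close> and \<open>d\<close> fixes
  \<open>a\<close> and multiplies \<open>b\<close> by \<open>d^-2\<close>.\<close>

lemma emeasure_cell_square:
  assumes "d \<noteq> 0" "open Q"
  shows "emeasure \<nu> (cell (vball (r + 2 * val d) (x * d\<^sup>2)) Q) = emeasure \<nu> (cell (vball r x) Q)"
proof (rule emeasure_act_AE[of "inverse d" d 0 0])
  fix a b c
  have "b * (inverse d)\<^sup>2 - x = (inverse d)\<^sup>2 * (b - x * d\<^sup>2)"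
    using assms(1) by (simp add: field_simps)
  then have "b * (inverse d)\<^sup>2 \<in> vball r x \<longleftrightarrow> b \<in> vball (r + 2 * val d) (x * d\<^sup>2)"
    using pideal_mult_iff[of "(inverse d)\<^sup>2" "b - x * d\<^sup>2" r] assms(1)
    by (simp add: vball_iff val_power2 val_inverse)
  then show "(a, b, c) \<in> cell (vball (r + 2 * val d) (x * d\<^sup>2)) Q \<longleftrightarrow>
      sl2_act (inverse d) 0 0 d (a, b, c) \<in> cell (vball r x) Q"
    using assms by (auto simp: sl2_act_def)
qed (use assms in auto)

text \<open>The \<open>q\<close> subballs have equal measure: in the \<open>b\<close> direction
  their centres differ by squares of units, in the \<open>a\<close> direction by shifts.\<close>

lemma emeasure_cell_step:
  assumes "x \<noteq> 0" "val x < r"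
  shows "emeasure \<nu> (cell (vball r x) (vball i t)) = ennreal q * emeasure \<nu> (cell (vball (r + 1) x) (vball i t))"
    and "emeasure \<nu> (cell (vball r x) (vball i t)) = ennreal q * emeasure \<nu> (cell (vball r x) (vball (i + 1) t))"
proof -
  have sum_subballs: "(\<Sum>P\<in>vball (r + 1) ` vball r y. f P) = ennreal q * v"
    if "\<And>P. P \<in> vball (r + 1) ` vball r y \<Longrightarrow> f P = v" for f v r and y :: 'k
  proof -
    have "(\<Sum>P\<in>vball (r + 1) ` vball r y. f P) = (\<Sum>P\<in>vball (r + 1) ` vball r y. v)"
      by (rule sum.cong[OF refl that])
    then show ?thesis by (simp add: card_subballs q_eq ennreal_of_nat_eq_real_of_nat)
  qed
  have 1: "emeasure \<nu> (cell P (vball i t)) = emeasure \<nu> (cell (vball (r + 1) x) (vball i t))"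
    if P: "P \<in> vball (r + 1) ` vball r x" for P
  proof -
    obtain y where y: "y \<in> vball r x" "P = vball (r + 1) y" using P by blast
    have "y \<in> vball (val x + 1) x" using y(1) vball_subset[of "val x + 1" r x] assms(2) by auto
    then obtain d where "y = x * d\<^sup>2" "d \<noteq> 0" "val d = 0"
      using square_multiple[OF two assms(1)] by blast
    then show ?thesis using emeasure_cell_square[of d "vball i t" "r + 1" x] y(2) by simp
  qed
  then show "emeasure \<nu> (cell (vball r x) (vball i t)) = ennreal q * emeasure \<nu> (cell (vball (r + 1) x) (vball i t))"
    by (subst emeasure_cell_vball_partition(1)[OF _ open_vball, of r "r + 1"])
      (simp, rule sum_subballs[where f = "\<lambda>P. emeasure \<nu> (cell P (vball i t))", OF 1])
  have 2: "emeasure \<nu> (cell (vball r x) P) = emeasure \<nu> (cell (vball r x) (vball (i + 1) t))"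
    if P: "P \<in> vball (i + 1) ` vball i t" for P
    using P emeasure_cell_shift[OF assms] by auto
  then show "emeasure \<nu> (cell (vball r x) (vball i t)) = ennreal q * emeasure \<nu> (cell (vball r x) (vball (i + 1) t))"
    by (subst emeasure_cell_vball_partition(2)[OF _ open_vball, of i "i + 1"])
      (simp, rule sum_subballs[where f = "\<lambda>P. emeasure \<nu> (cell (vball r x) P)", OF 2])
qed

text \<open>The values of \<open>h\<close> may still be infinite here; only the finite factor
  \<open>q\<close> is cancelled.\<close>

lemma geometric_ennreal:
  fixes h :: "int \<Rightarrow> ennreal"
  assumes "\<And>i. i \<ge> k \<Longrightarrow> h i = ennreal q * h (i + 1)" "k \<le> i"
  shows "h i = h k * ennreal (q powi (k - i))"
  using assms(2)
proof (induction i rule: int_ge_induct)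
  case (step i)
  have "ennreal q * h (i + 1) = h k * (ennreal q * ennreal (q powi (- (i - k + 1))))"
    using step assms(1)[of i] q_gt_1 q_mult_powi[of "i - k"] by (simp add: ennreal_mult'[symmetric])
  also have "\<dots> = ennreal q * (h k * ennreal (q powi (k - (i + 1))))"
    by (simp add: algebra_simps)
  finally show ?case using q_gt_1 by (simp add: ennreal_mult_cancel_left)
qed simp

text \<open>The density of \<open>\<nu>\<close> relative to \<open>|b|^-1 da db\<close> near
  \<open>b = x\<close>: the cell has volume \<open>q^-1\<close> for the latter, which the factor
  \<open>q\<close> compensates.\<close>

definition kappa :: "'k \<Rightarrow> ennreal" where
  "kappa x = emeasure \<nu> (cell (vball (val x + 1) x) (vball 0 0)) * ennreal q"

lemma emeasure_cell_kappa:
  assumes "x \<noteq> 0" "val x < r"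
  shows "emeasure \<nu> (cell (vball r x) (vball i t)) = kappa x * ennreal (q powi (val x - r - i))"
proof -
  let ?h = "\<lambda>r i. emeasure \<nu> (cell (vball r x) (vball i 0))"
  \<comment> \<open>\<open>geometric_ennreal\<close> only runs upwards, so the radii
    \<open>0\<close> and \<open>i\<close> are both compared with their minimum.\<close>
  define k where "k = min 0 i"
  have r: "?h r' i = ?h (val x + 1) i * ennreal (q powi (val x + 1 - r'))" if "val x < r'" for r' i
    using that by (intro geometric_ennreal emeasure_cell_step(1) assms) auto
  have i: "?h r' i = ?h r' k * ennreal (q powi (k - i))" if "k \<le> i" "val x < r'" for r' i
    using that by (intro geometric_ennreal emeasure_cell_step(2) assms) auto
  have "?h (val x + 1) i = ?h (val x + 1) k * ennreal (q powi (k - i))"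
    by (intro i) (auto simp: k_def)
  also have "\<dots> = ?h (val x + 1) k * ennreal (q powi k * q powi (- i))"
    using q_gt_1 by (simp add: power_int_add[symmetric])
  also have "\<dots> = ?h (val x + 1) k * ennreal (q powi (k - 0)) * ennreal (q powi (- i))"
    by (simp add: ennreal_mult'' mult.assoc less_imp_le)
  also have "?h (val x + 1) k * ennreal (q powi (k - 0)) = ?h (val x + 1) 0"
    by (intro i[symmetric]) (auto simp: k_def)
  finally have "?h r i = ?h (val x + 1) 0 * ennreal (q powi (- i)) * ennreal (q powi (val x + 1 - r))"
    using r[OF assms(2), of i] by simp
  also have "\<dots> = ?h (val x + 1) 0 * ennreal (q * q powi (val x - r - i))"
  proof -
    have "q powi (- i) * q powi (val x + 1 - r) = q * q powi (val x - r - i)"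
      using q_gt_1 q_powi_Suc[of "val x - r - i"] by (simp add: power_int_add[symmetric] algebra_simps)
    then show ?thesis by (simp add: ennreal_mult'[symmetric] mult.assoc less_imp_le)
  qed
  also have "\<dots> = kappa x * ennreal (q powi (val x - r - i))"
    using q_gt_1 by (simp add: kappa_def ennreal_mult' mult.assoc)
  finally show ?thesis using emeasure_cell_shift[OF assms, of i t 0] by simp
qed

lemma kappa_square: "d \<noteq> 0 \<Longrightarrow> x \<noteq> 0 \<Longrightarrow> kappa (x * d\<^sup>2) = kappa x"
  using emeasure_cell_square[of d "vball 0 0" "val x + 1" x]
  by (simp add: kappa_def val_mult val_power2 add.assoc add.commute)

text \<open>The Weyl element sends \<open>b\<close> to \<open>- c = (a^2 - \<theta>) / b\<close>, so
  it carries a cell near \<open>a = t\<close>, \<open>b = x\<close> to one near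
  \<open>a = - t\<close>, \<open>b = y\<close> with \<open>x y = t^2 - \<theta>\<close>.\<close>

lemma kappa_weyl:
  assumes "x \<noteq> 0" "t\<^sup>2 \<noteq> \<theta>"
  shows "kappa ((t\<^sup>2 - \<theta>) / x) = kappa x"
proof -
  define y where "y = (t\<^sup>2 - \<theta>) / x"
  have y: "y \<noteq> 0" "x * y = t\<^sup>2 - \<theta>" using assms by (auto simp: y_def)
  \<comment> \<open>A small enough ball of \<open>a\<close> keeps \<open>a^2 - \<theta>\<close>
    within relative distance \<open>q^-1\<close> of \<open>x y\<close>.\<close>
  let ?S = "(\<lambda>a. a\<^sup>2 - \<theta>) -` vball (val (x * y) + 1) (x * y)"
  have "open ?S" by (intro open_vimage continuous_intros) auto
  moreover have "t \<in> ?S" by (simp add: y)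
  ultimately obtain i where i: "vball i t \<subseteq> ?S" unfolding open_iff_vball by blast
  have "emeasure \<nu> (cell (vball (val x + 1) x) (vball i t)) = emeasure \<nu> (cell (vball (val y + 1) y) (vball i (-t)))"
  proof (rule emeasure_act_AE[of 0 0 1 "-1"])
    fix a b c assume eq: "a\<^sup>2 + b * c = \<theta>"
    have "b \<in> vball (val x + 1) x \<longleftrightarrow> - c \<in> vball (val y + 1) y" if "a \<in> vball i t"
    proof (rule vball_product_iff)
      have "b * - c = a\<^sup>2 - \<theta>" using eq by (simp add: algebra_simps)
      moreover have "a\<^sup>2 - \<theta> \<in> vball (val (x * y) + 1) (x * y)" using i that by auto
      ultimately show "b * - c \<in> vball (val (x * y) + 1) (x * y)" by simp
    qed (use assms y in auto)
    moreover have "- a \<in> vball i (- t) \<longleftrightarrow> a \<in> vball i t"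
      using pideal_diff_commute[of a t i] by (simp add: vball_iff)
    ultimately show "(a, b, c) \<in> cell (vball (val x + 1) x) (vball i t) \<longleftrightarrow>
        sl2_act 0 1 (- 1) 0 (a, b, c) \<in> cell (vball (val y + 1) y) (vball i (- t))"
      by (auto simp: sl2_act_def)
  qed auto
  then have "kappa x * ennreal (q powi (- 1 - i)) = kappa y * ennreal (q powi (- 1 - i))"
    using emeasure_cell_kappa[of x "val x + 1"] emeasure_cell_kappa[of y "val y + 1"] assms y by simp
  then have "ennreal (q powi (- 1 - i)) * kappa y = ennreal (q powi (- 1 - i)) * kappa x"
    by (simp only: mult.commute)
  then show ?thesis using q_powi_pos[of "- 1 - i"]
    by (auto simp: y_def ennreal_mult_cancel_left ennreal_eq_0_iff not_le)
qed

text \<open>A norm with \<open>b = 0\<close> is a square; any other is \<open>b^2\<close> times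
  \<open>(a / b)^2 - \<theta>\<close>, the Weyl partner of 1.\<close>

lemma kappa_norm:
  assumes "x \<in> norm_group \<theta>"
  shows "kappa x = kappa 1"
proof -
  obtain a b where x: "x \<noteq> 0" "x = a\<^sup>2 - b\<^sup>2 * \<theta>" using assms by (auto simp: norm_group_iff)
  show ?thesis
  proof (cases "b = 0")
    case True
    then show ?thesis using kappa_square[of a 1] x by auto
  next
    case False
    have eq: "x = ((a / b)\<^sup>2 - \<theta>) / 1 * b\<^sup>2" using False by (simp add: x power_divide field_simps)
    then have "(a / b)\<^sup>2 \<noteq> \<theta>" using x by auto
    then show ?thesis
      unfolding eq using kappa_square[of b] kappa_weyl[of 1 "a / b"] False by simp
  qed
qed

text \<open>The whole ball around a non-norm consists of non-norms, and no point of the orbit has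
  such a \<open>b\<close>.\<close>

lemma kappa_non_norm:
  assumes "x \<noteq> 0" "x \<notin> norm_group \<theta>"
  shows "kappa x = 0"
proof -
  have "emeasure \<nu> (cell (vball (val x + 1) x) (vball 0 0)) = emeasure \<nu> {}"
  proof (rule emeasure_cong_orbit)
    fix a b c assume "b \<noteq> 0 \<Longrightarrow> b \<in> norm_group \<theta>"
    then have "b \<notin> vball (val x + 1) x"
      using vball_val[OF assms(1), of b] norm_group_vball[OF two assms(1), of b] assms(2) by blast
    then show "(a, b, c) \<in> cell (vball (val x + 1) x) (vball 0 0) \<longleftrightarrow> (a, b, c) \<in> {}" by simp
  qed auto
  then show ?thesis by (simp add: kappa_def)
qed

lemma emeasure_cell_shell:
  assumes "n < r"
  shows "emeasure \<nu> (cell (shell n) (vball i t)) =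
    kappa 1 * ennreal (real (card {P \<in> vball r ` shell n. ball_rep P \<in> norm_group \<theta>}) * q powi (n - r - i))"
proof -
  have fin: "finite (vball r ` (shell n :: 'k set))"
    by (rule finite_vball_image[of _ n 0]) (simp add: vball_zero shell_eq)
  have *: "emeasure \<nu> (cell P (vball i t)) =
      (if ball_rep P \<in> norm_group \<theta> then kappa 1 * ennreal (q powi (n - r - i)) else 0)"
    if P: "P \<in> vball r ` shell n" for P
  proof -
    obtain y where y: "y \<in> shell n" "P = vball r y" using P by blast
    have *: "ball_rep P \<in> vball r y" unfolding y by (rule ball_rep_vball)
    then have x: "ball_rep P \<in> shell n" "P = vball r (ball_rep P)"
      using shell_vball[OF y(1) assms] vball_eqI[OF *] y by auto
    then have "emeasure \<nu> (cell P (vball i t)) = kappa (ball_rep P) * ennreal (q powi (n - r - i))"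
      using emeasure_cell_kappa[of "ball_rep P" r i t] assms by (auto simp: shell_def)
    then show ?thesis using kappa_norm kappa_non_norm x(1) by (auto simp: shell_def)
  qed
  have "emeasure \<nu> (cell (shell n) (vball i t)) =
      (\<Sum>P\<in>vball r ` shell n. if ball_rep P \<in> norm_group \<theta> then kappa 1 * ennreal (q powi (n - r - i)) else 0)"
    by (rule trans[OF emeasure_cell_partition(1)[OF fin _ open_vball] sum.cong[OF refl *]])
      (rule shell_vball[OF _ assms])
  also have "\<dots> = of_nat (card {P \<in> vball r ` shell n. ball_rep P \<in> norm_group \<theta>}) *
      (kappa 1 * ennreal (q powi (n - r - i)))"
    using fin by (simp add: sum.inter_filter[symmetric])
  finally show ?thesis
    by (simp add: ennreal_mult ennreal_of_nat_eq_real_of_nat less_imp_le mult_ac)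
qed

end

section \<open>Normalisation of the orbit measure\<close>

lemma one_in_pideal: "1 \<in> pideal 0"
  by (simp add: pideal_def)

lemma pideal_1_prime:
  assumes "x \<in> pideal 0" "y \<in> pideal 0" "x * y \<in> pideal 1"
  shows "x \<in> pideal 1 \<or> y \<in> pideal (1::int)"
  using assms by (cases "x = 0"; cases "y = 0") (auto simp: pideal_def val_mult)

lemma shell_0_mult_iff: "b \<in> shell 0 \<Longrightarrow> b * c \<in> pideal n \<longleftrightarrow> c \<in> pideal n"
  using pideal_mult_iff[of b c n] by (auto simp: shell_def)

section \<open>Squares and norms among the residue units\<close>

abbreviation residue_units :: "'k::nonarch_local_field set set" where
  "residue_units \<equiv> vball 1 ` shell 0"

lemma finite_residue_units: "finite (residue_units :: 'k::nonarch_local_field set set)"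
  by (rule finite_vball_image[of _ 0 0]) (simp add: vball_zero shell_eq)

lemma residue_unitsE:
  assumes "P \<in> residue_units"
  shows "ball_rep P \<in> shell 0" "vball 1 (ball_rep P) = P"
proof -
  obtain y where y: "y \<in> shell 0" "P = vball 1 y" using assms by blast
  have *: "ball_rep P \<in> vball 1 y" unfolding y by (rule ball_rep_vball)
  then show "ball_rep P \<in> shell 0" "vball 1 (ball_rep P) = P"
    using shell_vball[OF y(1), of 1] vball_eqI[OF *] y by auto
qed

lemma card_residue_units:
  "real (card (residue_units :: 'k::nonarch_local_field set set)) = qres TYPE('k) - 1"
proof -
  have "residue_field = insert (vball 1 0) (residue_units :: 'k set set)"
  proof -
    have "pideal 0 = pideal 1 \<union> (shell 0 :: 'k set)" by (auto simp: shell_eq intro: pideal_mono[of 0 1])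
    moreover have "vball 1 ` pideal 1 = {vball 1 (0::'k)}"
      using vball_eq_iff[of 1 _ 0] pideal_0[of 1] by (auto intro!: image_eqI[of _ _ 0])
    ultimately show ?thesis by (simp add: residue_field_eq image_Un)
  qed
  moreover have "vball 1 0 \<notin> (residue_units :: 'k set set)"
    by (auto simp: vball_eq_iff shell_eq)
  ultimately have "card (residue_field :: 'k set set) = Suc (card (residue_units :: 'k set set))"
    using finite_residue_units by (metis card_insert_disjoint)
  then show ?thesis by simp
qed

definition is_square :: "'k::field \<Rightarrow> bool" where
  "is_square x \<longleftrightarrow> (\<exists>y. x = y\<^sup>2)"

lemma is_square_vball:
  fixes x :: "'k::nonarch_local_field"
  assumes two: "(2::'k) \<notin> maximal_ideal" and x: "x \<in> shell 0" and y: "y \<in> vball 1 x"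
  shows "is_square y \<longleftrightarrow> is_square x"
proof -
  have x': "x \<noteq> 0" "val x = 0" using x by (auto simp: shell_def)
  have "y \<in> vball (val x + 1) x" using y x'(2) by simp
  then obtain d where d: "y = x * d\<^sup>2" "d \<noteq> 0" "val d = 0" by (rule square_multiple[OF two x'(1)])
  have "\<exists>v. y = v\<^sup>2" if "x = z\<^sup>2" for z
    by (rule exI[of _ "z * d"]) (simp add: d(1) that power_mult_distrib)
  moreover have "\<exists>v. x = v\<^sup>2" if "y = z\<^sup>2" for z
  proof
    show "x = (z / d)\<^sup>2" using d by (simp add: that[symmetric] power_divide)
  qed
  ultimately show ?thesis unfolding is_square_def by blast
qed

lemma shell_0_power2: "x\<^sup>2 \<in> shell 0 \<longleftrightarrow> x \<in> shell 0"
  by (cases "x = 0") (auto simp: shell_def val_power2)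

lemma shell_0_mult: "x \<in> shell 0 \<Longrightarrow> x * y \<in> shell 0 \<longleftrightarrow> y \<in> shell 0"
  by (auto simp: shell_def val_mult)

lemma residue_square_ball_iff:
  fixes x :: "'k::nonarch_local_field"
  assumes two: "(2::'k) \<notin> maximal_ideal" and x: "x \<in> shell 0"
  shows "is_square (ball_rep (vball 1 x)) \<longleftrightarrow> is_square x"
  using is_square_vball[OF assms ball_rep_vball] .

text \<open>Squaring on the residue units is two to one: the classes of \<open>y\<close> and
  \<open>- y\<close> form a fibre, and they differ since 2 is a unit.\<close>

lemma card_residue_squares:
  assumes two: "(2::'k::nonarch_local_field) \<notin> maximal_ideal"
  shows "2 * card {P \<in> residue_units. is_square (ball_rep P :: 'k)} = card (residue_units :: 'k set set)"
proof -
  define f where "f = (\<lambda>P. vball 1 ((ball_rep P :: 'k)\<^sup>2))"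
  let ?A = "residue_units :: 'k set set"
  have eq: "vball 1 (x\<^sup>2) = vball 1 (y\<^sup>2) \<longleftrightarrow> vball 1 x = vball 1 y \<or> vball 1 x = vball 1 (- y)"
    if "x \<in> shell 0" "y \<in> shell 0" for x y :: 'k
  proof -
    have O: "x - y \<in> pideal 0" "x + y \<in> pideal 0"
      using that by (auto intro!: pideal_diff pideal_add simp: shell_eq)
    have "x\<^sup>2 - y\<^sup>2 = (x - y) * (x + y)" by (simp add: power2_eq_square algebra_simps)
    then have "x\<^sup>2 - y\<^sup>2 \<in> pideal 1 \<longleftrightarrow> x - y \<in> pideal 1 \<or> x + y \<in> pideal 1"
      using pideal_1_prime[OF O] pideal_mult'[OF O(1), of "x + y" 1 1]
        pideal_mult'[OF _ O(2), of "x - y" 1 1] by auto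
    then show ?thesis by (simp add: vball_eq_iff)
  qed
  have img: "f ` ?A = {P \<in> ?A. is_square (ball_rep P)}"
  proof safe
    fix x :: 'k assume x: "x \<in> shell 0"
    then have r: "ball_rep (vball 1 x) \<in> shell 0" using residue_unitsE by blast
    then show "f (vball 1 x) \<in> ?A" by (auto simp: f_def shell_0_power2)
    show "is_square (ball_rep (f (vball 1 x)))"
      unfolding f_def using residue_square_ball_iff[OF two] r
      by (auto simp: shell_0_power2 is_square_def)
  next
    fix x :: 'k assume x: "x \<in> shell 0" "is_square (ball_rep (vball 1 x))"
    then obtain y where y: "x = y\<^sup>2" using residue_square_ball_iff[OF two] by (auto simp: is_square_def)
    then have y': "y \<in> shell 0" using x by (simp add: shell_0_power2)
    note r = residue_unitsE[of "vball 1 y", OF imageI[OF y']]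
    have "f (vball 1 y) = vball 1 x" unfolding f_def y using eq[OF r(1) y'] r(2) by auto
    then show "vball 1 x \<in> f ` ?A" using y' by blast
  qed
  have fib: "card {P \<in> ?A. f P = z} = 2" if z: "z \<in> f ` ?A" for z
  proof -
    obtain Q where Q: "Q \<in> ?A" "z = f Q" using z by blast
    define y where "y = ball_rep Q"
    have y: "y \<in> shell 0" "vball 1 y = Q" using residue_unitsE[OF Q(1)] by (simp_all add: y_def)
    have my: "- y \<in> shell 0" using y by (auto simp: shell_def)
    have "f P = z \<longleftrightarrow> P = vball 1 y \<or> P = vball 1 (- y)" if "P \<in> ?A" for P
      using residue_unitsE[OF that] eq[of "ball_rep P" y] y(1) by (simp add: Q(2) f_def y_def)
    moreover have "vball 1 y \<in> ?A" "vball 1 (- y) \<in> ?A" using y(1) my by blast+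
    ultimately have "{P \<in> ?A. f P = z} = {vball 1 y, vball 1 (- y)}" by blast
    moreover have "vball 1 y \<noteq> vball 1 (- y)"
    proof
      assume "vball 1 y = vball 1 (- y)"
      then have "2 * y \<in> pideal 1" by (simp add: vball_eq_iff)
      then show False using val_two[OF two] y(1) by (auto simp: shell_def pideal_def val_mult)
    qed
    ultimately show ?thesis by simp
  qed
  have "card ?A = (\<Sum>z\<in>f ` ?A. card {P \<in> ?A. f P = z})"
    using sum.image_gen[OF finite_residue_units, of "\<lambda>_. 1::nat" f] by simp
  also have "\<dots> = (\<Sum>z\<in>f ` ?A. 2)" by (intro sum.cong refl fib)
  finally show ?thesis by (simp add: img)
qed

text \<open>Index two by counting: multiplication by \<open>z\<close> maps the square residue
  classes injectively to the non-squares, of which there are equally many, so it reaches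
  \<open>y\<close>.\<close>

lemma product_of_nonsquares:
  fixes y z :: "'k::nonarch_local_field"
  assumes two: "(2::'k) \<notin> maximal_ideal"
    and y: "y \<in> shell 0" "\<not> is_square y" and z: "z \<in> shell 0" "\<not> is_square z"
  obtains s where "y = z * s\<^sup>2" "s \<noteq> 0"
proof -
  let ?A = "residue_units :: 'k set set"
  define S where "S = {P \<in> ?A. is_square (ball_rep P)}"
  define B where "B = {P \<in> ?A. \<not> is_square (ball_rep P)}"
  define g where "g = (\<lambda>P. vball 1 (z * ball_rep P))"
  have fin: "finite S" "finite B" using finite_residue_units[where ?'k = 'k] by (auto simp: S_def B_def)
  have "card S + card B = card ?A"
    using fin by (subst card_Un_disjoint[symmetric]) (auto simp: S_def B_def intro!: arg_cong[of _ _ card])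
  then have card: "card B = card S" using card_residue_squares[OF two] by (simp add: S_def)
  have "inj_on g S"
  proof (rule inj_onI)
    fix P Q assume PQ: "P \<in> S" "Q \<in> S" "g P = g Q"
    then have "z * (ball_rep P - ball_rep Q) \<in> pideal 1" by (simp add: g_def vball_eq_iff right_diff_distrib)
    then have "vball 1 (ball_rep P) = vball 1 (ball_rep Q)"
      using shell_0_mult_iff[OF z(1)] by (simp add: vball_eq_iff)
    then show "P = Q" using residue_unitsE(2)[of P] residue_unitsE(2)[of Q] PQ by (auto simp: S_def)
  qed
  moreover have "g ` S \<subseteq> B"
  proof
    fix Q assume "Q \<in> g ` S"
    then obtain P where P: "P \<in> S" "Q = g P" by blast
    then have P': "ball_rep P \<in> shell 0" "is_square (ball_rep P)" using residue_unitsE by (auto simp: S_def)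
    have zP: "z * ball_rep P \<in> shell 0" using P' z by (simp add: shell_0_mult)
    obtain w where w: "ball_rep P = w\<^sup>2" using P'(2) by (auto simp: is_square_def)
    then have "w \<noteq> 0" using P'(1) by (auto simp: shell_def)
    have "\<not> is_square (z * ball_rep P)"
    proof
      assume "is_square (z * ball_rep P)"
      then obtain v where "z * w\<^sup>2 = v\<^sup>2" by (auto simp: is_square_def w)
      then have "z = (v / w)\<^sup>2" using \<open>w \<noteq> 0\<close> by (simp add: power_divide field_simps)
      then show False using z(2) by (auto simp: is_square_def)
    qed
    then show "Q \<in> B" using residue_square_ball_iff[OF two zP] zP by (auto simp: B_def g_def P(2))
  qed
  ultimately have "g ` S = B" using card_subset_eq[OF fin(2)] card by (simp add: card_image)
  moreover have "vball 1 y \<in> B" using y residue_square_ball_iff[OF two y(1)] by (auto simp: B_def)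
  ultimately obtain P where P: "P \<in> S" "vball 1 y = g P" by auto
  have P': "ball_rep P \<in> shell 0" "is_square (ball_rep P)" using P(1) residue_unitsE by (auto simp: S_def)
  then obtain w where w: "ball_rep P = w\<^sup>2" by (auto simp: is_square_def)
  have zP: "z * ball_rep P \<in> shell 0" using P' z by (simp add: shell_0_mult)
  then have "y \<in> vball (val (z * ball_rep P) + 1) (z * ball_rep P)"
    using P(2) vball_self[of y 1] by (auto simp: g_def shell_def)
  moreover have "z * ball_rep P \<noteq> 0" using zP by (simp add: shell_def)
  ultimately obtain d where d: "y = z * ball_rep P * d\<^sup>2" "d \<noteq> 0" "val d = 0"
    using square_multiple[OF two] by blast
  show ?thesis
  proof (rule that)
    show "y = z * (w * d)\<^sup>2" using d w by (simp add: power_mult_distrib mult.assoc)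
    show "w * d \<noteq> 0" using d w P'(1) by (auto simp: shell_def)
  qed
qed

text \<open>Pigeonhole in the finite residue field: its characteristic is positive.\<close>

lemma multiple_of_one_in_pideal:
  obtains n :: nat where "of_nat (Suc n) \<in> (pideal 1 :: 'k::nonarch_local_field set)"
proof -
  have nat_O: "of_nat n \<in> (pideal 0 :: 'k set)" for n
    by (induction n) (auto intro: pideal_add one_in_pideal)
  have "finite (range (\<lambda>n::nat. vball 1 (of_nat n :: 'k)))"
    using nat_O by (intro finite_subset[OF _ finite_residue_field]) (auto simp: residue_field_eq)
  then have "\<not> inj (\<lambda>n::nat. vball 1 (of_nat n :: 'k))" using finite_imageD by blast
  then obtain i j :: nat where "i \<noteq> j" "vball 1 (of_nat i :: 'k) = vball 1 (of_nat j)"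
    by (auto simp: inj_def)
  then obtain i j :: nat where ij: "i < j" "vball 1 (of_nat j :: 'k) = vball 1 (of_nat i)"
    by (metis linorder_neqE_nat)
  then have "of_nat j - of_nat i \<in> (pideal 1 :: 'k set)" by (simp add: vball_eq_iff)
  then have "of_nat (Suc (j - i - 1)) \<in> (pideal 1 :: 'k set)" using ij(1) by (simp add: of_nat_diff)
  then show ?thesis by (rule that)
qed

lemma nonsquare_unit_not_square_mod:
  "nonsquare_unit e \<Longrightarrow> y \<in> pideal 0 \<Longrightarrow> e - y\<^sup>2 \<notin> pideal 1"
  by (auto simp: nonsquare_unit_def integer_ring_eq maximal_ideal_eq)

text \<open>
  If every \<open>t\<^sup>2 - \<epsilon>\<close> were a square, then the squares of the residue field would be closed under
  subtraction of \<open>\<epsilon>\<close>, and \<open>\<epsilon> = 0 - (p - 1) \<epsilon>\<close> would be a square.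
\<close>

lemma unramified_norm_nonsquare:
  assumes eps: "nonsquare_unit (\<epsilon> :: 'k::nonarch_local_field)"
  shows "\<exists>t\<in>pideal 0. \<not> is_square (t\<^sup>2 - \<epsilon>)"
proof (rule ccontr)
  assume "\<not> ?thesis"
  then have sq: "is_square (t\<^sup>2 - \<epsilon>)" if "t \<in> pideal 0" for t using that by blast
  have e: "\<epsilon> \<in> pideal 0" using eps by (auto simp: nonsquare_unit_def pideal_def)
  have step: "\<exists>r\<in>pideal 0. r\<^sup>2 + of_nat n * \<epsilon> \<in> pideal 1" for n
  proof (induction n)
    case 0
    show ?case by (intro bexI[of _ 0]) auto
  next
    case (Suc n)
    then obtain r where r: "r \<in> pideal 0" "r\<^sup>2 + of_nat n * \<epsilon> \<in> pideal 1" by blast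
    obtain v where v: "r\<^sup>2 - \<epsilon> = v\<^sup>2" using sq[OF r(1)] by (auto simp: is_square_def)
    have "r\<^sup>2 - \<epsilon> \<in> pideal 0" unfolding power2_eq_square
      by (rule pideal_diff[OF pideal_mult'[OF r(1) r(1)] e]) simp
    then have "v\<^sup>2 \<in> pideal 0" by (simp only: v)
    then have "v \<in> pideal 0" unfolding pideal_square_iff by (auto simp: pideal_def)
    moreover have "v\<^sup>2 + of_nat (Suc n) * \<epsilon> = r\<^sup>2 + of_nat n * \<epsilon>"
      unfolding v[symmetric] by (simp add: algebra_simps)
    ultimately show ?case using r(2) by (intro bexI[of _ v]) simp_all
  qed
  obtain n where n: "of_nat (Suc n) \<in> (pideal 1 :: 'k set)" by (rule multiple_of_one_in_pideal)
  obtain r where r: "r \<in> pideal 0" "r\<^sup>2 + of_nat n * \<epsilon> \<in> pideal 1" using step by blast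
  have "of_nat (Suc n) * \<epsilon> - (r\<^sup>2 + of_nat n * \<epsilon>) \<in> pideal 1"
    using pideal_mult'[OF n e, of 1] r(2) by (intro pideal_diff) auto
  then have "\<epsilon> - r\<^sup>2 \<in> pideal 1" by (simp add: algebra_simps)
  then show False using nonsquare_unit_not_square_mod[OF eps r(1)] by simp
qed

text \<open>For a suitable \<open>t\<close> the norm \<open>t^2 - \<epsilon>\<close> is a non-square
  unit, and every other non-square unit is a square multiple of it.\<close>

lemma norm_group_unramified:
  assumes two: "(2::'k::nonarch_local_field) \<notin> maximal_ideal"
    and eps: "nonsquare_unit (\<epsilon> :: 'k)" and x: "x \<in> shell 0"
  shows "x \<in> norm_group \<epsilon>"
proof (cases "is_square x")
  case True
  then show ?thesis using x square_in_norm_group by (auto simp: is_square_def shell_def)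
next
  case False
  obtain t where t: "t \<in> pideal 0" "\<not> is_square (t\<^sup>2 - \<epsilon>)" using unramified_norm_nonsquare[OF eps] by blast
  have "t\<^sup>2 - \<epsilon> \<in> pideal 0"
    using eps t(1) pideal_mult'[OF t(1) t(1), of 0]
    by (intro pideal_diff) (auto simp: nonsquare_unit_def pideal_def[of 0] power2_eq_square)
  moreover have "t\<^sup>2 - \<epsilon> \<notin> pideal 1"
    using nonsquare_unit_not_square_mod[OF eps t(1)] by (simp add: pideal_diff_commute)
  ultimately have z: "t\<^sup>2 - \<epsilon> \<in> shell 0" by (simp add: shell_eq)
  obtain s where s: "x = (t\<^sup>2 - \<epsilon>) * s\<^sup>2" "s \<noteq> 0"
    by (rule product_of_nonsquares[OF two x False z t(2)])
  have "t\<^sup>2 - \<epsilon> \<in> norm_group \<epsilon>"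
    unfolding norm_group_iff using z by (intro conjI exI[of _ t] exI[of _ 1]) (auto simp: shell_def)
  then show ?thesis by (simp only: s(1) norm_group_square[OF s(2)])
qed

text \<open>In \<open>x = a^2 - b^2 \<pi>\<close> the two terms have valuations of different parity,
  so for a unit \<open>x\<close> the second one is integral, hence in \<open>p\<close>, and
  \<open>x\<close> is congruent to \<open>a^2\<close>.\<close>

lemma norm_group_ramified:
  assumes two: "(2::'k::nonarch_local_field) \<notin> maximal_ideal"
    and pi: "uniformiser (\<pi> :: 'k)" and x: "x \<in> shell 0"
  shows "x \<in> norm_group \<pi> \<longleftrightarrow> is_square x"
proof
  assume "is_square x"
  then show "x \<in> norm_group \<pi>" using x square_in_norm_group by (auto simp: is_square_def shell_def)
next
  assume "x \<in> norm_group \<pi>"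
  then obtain a b where ab: "x = a\<^sup>2 - b\<^sup>2 * \<pi>" by (auto simp: norm_group_iff)
  have p: "\<pi> \<noteq> 0" "val \<pi> = 1" using pi by (auto simp: uniformiser_def)
  have x': "x \<noteq> 0" "val x = 0" using x by (auto simp: shell_def)
  show "is_square x"
  proof (cases "b\<^sup>2 * \<pi> \<in> pideal 1")
    case True
    then have "a\<^sup>2 \<in> vball 1 x" by (simp add: ab vball_iff)
    then have "is_square (a\<^sup>2) \<longleftrightarrow> is_square x" by (rule is_square_vball[OF two x])
    then show ?thesis by (auto simp: is_square_def)
  next
    case False
    then have b: "b \<noteq> 0" "val (b\<^sup>2 * \<pi>) = 2 * val b + 1" "val b < 0"
      using p by (auto simp: pideal_def val_mult val_power2)
    have "a\<^sup>2 = b\<^sup>2 * \<pi> + x" by (simp add: ab)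
    moreover have "x \<in> pideal (val (b\<^sup>2 * \<pi>) + 1)" using x' b by (simp add: pideal_def)
    ultimately have "a\<^sup>2 \<noteq> 0" "val (a\<^sup>2) = 2 * val b + 1"
      using val_add_eq[of "b\<^sup>2 * \<pi>" x] b p by auto
    then have "2 * val a = 2 * val b + 1" using val_power2[of a] by auto
    then show ?thesis by presburger
  qed
qed

text \<open>Its part on the orbit is the image of \<open>SL2_integers\<close> by
  \<open>integral_orbit\<close>, so its measure is the prescribed normalisation.\<close>

definition integral_triples :: "('k::discrete_valued_field \<times> 'k \<times> 'k) set" where
  "integral_triples = pideal 0 \<times> pideal 0 \<times> pideal 0"

section \<open>Volume of the integral points in the three cases\<close>

context orbit_measure
begin

lemma open_triple [simp]: "open A \<Longrightarrow> open B \<Longrightarrow> open C \<Longrightarrow> A \<times> B \<times> C \<in> sets \<nu>"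
  by (intro open_in_nu open_Times)

text \<open>The pieces are: \<open>b\<close> a unit, only \<open>c\<close> a unit, neither. A unit
  \<open>b\<close> makes \<open>c\<close> automatically integral; in the second piece the Weyl
  element makes \<open>b\<close> a unit, and the old condition \<open>b \<in> p\<close> becomes a
  congruence of \<open>a^2\<close> with \<open>\<theta>\<close>.\<close>

lemma emeasure_integral_cells:
  assumes O: "\<theta> \<in> pideal 0"
  shows "emeasure \<nu> integral_triples = emeasure \<nu> (cell (shell 0) (vball 0 0)) +
    emeasure \<nu> {p. fst p \<in> pideal 0 \<and> fst (snd p) \<in> shell 0 \<and> (fst p)\<^sup>2 - \<theta> \<in> pideal 1} +
    emeasure \<nu> (pideal 0 \<times> pideal 1 \<times> pideal 1)"
proof -
  let ?Z1 = "pideal 0 \<times> shell 0 \<times> pideal 0 :: ('k \<times> 'k \<times> 'k) set"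
  let ?Z2 = "pideal 0 \<times> pideal 1 \<times> shell 0 :: ('k \<times> 'k \<times> 'k) set"
  let ?Z3 = "pideal 0 \<times> pideal 1 \<times> pideal 1 :: ('k \<times> 'k \<times> 'k) set"
  let ?W = "{p. fst p \<in> pideal 0 \<and> fst (snd p) \<in> shell 0 \<and> (fst p)\<^sup>2 - \<theta> \<in> pideal 1}"
  have W_eq: "?W = (\<lambda>p. fst p) -` pideal 0 \<inter> (\<lambda>p. fst (snd p)) -` shell 0 \<inter> (\<lambda>p. (fst p)\<^sup>2 - \<theta>) -` pideal 1"
    by auto
  have W: "?W \<in> sets \<nu>"
    unfolding W_eq by (intro open_in_nu open_Int open_vimage continuous_intros) auto
  have "integral_triples = ?Z1 \<union> ?Z2 \<union> ?Z3"
    by (auto simp: integral_triples_def shell_eq intro: pideal_mono[of 0 1])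
  moreover have "?Z1 \<inter> ?Z2 = {}" "(?Z1 \<union> ?Z2) \<inter> ?Z3 = {}" by (auto simp: shell_eq)
  ultimately have "emeasure \<nu> integral_triples = emeasure \<nu> ?Z1 + emeasure \<nu> ?Z2 + emeasure \<nu> ?Z3"
    using plus_emeasure[of ?Z1 \<nu> ?Z2] plus_emeasure[of "?Z1 \<union> ?Z2" \<nu> ?Z3]
      sets.Un[of ?Z1 \<nu> ?Z2] by simp
  moreover have "emeasure \<nu> ?Z1 = emeasure \<nu> (cell (shell 0) (vball 0 0))"
  proof (rule emeasure_cong_orbit)
    fix a b c assume eq: "a\<^sup>2 + b * c = \<theta>"
    have "c \<in> pideal 0" if "a \<in> pideal 0" "b \<in> shell 0"
    proof -
      have "b * c = \<theta> - a * a" using eq by (auto simp: power2_eq_square)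
      then have "b * c \<in> pideal 0" using pideal_diff[OF O pideal_mult'[OF that(1) that(1), of 0]] by simp
      then show ?thesis using shell_0_mult_iff[OF that(2)] by blast
    qed
    then show "(a, b, c) \<in> ?Z1 \<longleftrightarrow> (a, b, c) \<in> cell (shell 0) (vball 0 0)"
      by (auto simp: vball_zero)
  qed auto
  moreover have "emeasure \<nu> ?Z2 = emeasure \<nu> ?W"
  proof (rule emeasure_act_AE[of 0 0 1 "-1"])
    fix a b c assume eq: "a\<^sup>2 + b * c = \<theta>"
    have "b \<in> pideal 1 \<longleftrightarrow> a\<^sup>2 - \<theta> \<in> pideal 1" if "c \<in> shell 0"
    proof -
      have "a\<^sup>2 - \<theta> = - (c * b)" using eq by auto
      then show ?thesis using shell_0_mult_iff[OF that, of b 1] by simp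
    qed
    moreover have "- c \<in> shell 0 \<longleftrightarrow> c \<in> shell 0" by (simp add: shell_def)
    ultimately show "(a, b, c) \<in> ?Z2 \<longleftrightarrow> sl2_act 0 1 (- 1) 0 (a, b, c) \<in> ?W"
      by (auto simp: sl2_act_def)
  qed (use W in auto)
  ultimately show ?thesis by simp
qed

lemma kappa_add: "x \<ge> 0 \<Longrightarrow> y \<ge> 0 \<Longrightarrow> kappa z * ennreal x + kappa z * ennreal y = kappa z * ennreal (x + y)"
  by (simp add: distrib_left)

text \<open>A positive finite \<open>v\<close> can be cancelled, which also rules out the values 0
  and infinity of \<open>kappa 1\<close>.\<close>

lemma kappa_normalised:
  assumes "emeasure \<nu> integral_triples = kappa 1 * ennreal v" "emeasure \<nu> integral_triples = ennreal v" "v > 0"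
  shows "kappa 1 = 1"
proof -
  have "ennreal v * kappa 1 = ennreal v * 1" using assms(1,2) by (simp add: mult.commute)
  then show ?thesis using assms(3) unfolding ennreal_mult_cancel_left by (auto simp: ennreal_eq_0_iff)
qed

lemma norm_card_ramified:
  assumes "uniformiser \<theta>"
  shows "real (card {P \<in> vball 1 ` shell 0. ball_rep P \<in> norm_group \<theta>}) = (q - 1) / 2"
proof -
  have "{P \<in> vball 1 ` shell 0. ball_rep P \<in> norm_group \<theta>} = {P \<in> residue_units. is_square (ball_rep P)}"
    using norm_group_ramified[OF two assms] residue_unitsE(1) by auto
  moreover have "real (2 * card {P \<in> residue_units. is_square (ball_rep P :: 'k)}) = q - 1"
    unfolding card_residue_squares[OF two] using card_residue_units[where ?'k = 'k] q_eq by simp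
  ultimately show ?thesis by simp
qed

lemma norm_card_unramified:
  assumes "\<And>x. x \<in> shell 0 \<Longrightarrow> x \<in> norm_group \<theta>"
  shows "real (card {P \<in> vball 1 ` shell 0. ball_rep P \<in> norm_group \<theta>}) = q - 1"
proof -
  have "{P \<in> vball 1 ` shell 0. ball_rep P \<in> norm_group \<theta>} = (residue_units :: 'k set set)"
    using assms residue_unitsE(1) by auto
  then show ?thesis using card_residue_units[where ?'k = 'k] q_eq by simp
qed

text \<open>Only the first of the three pieces survives, since \<open>\<theta>\<close> is not a
  square modulo \<open>p\<close>; all \<open>q - 1\<close> unit classes are norms, each of volume
  \<open>q^-1\<close>.\<close>

lemma kappa_unramified:
  assumes "nonsquare_unit \<theta>" "emeasure \<nu> integral_triples = ennreal ((q - 1) / q)"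
  shows "kappa 1 = 1"
proof (rule kappa_normalised[OF _ assms(2)])
  have O: "\<theta> \<in> pideal 0" using assms(1) by (auto simp: nonsquare_unit_def pideal_def)
  note ns = nonsquare_unit_not_square_mod[OF assms(1)]
  have "emeasure \<nu> (pideal 0 \<times> pideal 1 \<times> pideal 1) = emeasure \<nu> {}"
  proof (rule emeasure_cong_orbit)
    fix a b c assume eq: "a\<^sup>2 + b * c = \<theta>"
    have "\<theta> - a\<^sup>2 = b * c" using eq by auto
    then show "(a, b, c) \<in> pideal 0 \<times> pideal 1 \<times> pideal 1 \<longleftrightarrow> (a, b, c) \<in> {}"
      using ns[of a] pideal_mult'[of b 1 c 1 1] by auto
  qed auto
  moreover have W: "{p. fst p \<in> pideal 0 \<and> fst (snd p) \<in> shell 0 \<and> (fst p)\<^sup>2 - \<theta> \<in> pideal 1} = {}"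
    using ns pideal_diff_commute by auto
  ultimately show "emeasure \<nu> integral_triples = kappa 1 * ennreal ((q - 1) / q)"
    unfolding emeasure_integral_cells[OF O] W
    using emeasure_cell_shell[of 0 1 0 0] norm_card_unramified[OF norm_group_unramified[OF two assms(1)]]
    by (simp add: power_int_minus divide_inverse)
qed (use q_gt_1 in auto)

text \<open>A point with \<open>b\<close> and \<open>c\<close> in \<open>p\<close> would give
  \<open>a^2\<close> the odd valuation 1. In the second piece \<open>a\<close> runs over
  \<open>p\<close> only, and half of the unit classes are norms, whence \<open>(q - 1)/2\<close>
  times \<open>q^-1 + q^-2\<close>.\<close>

lemma kappa_ramified:
  assumes "uniformiser \<theta>" "emeasure \<nu> integral_triples = ennreal (1 / 2 * (q\<^sup>2 - 1) / q\<^sup>2)"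
  shows "kappa 1 = 1"
proof (rule kappa_normalised[OF _ assms(2)])
  have p: "\<theta> \<noteq> 0" "val \<theta> = 1" using assms(1) by (auto simp: uniformiser_def)
  then have O: "\<theta> \<in> pideal 0" "\<theta> \<in> pideal 1" by (auto simp: pideal_def)
  have "emeasure \<nu> (pideal 0 \<times> pideal 1 \<times> pideal 1) = emeasure \<nu> {}"
  proof (rule emeasure_cong_orbit)
    fix a b c assume eq: "a\<^sup>2 + b * c = \<theta>"
    have False if "b \<in> pideal 1" "c \<in> pideal 1"
    proof -
      have "a\<^sup>2 = \<theta> + - (b * c)" using eq by (simp add: eq_diff_eq)
      moreover have "- (b * c) \<in> pideal (val \<theta> + 1)" using pideal_mult'[OF that, of 2] p by simp
      ultimately have "a\<^sup>2 \<noteq> 0" "val (a\<^sup>2) = 1" using val_add_eq[OF p(1), of "- (b * c)"] p by auto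
      then have "2 * val a = 1" using val_power2[of a] by auto
      then show False by presburger
    qed
    then show "(a, b, c) \<in> pideal 0 \<times> pideal 1 \<times> pideal 1 \<longleftrightarrow> (a, b, c) \<in> {}" by auto
  qed auto
  moreover have "{p. fst p \<in> pideal 0 \<and> fst (snd p) \<in> shell 0 \<and> (fst p)\<^sup>2 - \<theta> \<in> pideal 1} =
      cell (shell 0) (vball 1 0)"
  proof -
    have *: "a \<in> pideal 0 \<and> a\<^sup>2 - \<theta> \<in> pideal 1 \<longleftrightarrow> a \<in> vball 1 0" for a
      unfolding pideal_diff_iff[OF O(2)] pideal_square_iff vball_zero by (auto simp: pideal_def)
    show ?thesis
    proof (rule set_eqI)
      fix p :: "'k \<times> 'k \<times> 'k"
      obtain a b c where p: "p = (a, b, c)" by (cases p)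
      show "p \<in> {p. fst p \<in> pideal 0 \<and> fst (snd p) \<in> shell 0 \<and> (fst p)\<^sup>2 - \<theta> \<in> pideal 1} \<longleftrightarrow>
          p \<in> cell (shell 0) (vball 1 0)" unfolding p using *[of a] by auto
    qed
  qed
  ultimately have "emeasure \<nu> integral_triples =
      kappa 1 * ennreal ((q - 1) / 2 * q powi - 1) + kappa 1 * ennreal ((q - 1) / 2 * q powi - 2)"
    unfolding emeasure_integral_cells[OF O(1)]
    using emeasure_cell_shell[of 0 1 0 0] emeasure_cell_shell[of 0 1 1 0] norm_card_ramified[OF assms(1)]
    by simp
  also have "\<dots> = kappa 1 * ennreal ((q - 1) / 2 * q powi - 1 + (q - 1) / 2 * q powi - 2)"
    using q_gt_1 by (simp add: kappa_add less_imp_le)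
  also have "(q - 1) / 2 * q powi - 1 + (q - 1) / 2 * q powi - 2 = 1 / 2 * (q\<^sup>2 - 1) / q\<^sup>2"
    using q_gt_1 by (simp add: power_int_minus field_simps power2_eq_square)
  finally show "emeasure \<nu> integral_triples = kappa 1 * ennreal (1 / 2 * (q\<^sup>2 - 1) / q\<^sup>2)" .
qed (use q_gt_1 in \<open>auto simp: power2_eq_square less_1_mult intro!: divide_pos_pos mult_pos_pos\<close>)

lemma vball_one_disjoint: "vball 1 1 \<inter> vball 1 (- 1 :: 'k) = {}"
  using val_two[OF two] by (intro vball_disjoint) (simp add: vball_eq_iff pideal_def)

lemma square_congruent_one:
  assumes "a \<in> pideal 0"
  shows "a\<^sup>2 - 1 \<in> pideal 1 \<longleftrightarrow> a \<in> vball 1 1 \<union> vball 1 (- 1 :: 'k)"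
proof -
  have O: "a - 1 \<in> pideal 0" "a + 1 \<in> pideal 0"
    by (rule pideal_diff[OF assms one_in_pideal] pideal_add[OF assms one_in_pideal])+
  have "a\<^sup>2 - 1 = (a - 1) * (a + 1)" by (simp add: power2_eq_square algebra_simps)
  then show ?thesis
    using pideal_1_prime[OF O] pideal_mult'[OF O(1), of "a + 1" 1 1]
      pideal_mult'[OF _ O(2), of "a - 1" 1 1] by (auto simp: vball_iff)
qed

lemma vball_one_integral: "e\<^sup>2 = (1::'k) \<Longrightarrow> vball 1 e \<subseteq> pideal 0"
  by (rule pideal_vball) (auto simp: power2_eq_1_iff pideal_def)

text \<open>Conjugation by the upper unipotent matrix with entry 1 makes the coordinate \<open>b\<close> a unit.\<close>

lemma emeasure_small_off_diagonal:
  assumes "\<theta> = 1" and e: "e\<^sup>2 = 1"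
  shows "emeasure \<nu> (vball 1 e \<times> pideal 1 \<times> pideal 1) = kappa 1 * ennreal (q powi - 2)"
proof -
  note two' = val_two[OF two]
  have two0: "2 \<in> (pideal 0 :: 'k set)" using two' by (simp add: pideal_def)
  have e': "e \<noteq> 0" "val e = 0" using e by (auto simp: power2_eq_1_iff)
  have m: "- 2 * e \<noteq> 0" "val (- 2 * e) = 0" using e' two' by (auto simp: val_mult)
  have "emeasure \<nu> (vball 1 e \<times> pideal 1 \<times> pideal 1) = emeasure \<nu> (cell (vball 1 (- 2 * e)) (vball 1 e))"
  proof (rule emeasure_act_AE[of 1 1 1 0])
    fix a b c assume eq: "a\<^sup>2 + b * c = \<theta>"
    let ?a = "a + c" and ?b = "b - 2 * a - c"
    show "(a, b, c) \<in> vball 1 e \<times> pideal 1 \<times> pideal 1 \<longleftrightarrow>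
      sl2_act 1 1 0 1 (a, b, c) \<in> cell (vball 1 (- 2 * e)) (vball 1 e)" (is "?L \<longleftrightarrow> ?R")
    proof
      assume ?L
      then have abc: "a - e \<in> pideal 1" "b \<in> pideal 1" "c \<in> pideal 1" by (auto simp: vball_iff)
      have "(a - e) + c \<in> pideal 1" using abc by (intro pideal_add)
      moreover have "(b - 2 * (a - e)) - c \<in> pideal 1"
        by (rule pideal_diff[OF pideal_diff[OF abc(2) pideal_mult'[OF two0 abc(1), of 1]] abc(3)]) simp
      ultimately show ?R by (simp add: sl2_act_def vball_iff algebra_simps)
    next
      assume ?R
      then have R: "?a - e \<in> pideal 1" "?b - (- 2 * e) \<in> pideal 1"
        by (simp_all add: sl2_act_def vball_iff)
      have b: "?b \<in> shell 0"
        using vball_val[OF m(1), of ?b] R m(2) by (simp add: vball_iff shell_def)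
      have ein: "?a \<in> vball 1 e" using R(1) by (simp add: vball_iff)
      \<comment> \<open>The action leaves \<open>c\<close> unchanged and preserves the orbit
        equation; as the new \<open>b\<close> is a unit, \<open>c\<close> is a unit multiple of
        \<open>?a^2 - 1\<close>.\<close>
      have "?a\<^sup>2 + ?b * c = 1" using eq assms(1) by (simp add: power2_eq_square algebra_simps)
      then have "(?a\<^sup>2 + ?b * c) - ?a\<^sup>2 = 1 - ?a\<^sup>2" by (rule arg_cong)
      then have "?b * c = - (?a\<^sup>2 - 1)" by simp
      moreover have "?a\<^sup>2 - 1 \<in> pideal 1"
        using square_congruent_one[of ?a] ein vball_one_integral[OF e] e by (auto simp: power2_eq_1_iff)
      ultimately have c: "c \<in> pideal 1" using shell_0_mult_iff[OF b, of c 1] by (simp only: pideal_uminus)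
      have a: "a - e \<in> pideal 1" using pideal_diff[OF R(1) c] by simp
      have "(?b - (- 2 * e)) + 2 * (a - e) + c \<in> pideal 1"
        by (rule pideal_add[OF pideal_add[OF R(2) pideal_mult'[OF two0 a, of 1]] c]) simp
      then have "b \<in> pideal 1" by (simp add: algebra_simps)
      then show ?L using a c by (simp add: vball_iff)
    qed
  qed auto
  also have "\<dots> = kappa (- 2 * e) * ennreal (q powi - 2)"
    using emeasure_cell_kappa[OF m(1), of 1 1 e] m(2) by simp
  finally show ?thesis
    using kappa_norm[of "- 2 * e"] norm_group_one[OF two'(1) m(1)] assms(1) by simp
qed

text \<open>All three pieces occur. As \<open>a^2\<close> congruent to 1 means \<open>a\<close> near
  1 or -1, their volumes are \<open>(q - 1)/q\<close>, \<open>2 (q - 1)/q^2\<close> and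
  \<open>2/q^2\<close>, with sum \<open>(q + 1)/q\<close>.\<close>

lemma kappa_split:
  assumes th: "\<theta> = 1" and "emeasure \<nu> integral_triples = ennreal ((q + 1) / q)"
  shows "kappa 1 = 1"
proof (rule kappa_normalised[OF _ assms(2)])
  have O: "\<theta> \<in> pideal 0" by (simp add: th pideal_def)
  let ?T = "\<lambda>e. vball 1 e \<times> pideal 1 \<times> pideal 1 :: ('k \<times> 'k \<times> 'k) set"
  have "emeasure \<nu> (pideal 0 \<times> pideal 1 \<times> pideal 1) = emeasure \<nu> (?T 1 \<union> ?T (- 1))"
  proof (rule emeasure_cong_orbit)
    fix a b c assume eq: "a\<^sup>2 + b * c = \<theta>"
    have "a\<^sup>2 - 1 \<in> pideal 1" if "b \<in> pideal 1" "c \<in> pideal 1"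
    proof -
      have "a\<^sup>2 - 1 = a\<^sup>2 - (a\<^sup>2 + b * c)" using eq th by simp
      also have "\<dots> = - (b * c)" by simp
      finally show ?thesis using pideal_mult'[OF that, of 1] by simp
    qed
    then show "(a, b, c) \<in> pideal 0 \<times> pideal 1 \<times> pideal 1 \<longleftrightarrow> (a, b, c) \<in> ?T 1 \<union> ?T (- 1)"
      using square_congruent_one[of a] vball_one_integral[of 1] vball_one_integral[of "- 1"] by auto
  qed (intro sets.Un open_triple; simp)+
  also have "\<dots> = emeasure \<nu> (?T 1) + emeasure \<nu> (?T (- 1))"
    using vball_one_disjoint by (intro plus_emeasure[symmetric]) auto
  also have "\<dots> = kappa 1 * ennreal (2 * q powi - 2)"
    using emeasure_small_off_diagonal[OF th] by (simp add: kappa_add less_imp_le)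
  finally have 3: "emeasure \<nu> (pideal 0 \<times> pideal 1 \<times> pideal 1) = kappa 1 * ennreal (2 * q powi - 2)" .
  have card: "real (card {P \<in> vball 1 ` shell 0. ball_rep P \<in> norm_group \<theta>}) = q - 1"
    unfolding th using norm_group_one[OF val_two(1)[OF two]] by (intro norm_card_unramified[unfolded th]) (auto simp: shell_def)
  have "{p. fst p \<in> pideal 0 \<and> fst (snd p) \<in> shell 0 \<and> (fst p)\<^sup>2 - \<theta> \<in> pideal 1} =
      cell (shell 0) (vball 1 1) \<union> cell (shell 0) (vball 1 (- 1))"
  proof -
    have *: "a \<in> pideal 0 \<and> a\<^sup>2 - \<theta> \<in> pideal 1 \<longleftrightarrow> a \<in> vball 1 1 \<union> vball 1 (- 1)" for a
      using square_congruent_one[of a] vball_one_integral[of 1] vball_one_integral[of "- 1"] th by auto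
    show ?thesis
    proof (rule set_eqI)
      fix p :: "'k \<times> 'k \<times> 'k"
      obtain a b c where p: "p = (a, b, c)" by (cases p)
      show "p \<in> {p. fst p \<in> pideal 0 \<and> fst (snd p) \<in> shell 0 \<and> (fst p)\<^sup>2 - \<theta> \<in> pideal 1} \<longleftrightarrow>
          p \<in> cell (shell 0) (vball 1 1) \<union> cell (shell 0) (vball 1 (- 1))" unfolding p using *[of a] by auto
    qed
  qed
  then have "emeasure \<nu> {p. fst p \<in> pideal 0 \<and> fst (snd p) \<in> shell 0 \<and> (fst p)\<^sup>2 - \<theta> \<in> pideal 1} =
      emeasure \<nu> (cell (shell 0) (vball 1 1)) + emeasure \<nu> (cell (shell 0) (vball 1 (- 1)))"
    using vball_one_disjoint by (simp only:, intro plus_emeasure[symmetric]) (auto simp: cell_def)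
  also have "\<dots> = kappa 1 * ennreal (2 * ((q - 1) * q powi - 2))"
    using emeasure_cell_shell[of 0 1 1] card q_gt_1 by (simp add: kappa_add less_imp_le)
  finally have "emeasure \<nu> integral_triples = kappa 1 * ennreal ((q - 1) * q powi - 1) +
      kappa 1 * ennreal (2 * ((q - 1) * q powi - 2)) + kappa 1 * ennreal (2 * q powi - 2)"
    unfolding emeasure_integral_cells[OF O] 3 using emeasure_cell_shell[of 0 1 0 0] card by simp
  also have "\<dots> = kappa 1 * ennreal ((q - 1) * q powi - 1 + 2 * ((q - 1) * q powi - 2) + 2 * q powi - 2)"
    using q_gt_1 by (simp add: kappa_add less_imp_le del: ennreal_plus)
  also have "(q - 1) * q powi - 1 + 2 * ((q - 1) * q powi - 2) + 2 * q powi - 2 = (q + 1) / q"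
    using q_gt_1 by (simp add: power_int_minus field_simps power2_eq_square)
  finally show "emeasure \<nu> integral_triples = kappa 1 * ennreal ((q + 1) / q)" .
qed (use q_gt_1 in auto)

end

section \<open>Truncated orbit integrals\<close>

lemma ball_rep_image:
  assumes "P \<in> vball r ` S" "\<And>x. x \<in> S \<Longrightarrow> vball r x \<subseteq> S"
  shows "ball_rep P \<in> S" "vball r (ball_rep P) = P"
proof -
  obtain y where y: "y \<in> S" "P = vball r y" using assms by blast
  have *: "ball_rep P \<in> vball r y" unfolding y by (rule ball_rep_vball)
  then show "ball_rep P \<in> S" "vball r (ball_rep P) = P"
    using assms(2)[OF y(1)] vball_eqI[OF *] y by auto
qed

lemma has_bochner_integral_AE_0:
  fixes f :: "'a \<Rightarrow> complex"
  assumes "f \<in> borel_measurable M" "AE x in M. f x = 0"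
  shows "has_bochner_integral M f 0"
  using has_bochner_integral_cong_AE[OF assms(1) _ assms(2), of 0] has_bochner_integral_zero by simp

text \<open>With \<open>b c\<close> smaller than \<open>\<theta>\<close>, \<open>a^2\<close> would
  have the valuation of \<open>\<theta>\<close>: odd for a uniformiser, while a non-square unit
  would become congruent to a square. So near \<open>b = 0\<close> non-split orbits have no points
  of bounded \<open>c\<close>.\<close>

lemma nonsplit_off_diagonal:
  assumes cases: "nonsquare_unit \<theta> \<or> uniformiser (\<theta> :: 'k::nonarch_local_field)"
    and "a\<^sup>2 + b * c = \<theta>" and bc: "b * c \<in> pideal (val \<theta> + 1)"
  shows False
proof -
  have th: "\<theta> \<noteq> 0" using cases by (auto simp: nonsquare_unit_def uniformiser_def)
  have "\<theta> + - (b * c) = a\<^sup>2" using assms(2) by auto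
  then have "a\<^sup>2 \<noteq> 0" "val (a\<^sup>2) = val \<theta>" using val_add_eq[OF th, of "- (b * c)"] bc by auto
  then have val_a: "2 * val a = val \<theta>" using val_power2[of a] by auto
  from cases show False
  proof
    assume ns: "nonsquare_unit \<theta>"
    then have "val \<theta> = 0" by (simp add: nonsquare_unit_def)
    moreover have "\<theta> - a\<^sup>2 = b * c" using assms(2) by auto
    ultimately show False using nonsquare_unit_not_square_mod[OF ns, of a] val_a bc by (simp add: pideal_def)
  next
    assume "uniformiser \<theta>"
    then have "2 * val a = 1" using val_a by (simp add: uniformiser_def)
    then show False by presburger
  qed
qed

locale orbit_fourier = orbit_phase dx q \<psi> m \<theta> \<theta>' + orbit_measure dx q \<nu> \<theta>
  for dx :: "'k::nonarch_local_field measure" and q \<psi> m \<theta> \<theta>' \<nu> +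
  assumes theta_cases: "\<theta> = 1 \<or> nonsquare_unit \<theta> \<or> uniformiser \<theta>"
    and kappa_one: "kappa 1 = 1"
    and integral_triples_finite: "emeasure \<nu> integral_triples < \<infinity>"
begin

lemma phase_locally_constant:
  "\<exists>r. n < r \<and> i \<le> r \<and>
    (\<forall>x\<in>shell n. \<forall>x'\<in>vball r x. \<forall>t\<in>pideal i. \<forall>t'\<in>vball r t.
      phase x' t' = phase x t \<and> (\<theta> - t'\<^sup>2 \<in> pideal j \<longleftrightarrow> \<theta> - t\<^sup>2 \<in> pideal j))"
proof -
  \<comment> \<open>The bounds ensure, in order: \<open>t'\<close> stays in \<open>pideal i\<close>;
    \<open>x'\<close> stays in the shell; \<open>(x' - x) \<theta>'\<close>,
    \<open>(1/x' - 1/x) (\<theta> - t'^2)\<close> and \<open>(t'^2 - t^2) / x\<close> lie in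
    \<open>pideal m\<close>; the condition on \<open>\<theta> - t^2\<close> is preserved.\<close>
  define r where "r = Max {i, n + 1, m - val \<theta>', m + 2 * n - min 0 (2 * i), m + n - i, j - i}"
  have "\<forall>y\<in>{i, n + 1, m - val \<theta>', m + 2 * n - min 0 (2 * i), m + n - i, j - i}. y \<le> r"
    unfolding r_def by (intro ballI Max_ge) auto
  then have r: "i \<le> r" "n < r" "m - val \<theta>' \<le> r" "m + 2 * n - min 0 (2 * i) \<le> r" "m + n - i \<le> r" "j - i \<le> r"
    by auto
  have sq: "t'\<^sup>2 - t\<^sup>2 \<in> pideal (r + i)" "t' \<in> pideal i" if "t \<in> pideal i" "t' \<in> vball r t" for t t'
  proof -
    show t': "t' \<in> pideal i" using pideal_vball[OF that(1) r(1)] that(2) by auto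
    have "(t' - t) * (t' + t) \<in> pideal (r + i)"
      using that(2) pideal_add[OF t' that(1)] by (intro pideal_mult) (auto simp: vball_iff)
    then show "t'\<^sup>2 - t\<^sup>2 \<in> pideal (r + i)" by (simp add: power2_eq_square algebra_simps)
  qed
  show ?thesis
  proof (intro exI[of _ r] conjI[OF r(2)] conjI[OF r(1)] ballI conjI)
    fix t t' :: 'k assume t: "t \<in> pideal i" "t' \<in> vball r t"
    have "t'\<^sup>2 - t\<^sup>2 \<in> pideal j" using pideal_mono[OF _ sq(1)[OF t], of j] r by simp
    from pideal_diff_iff[OF this, of "\<theta> - t\<^sup>2"]
    show "\<theta> - t'\<^sup>2 \<in> pideal j \<longleftrightarrow> \<theta> - t\<^sup>2 \<in> pideal j" by simp
  next
    fix x x' t t' :: 'k assume x: "x \<in> shell n" "x' \<in> vball r x" and t: "t \<in> pideal i" "t' \<in> vball r t"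
    have x0: "x \<noteq> 0" "val x = n" using x by (auto simp: shell_def)
    have x1: "x' \<noteq> 0" "val x' = n" using shell_vball[OF x(1) r(2)] x(2) by (auto simp: shell_def)
    have xx: "x' - x \<in> pideal r" using x(2) by (simp add: vball_iff)
    have inv: "inverse x \<in> pideal (- n)" "inverse x' \<in> pideal (- n)"
      using x0 x1 by (simp_all add: pideal_def val_inverse)
    have 1: "(x' - x) * \<theta>' \<in> pideal m" by (rule pideal_mult'[OF xx pideal_self]) (use r in simp)
    have th: "\<theta> - t'\<^sup>2 \<in> pideal (min 0 (2 * i))"
    proof (rule pideal_diff)
      show "\<theta> \<in> pideal (min 0 (2 * i))" using theta by (simp add: pideal_def)
      show "t'\<^sup>2 \<in> pideal (min 0 (2 * i))" unfolding power2_eq_square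
        by (rule pideal_mult'[OF sq(2)[OF t] sq(2)[OF t]]) simp
    qed
    have "inverse x' - inverse x = (inverse x * inverse x') * - (x' - x)"
      using x0 x1 by (simp add: field_simps)
    moreover have "(inverse x * inverse x') * - (x' - x) \<in> pideal (- n - n + r)"
      by (rule pideal_mult'[OF pideal_mult[OF inv]]) (use xx in \<open>simp_all only: pideal_uminus\<close>, simp)
    ultimately have inv': "inverse x' - inverse x \<in> pideal (- n - n + r)" by simp
    have 2: "(inverse x' - inverse x) * (\<theta> - t'\<^sup>2) \<in> pideal m"
      by (rule pideal_mult'[OF inv' th]) (use r in simp)
    have 3: "inverse x * (t'\<^sup>2 - t\<^sup>2) \<in> pideal m"
      by (rule pideal_mult'[OF inv(1) sq(1)[OF t]]) (use r in simp)
    have "(x' - x) * \<theta>' + (inverse x' - inverse x) * (\<theta> - t'\<^sup>2) - inverse x * (t'\<^sup>2 - t\<^sup>2) \<in> pideal m"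
      by (intro pideal_diff[OF pideal_add[OF 1 2] 3])
    then show "phase x' t' = phase x t"
      unfolding phase_def by (intro psi_cong) (simp add: algebra_simps)
  qed
qed

text \<open>The outer term at \<open>n\<close>, with the inner series already replaced by one
  integral as in \<open>inner_sum\<close>.\<close>

definition mock_term :: "int \<Rightarrow> complex" where
  "mock_term n = complex_of_real (q powi n) * (LINT x|dx. indicator (shell n) x *
     (indicator (norm_group \<theta>) x * (LINT t|dx. indicator (pideal (shell_start n)) t * phase x t)))"

lemma norm_group_indicator_vball:
  assumes "x \<in> shell n" "n < r" "y \<in> vball r x"
  shows "indicator (norm_group \<theta>) y = indicator (norm_group \<theta>) x"
proof -
  have "x \<noteq> 0" "y \<in> vball (val x + 1) x"
    using assms vball_subset[of "n + 1" r x] by (auto simp: shell_def)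
  then show ?thesis using norm_group_vball[OF two, of x y \<theta>] by (simp add: indicator_def)
qed

lemma mock_fourier_term:
  "(LINT x:shell n|mult_measure dx. indicator (norm_group \<theta>) x *
      (\<Sum>\<^sub>\<infinity>l::int. LINT t:shell l|dx. phase x t)) = mock_term n"
proof -
  let ?g = "\<lambda>x. LINT t|dx. indicator (pideal (shell_start n)) t * phase x t"
  obtain r where r: "n < r" and const: "\<forall>x\<in>shell n. \<forall>x'\<in>vball r x. \<forall>t\<in>pideal (shell_start n). \<forall>t'\<in>vball r t.
      phase x' t' = phase x t \<and> (\<theta> - t'\<^sup>2 \<in> pideal 0 \<longleftrightarrow> \<theta> - t\<^sup>2 \<in> pideal 0)"
    using phase_locally_constant[of n "shell_start n" 0] by (elim exE conjE) (rule that)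
  have g: "?g y = ?g x" if "x \<in> shell n" "y \<in> vball r x" for x y
    using const[THEN bspec, OF that(1), THEN bspec, OF that(2), THEN bspec, THEN bspec, OF _ vball_self]
    by (intro Bochner_Integration.integral_cong) (simp_all add: indicator_def)
  have "(LINT x:shell n|mult_measure dx. indicator (norm_group \<theta>) x * ?g x) = mock_term n"
    unfolding mock_term_def
  proof (rule integral_mult_measure_shell[OF r])
    fix x y :: 'k assume xy: "x \<in> shell n" "y \<in> vball r x"
    show "indicator (norm_group \<theta>) y * ?g y = indicator (norm_group \<theta>) x * ?g x"
      unfolding g[OF xy] norm_group_indicator_vball[OF xy(1) r xy(2)] ..
  qed
  moreover have "indicator (shell n) x *\<^sub>R (indicator (norm_group \<theta>) x *
      (\<Sum>\<^sub>\<infinity>l::int. LINT t:shell l|dx. phase x t)) =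
      indicator (shell n) x *\<^sub>R (indicator (norm_group \<theta>) x * ?g x)" for x
    using inner_sum[of x n] by (cases "x \<in> shell n") simp_all
  ultimately show ?thesis unfolding set_lebesgue_integral_def by (simp only:)
qed

text \<open>This is \<open>\<Phi>\<close> of the pairing of the orbit point with \<open>Y\<close>;
  the factor \<open>\<beta> s\<close> sits in \<open>\<psi>\<close>.\<close>

definition kernel :: "'k \<times> 'k \<times> 'k \<Rightarrow> complex" where
  "kernel p = \<psi> (fst (snd p) * \<theta>' + snd (snd p))"

lemma kernel_meas [measurable]: "kernel \<in> borel_measurable \<nu>"
proof -
  have "continuous_on UNIV (\<psi> \<circ> (\<lambda>p. fst (snd p) * \<theta>' + snd (snd p)))"
    by (intro continuous_on_compose continuous_intros continuous_on_subset[OF psi_cont]) auto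
  then have "kernel \<in> borel_measurable borel"
    by (intro borel_measurable_continuous_onI) (simp add: kernel_def[abs_def] comp_def)
  then show ?thesis by (simp add: measurable_cong_sets[OF sets_nu refl])
qed

lemma truncated_kernel_meas: "open S \<Longrightarrow> (\<lambda>p. indicator S p * kernel p) \<in> borel_measurable \<nu>"
  by (intro borel_measurable_times borel_measurable_indicator kernel_meas open_in_nu)

lemma kernel_norm [simp]: "cmod (kernel p) = 1" by (simp add: kernel_def psi_norm)

lemma kernel_orbit: "a\<^sup>2 + b * c = \<theta> \<Longrightarrow> b \<noteq> 0 \<Longrightarrow> kernel (a, b, c) = phase b a"
proof -
  assume *: "a\<^sup>2 + b * c = \<theta>" "b \<noteq> 0"
  then have "inverse b * \<theta> - inverse b * a\<^sup>2 = c" by (auto simp: field_simps)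
  then show ?thesis by (simp add: kernel_def phase_def add_diff_eq[symmetric])
qed

text \<open>Since \<open>kappa\<close> is 1 on norms and 0 on the other non-zero elements, the orbit
  measure itself produces the indicator of the norm group in the mock Fourier transform.\<close>

lemma cell_integral:
  assumes x: "x \<in> shell n" and r: "n < r"
  shows "has_bochner_integral \<nu> (\<lambda>p. indicator (cell (vball r x) (vball r t)) p * (c :: complex))
     (complex_of_real (q powi n * (q powi (- r) * q powi (- r))) * (indicator (norm_group \<theta>) x * c))"
proof -
  have x': "x \<noteq> 0" "val x = n" using x by (auto simp: shell_def)
  have "emeasure \<nu> (cell (vball r x) (vball r t)) = kappa x * ennreal (q powi (n - r - r))"
    using emeasure_cell_kappa[OF x'(1), of r r t] x' r by simp
  also have "kappa x = ennreal (indicator (norm_group \<theta>) x)"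
    using kappa_norm[of x] kappa_non_norm[OF x'(1)] kappa_one by (simp add: indicator_def)
  also have "q powi (n - r - r) = q powi n * (q powi (- r) * q powi (- r))"
    using q_gt_1 by (simp add: power_int_add[symmetric])
  finally have em: "emeasure \<nu> (cell (vball r x) (vball r t)) =
      ennreal (indicator (norm_group \<theta>) x * (q powi n * (q powi (- r) * q powi (- r))))"
    by (simp add: ennreal_mult' less_imp_le)
  have "measure \<nu> (cell (vball r x) (vball r t)) =
      indicator (norm_group \<theta>) x * (q powi n * (q powi (- r) * q powi (- r)))"
    unfolding measure_def em by (rule enn2real_ennreal) (simp add: less_imp_le)
  moreover have "emeasure \<nu> (cell (vball r x) (vball r t)) < \<infinity>" by (simp add: em)
  ultimately show ?thesis
    using has_bochner_integral_indicator_times[of "cell (vball r x) (vball r t)" \<nu> c]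
    by (cases "x \<in> norm_group \<theta>") (simp_all add: mult.assoc)
qed

text \<open>The measure \<open>|b|^-1 da db\<close> at work on one shell of \<open>b\<close>: at a
  common radius of constancy both sides are the same finite sum over cells, and the bound on
  \<open>c\<close> becomes the condition on \<open>\<theta> - t^2\<close>.\<close>

lemma shell_integral:
  fixes A n C :: int
  defines "K \<equiv> \<lambda>x. LINT t|dx. indicator (pideal (- A) \<inter> {t. \<theta> - t\<^sup>2 \<in> pideal (n - C)}) t * phase x t"
  shows "has_bochner_integral \<nu> (\<lambda>p. indicator (pideal (- A) \<times> shell n \<times> pideal (- C)) p * kernel p)
     (complex_of_real (q powi n) *
       (LINT x|dx. indicator (shell n) x * (indicator (norm_group \<theta>) x * K x)))"
proof -
  define H where "H x t = indicator {t. \<theta> - t\<^sup>2 \<in> pideal (n - C)} t * phase x t" for x t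
  obtain r where r: "n < r" "- A \<le> r" and const: "\<forall>x\<in>shell n. \<forall>x'\<in>vball r x. \<forall>t\<in>pideal (- A). \<forall>t'\<in>vball r t.
      phase x' t' = phase x t \<and> (\<theta> - t'\<^sup>2 \<in> pideal (n - C) \<longleftrightarrow> \<theta> - t\<^sup>2 \<in> pideal (n - C))"
    using phase_locally_constant[of n "- A" "n - C"] by (elim exE conjE) (rule that)
  have H: "H x' t' = H x t"
    if "x \<in> shell n" "x' \<in> vball r x" "t \<in> pideal (- A)" "t' \<in> vball r t" for x x' t t'
    unfolding H_def
    using const[THEN bspec, OF that(1), THEN bspec, OF that(2), THEN bspec, OF that(3), THEN bspec, OF that(4)]
    by (simp add: indicator_def)
  let ?S = "shell n :: 'k set" and ?T = "pideal (- A) :: 'k set"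
  have fin: "finite (vball r ` ?S)" "finite (vball r ` ?T)"
    by (rule finite_vball_image[of _ n 0], simp add: vball_zero shell_eq,
        rule finite_vball_image[of _ "- A" 0], simp add: vball_zero)
  have sub: "\<And>x. x \<in> ?S \<Longrightarrow> vball r x \<subseteq> ?S" "\<And>x. x \<in> ?T \<Longrightarrow> vball r x \<subseteq> ?T"
    using shell_vball[OF _ r(1)] pideal_vball[OF _ r(2)] by blast+
  have repS: "ball_rep P \<in> ?S" "vball r (ball_rep P) = P" if "P \<in> vball r ` ?S" for P
    using ball_rep_image[OF that sub(1)] by auto
  have repT: "ball_rep P \<in> ?T" "vball r (ball_rep P) = P" if "P \<in> vball r ` ?T" for P
    using ball_rep_image[OF that sub(2)] by auto
  have K: "K x = (\<Sum>Q\<in>vball r ` ?T. complex_of_real (q powi (- r)) * H x (ball_rep Q))"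
    if "x \<in> ?S" for x
  proof -
    have "K x = (LINT t|dx. indicator ?T t * H x t)"
      unfolding K_def H_def by (simp only: indicator_inter_arith mult.assoc)
    also have "\<dots> = (\<Sum>Q\<in>vball r ` ?T. complex_of_real (q powi (- r)) * H x (ball_rep Q))"
      by (rule integral_locally_constant[OF fin(2) sub(2) H[OF that vball_self]])
    finally show ?thesis .
  qed
  have "(LINT x|dx. indicator ?S x * (indicator (norm_group \<theta>) x * K x)) =
      (\<Sum>P\<in>vball r ` ?S. complex_of_real (q powi (- r)) * (indicator (norm_group \<theta>) (ball_rep P) * K (ball_rep P)))"
  proof (rule integral_locally_constant[OF fin(1) sub(1)])
    fix x y assume xy: "x \<in> ?S" "y \<in> vball r x"
    have "K y = K x" unfolding K[OF xy(1)] K[OF subsetD[OF sub(1)[OF xy(1)] xy(2)]]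
      using H[OF xy _ vball_self] repT(1) by (intro sum.cong refl) simp
    then show "indicator (norm_group \<theta>) y * K y = indicator (norm_group \<theta>) x * K x"
      using norm_group_indicator_vball[OF xy(1) r(1) xy(2), where ?'a = complex] by simp
  qed
  also have "\<dots> = (\<Sum>P\<in>vball r ` ?S. \<Sum>Q\<in>vball r ` ?T. complex_of_real (q powi (- r) * q powi (- r)) *
      (indicator (norm_group \<theta>) (ball_rep P) * H (ball_rep P) (ball_rep Q)))"
    using K[OF repS(1)] by (intro sum.cong refl) (simp add: sum_distrib_left mult_ac)
  finally have rhs: "complex_of_real (q powi n) * (LINT x|dx. indicator ?S x * (indicator (norm_group \<theta>) x * K x)) =
      (\<Sum>P\<in>vball r ` ?S. \<Sum>Q\<in>vball r ` ?T. complex_of_real (q powi n * (q powi (- r) * q powi (- r))) *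
      (indicator (norm_group \<theta>) (ball_rep P) * H (ball_rep P) (ball_rep Q)))"
    by (simp add: sum_distrib_left mult_ac)
  \<comment> \<open>A step function of \<open>a\<close> and \<open>b\<close> alone; it agrees with
    the truncated kernel on the orbit, hence almost everywhere.\<close>
  let ?G = "\<lambda>p. \<Sum>P\<in>vball r ` ?S. \<Sum>Q\<in>vball r ` ?T. indicator (cell P Q) p * H (ball_rep P) (ball_rep Q)"
  have G: "has_bochner_integral \<nu> ?G
     (complex_of_real (q powi n) * (LINT x|dx. indicator ?S x * (indicator (norm_group \<theta>) x * K x)))"
    unfolding rhs
  proof (intro has_bochner_integral_sum)
    fix P Q assume "P \<in> vball r ` ?S" "Q \<in> vball r ` ?T"
    then show "has_bochner_integral \<nu> (\<lambda>p. indicator (cell P Q) p * H (ball_rep P) (ball_rep Q))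
      (complex_of_real (q powi n * (q powi (- r) * q powi (- r))) *
        (indicator (norm_group \<theta>) (ball_rep P) * H (ball_rep P) (ball_rep Q)))"
      using cell_integral[OF repS(1) r(1), of P "ball_rep Q"] repS(2) repT(2) by simp
  qed
  have G_eq: "?G (a, b, c) = indicator ?S b * (indicator ?T a * H b a)" for a b c
  proof -
    have "?G (a, b, c) = (\<Sum>P\<in>vball r ` ?S. indicator P b * (\<Sum>Q\<in>vball r ` ?T. indicator Q a * H (ball_rep P) (ball_rep Q)))"
      by (simp add: sum_distrib_left cell_def indicator_times mult_ac)
    also have "\<dots> = indicator ?S b * (indicator ?T a * H (ball_rep (vball r b)) (ball_rep (vball r a)))"
      using sum_indicator_vballs[OF fin(1) sub(1), of b "\<lambda>P. \<Sum>Q\<in>vball r ` ?T. indicator Q a * H (ball_rep P) (ball_rep Q)"]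
        sum_indicator_vballs[OF fin(2) sub(2), of a "\<lambda>Q. H (ball_rep (vball r b)) (ball_rep Q)"] by simp
    also have "\<dots> = indicator ?S b * (indicator ?T a * H b a)"
      using H[OF _ ball_rep_vball _ ball_rep_vball, of b a] by (simp add: indicator_def)
    finally show ?thesis .
  qed
  have AE: "AE p in \<nu>. ?G p = indicator (?T \<times> ?S \<times> pideal (- C)) p * kernel p"
    using orbit
  proof eventually_elim
    case (elim p)
    obtain a b c where p: "p = (a, b, c)" by (cases p)
    have eq: "a\<^sup>2 + b * c = \<theta>" using elim by (simp add: p)
    show ?case
    proof (cases "b \<in> ?S")
      case True
      then have b: "b \<noteq> 0" "val b = n" by (auto simp: shell_def)
      have "\<theta> - a\<^sup>2 = b * c" using eq by auto
      then have "\<theta> - a\<^sup>2 \<in> pideal (n - C) \<longleftrightarrow> c \<in> pideal (- C)"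
        using pideal_mult_iff[OF b(1), of c "n - C"] b(2) by simp
      then show ?thesis unfolding p G_eq using kernel_orbit[OF eq b(1)] True
        by (simp add: H_def indicator_def)
    next
      case False
      then show ?thesis unfolding p G_eq by (simp add: indicator_def)
    qed
  qed
  have meas: "(\<lambda>p. indicator (?T \<times> ?S \<times> pideal (- C)) p * kernel p) \<in> borel_measurable \<nu>"
    by (intro truncated_kernel_meas open_Times) auto
  show ?thesis
    using has_bochner_integral_cong_AE[OF _ meas AE] borel_measurable_has_bochner_integral[OF G] G by blast
qed

section \<open>The neighbourhood of \<open>b = 0\<close>\<close>

text \<open>A diagonal element moves the region into \<open>integral_triples\<close>, whose measure
  is finite; this gives integrability near \<open>b = 0\<close>.\<close>

lemma split_region_finite:
  assumes "e\<^sup>2 = (1::'k)"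
  shows "emeasure \<nu> (vball 1 e \<times> pideal (C + 1) \<times> pideal (- C)) < \<infinity>"
proof -
  \<comment> \<open>The rounding gives both \<open>2 val d \<le> C + 1\<close>, which makes
    \<open>b d^-2\<close> integral, and \<open>2 val d \<ge> C\<close>, which makes
    \<open>c d^2\<close> integral.\<close>
  obtain d :: 'k where d: "d \<noteq> 0" "val d = (C + 1) div 2" using val_surj by blast
  let ?g = "sl2_act (inverse d) 0 0 d"
  have "vball 1 e \<times> pideal (C + 1) \<times> pideal (- C) \<subseteq> ?g -` integral_triples"
  proof
    fix p :: "'k \<times> 'k \<times> 'k" assume "p \<in> vball 1 e \<times> pideal (C + 1) \<times> pideal (- C)"
    then obtain a b c where p: "p = (a, b, c)"
      and a: "a \<in> vball 1 e" and b: "b \<in> pideal (C + 1)" and c: "c \<in> pideal (- C)" by blast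
    have "a \<in> pideal 0" using vball_one_integral[OF assms] a by blast
    moreover have "b * (inverse d)\<^sup>2 \<in> pideal 0"
      using d by (intro pideal_mult'[OF b, of _ "- 2 * val d"]) (auto simp: pideal_def val_power2 val_inverse)
    moreover have "c * d\<^sup>2 \<in> pideal 0"
      using d by (intro pideal_mult'[OF c, of _ "2 * val d"]) (auto simp: pideal_def val_power2)
    ultimately show "p \<in> ?g -` integral_triples"
      using d by (simp add: p sl2_act_def integral_triples_def)
  qed
  moreover have I: "integral_triples \<in> sets \<nu>" unfolding integral_triples_def by (intro open_triple) auto
  ultimately have "emeasure \<nu> (vball 1 e \<times> pideal (C + 1) \<times> pideal (- C)) \<le> emeasure \<nu> (?g -` integral_triples)"
    using measurable_sets[OF sl2_act_meas, of integral_triples] sets_nu by (intro emeasure_mono) auto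
  then show ?thesis using emeasure_act[OF _ I, of "inverse d" d 0 0] d integral_triples_finite by simp
qed

text \<open>
  Near the points with \<open>b = 0\<close> the lower unipotent subgroup multiplies the kernel by a
  non-trivial character value while preserving the region.
\<close>

lemma split_region_integral:
  assumes th: "\<theta> = 1" and e: "e\<^sup>2 = 1" and C: "1 - m \<le> C"
  shows "has_bochner_integral \<nu> (\<lambda>p. indicator (vball 1 e \<times> pideal (C + 1) \<times> pideal (- C)) p * kernel p) 0"
proof -
  note two' = val_two[OF two]
  let ?R = "vball 1 e \<times> pideal (C + 1) \<times> pideal (- C) :: ('k \<times> 'k \<times> 'k) set"
  let ?f = "\<lambda>p. indicator ?R p * kernel p"
  have e': "e \<noteq> 0" "val e = 0" using e by (auto simp: power2_eq_1_iff)
  obtain z where z: "z \<noteq> 0" "val z = m - 1" "\<psi> z \<noteq> 1" by (rule psi_witness)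
  \<comment> \<open>On the region \<open>c\<close> moves by \<open>2 u a - b u^2\<close>, which is
    \<open>2 u e = z\<close> modulo \<open>pideal m\<close>; the bound \<open>1 - m \<le> C\<close>
    makes the shift preserve all three conditions.\<close>
  define u where "u = z / (2 * e)"
  have u: "u \<in> pideal (m - 1)" "2 * u * e = z"
    using z e' two' by (auto simp: u_def pideal_def val_divide val_mult)
  have meas: "?f \<in> borel_measurable \<nu>" by (intro truncated_kernel_meas open_Times) auto
  then have meas': "?f \<in> borel_measurable borel" by (simp add: measurable_cong_sets[OF sets_nu refl])
  have "emeasure \<nu> ?R < \<infinity>" by (rule split_region_finite[OF e])
  then have int: "integrable \<nu> ?f"
    by (intro integrableI_bounded_set[of ?R _ _ 1] meas) (auto simp: indicator_def)
  have shift: "?f (sl2_act 1 0 u 1 p) = \<psi> z * ?f p" for p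
  proof -
    obtain a b c where p: "p = (a, b, c)" by (cases p)
    have act: "sl2_act 1 0 u 1 p = (a - b * u, b, c + (2 * u * a - b * u\<^sup>2))"
      by (simp add: p sl2_act_def)
    show ?thesis
    proof (cases "b \<in> pideal (C + 1)")
      case True
      have bu: "b * u \<in> pideal 1" by (rule pideal_mult'[OF True u(1)]) (use C in simp)
      have buu: "b * u\<^sup>2 \<in> pideal m"
        unfolding power2_eq_square mult.assoc[symmetric]
        by (rule pideal_mult'[OF pideal_mult[OF True u(1)] u(1)]) (use C in simp)
      have a: "a - b * u \<in> vball 1 e \<longleftrightarrow> a \<in> vball 1 e"
        using pideal_diff_iff[OF bu, of "a - e"] by (simp add: vball_iff algebra_simps)
      show ?thesis
      proof (cases "a \<in> vball 1 e")
        case True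
        have ae: "u * (2 * (a - e)) \<in> pideal m"
          using True two' by (intro pideal_mult'[OF u(1), of _ 1] pideal_mult'[of 2 0 _ 1])
            (auto simp: vball_iff pideal_def)
        have eq: "2 * u * a - b * u\<^sup>2 = z + (u * (2 * (a - e)) - b * u\<^sup>2)"
          using u(2) by (simp add: algebra_simps)
        have "z \<in> pideal (- C)" using z C by (simp add: pideal_def)
        moreover have small: "u * (2 * (a - e)) - b * u\<^sup>2 \<in> pideal m" by (rule pideal_diff[OF ae buu])
        then have "u * (2 * (a - e)) - b * u\<^sup>2 \<in> pideal (- C)" by (rule pideal_mono[rotated]) (use C in simp)
        ultimately have shift_c: "2 * u * a - b * u\<^sup>2 \<in> pideal (- C)" unfolding eq by (rule pideal_add)
        have c: "c + (2 * u * a - b * u\<^sup>2) \<in> pideal (- C) \<longleftrightarrow> c \<in> pideal (- C)"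
          using pideal_diff_iff[OF shift_c, of "c + (2 * u * a - b * u\<^sup>2)"] by simp
        have "kernel (sl2_act 1 0 u 1 p) = \<psi> z * kernel p"
          unfolding act unfolding kernel_def p fst_conv snd_conv psi_add[symmetric] eq
          using small by (intro psi_cong) (simp add: algebra_simps)
        then show ?thesis unfolding act unfolding p using a c True \<open>b \<in> _\<close> by (simp add: indicator_def)
      next
        case False
        then show ?thesis unfolding act unfolding p using a by (simp add: indicator_def)
      qed
    next
      case False
      then show ?thesis unfolding act unfolding p by (simp add: indicator_def)
    qed
  qed
  have "(LINT p|\<nu>. ?f p) = (LINT p|distr \<nu> borel (sl2_act 1 0 u 1). ?f p)"
    using invariant[of 1 1 0 u] by simp
  also have "\<dots> = (LINT p|\<nu>. ?f (sl2_act 1 0 u 1 p))"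
    by (rule integral_distr[OF sl2_act_meas meas'])
  also have "\<dots> = \<psi> z * (LINT p|\<nu>. ?f p)" unfolding shift by simp
  finally have "(LINT p|\<nu>. ?f p) = 0" using z(3) by simp
  then show ?thesis using int by (simp add: has_bochner_integral_iff)
qed

text \<open>The \<open>+ 1\<close> makes \<open>b c\<close> smaller than \<open>\<theta>\<close>.
  For non-split \<open>\<theta>\<close> the region then misses the orbit; for
  \<open>\<theta> = 1\<close> it forces \<open>a\<close> close to 1 or -1, where
  \<open>split_region_integral\<close> applies.\<close>

lemma orbit_tail_integral:
  assumes C: "1 - m \<le> C" and A: "0 \<le> A"
  shows "has_bochner_integral \<nu>
    (\<lambda>p. indicator (pideal (- A) \<times> pideal (C + val \<theta> + 1) \<times> pideal (- C)) p * kernel p) 0"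
proof (cases "\<theta> = 1")
  case False
  have "AE p in \<nu>. indicator (pideal (- A) \<times> pideal (C + val \<theta> + 1) \<times> pideal (- C)) p * kernel p = 0"
    using orbit
  proof eventually_elim
    case (elim p)
    have "fst (snd p) * snd (snd p) \<in> pideal (val \<theta> + 1)"
      if "fst (snd p) \<in> pideal (C + val \<theta> + 1)" "snd (snd p) \<in> pideal (- C)"
      by (rule pideal_mult'[OF that]) simp
    then show ?case using nonsplit_off_diagonal[of \<theta> "fst p" "fst (snd p)" "snd (snd p)"] False theta_cases elim
      by (auto simp: indicator_def mem_Times_iff)
  qed
  moreover have "(\<lambda>p. indicator (pideal (- A) \<times> pideal (C + val \<theta> + 1) \<times> pideal (- C)) p * kernel p)
      \<in> borel_measurable \<nu>"
    by (intro truncated_kernel_meas open_Times) auto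
  ultimately show ?thesis by (rule has_bochner_integral_AE_0[rotated])
next
  case True
  let ?R = "\<lambda>e. vball 1 e \<times> pideal (C + 1) \<times> pideal (- C) :: ('k \<times> 'k \<times> 'k) set"
  let ?Z = "pideal (- A) \<times> pideal (C + 1) \<times> pideal (- C) :: ('k \<times> 'k \<times> 'k) set"
  have 0: "has_bochner_integral \<nu> (\<lambda>p. indicator (?R 1) p * kernel p + indicator (?R (- 1)) p * kernel p) (0 + 0)"
    by (intro has_bochner_integral_add split_region_integral True C) auto
  have AE: "AE p in \<nu>. indicator (?R 1) p * kernel p + indicator (?R (- 1)) p * kernel p = indicator ?Z p * kernel p"
    using orbit
  proof eventually_elim
    case (elim p)
    obtain a b c where p: "p = (a, b, c)" by (cases p)
    have eq: "a\<^sup>2 + b * c = 1" using elim True by (simp add: p)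
    have key: "a \<in> pideal (- A) \<longleftrightarrow> a \<in> vball 1 1 \<or> a \<in> vball 1 (- 1)"
      if "b \<in> pideal (C + 1)" "c \<in> pideal (- C)"
    proof -
      have bc: "b * c \<in> pideal 1" by (rule pideal_mult'[OF that]) simp
      have sq: "a\<^sup>2 = 1 - b * c" by (simp add: eq[symmetric])
      have "a\<^sup>2 \<in> pideal 0" unfolding sq using pideal_mono[OF _ bc, of 0] by (intro pideal_diff one_in_pideal) auto
      then have a: "a \<in> pideal 0" unfolding pideal_square_iff by (auto simp: pideal_def)
      moreover have "a\<^sup>2 - 1 \<in> pideal 1" unfolding sq using bc by simp
      ultimately show ?thesis using square_congruent_one[OF a] pideal_mono[OF _ a, of "- A"] A by simp
    qed
    have "\<not> (a \<in> vball 1 1 \<and> a \<in> vball 1 (- 1))" using vball_one_disjoint by blast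
    then show ?case
      by (cases "b \<in> pideal (C + 1) \<and> c \<in> pideal (- C)"; cases "a \<in> vball 1 1"; cases "a \<in> vball 1 (- 1)")
        (simp_all add: p indicator_def key)
  qed
  have meas: "(\<lambda>p. indicator ?Z p * kernel p) \<in> borel_measurable \<nu>"
    by (intro truncated_kernel_meas open_Times) auto
  have "has_bochner_integral \<nu> (\<lambda>p. indicator ?Z p * kernel p) (0 + 0)"
    using has_bochner_integral_cong_AE[OF _ meas AE] borel_measurable_has_bochner_integral[OF 0] 0 by blast
  then show ?thesis using True by simp
qed

text \<open>The shells \<open>n \<le> C + val \<theta>\<close> are those to which
  \<open>truncated_inner_integral\<close> applies; what lies beyond is exactly the tail that
  vanishes.\<close>

lemma truncated_orbit_integral:
  assumes C: "1 - m \<le> C" and A: "0 \<le> A" "- A \<le> shell_start (- B)" and BC: "- B \<le> C"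
  shows "(LINT p|\<nu>. indicator (pideal (- A) \<times> pideal (- B) \<times> pideal (- C)) p * kernel p) =
    (\<Sum>n\<in>{- B..<C + val \<theta> + 1}. mock_term n)"
proof -
  let ?M = "C + val \<theta> + 1"
  have shell_term: "has_bochner_integral \<nu> (\<lambda>p. indicator (pideal (- A) \<times> shell n \<times> pideal (- C)) p * kernel p) (mock_term n)"
    if n: "n \<in> {- B..<?M}" for n
  proof -
    have "- A \<le> shell_start n" using n A(2) by (auto simp: shell_start_def)
    then have "(LINT t|dx. indicator (pideal (- A) \<inter> {t. \<theta> - t\<^sup>2 \<in> pideal (n - C)}) t * phase x t) =
        (LINT t|dx. indicator (pideal (shell_start n)) t * phase x t)" if "x \<in> shell n" for x
      using n by (intro truncated_inner_integral[OF that C]) auto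
    then have "(LINT x|dx. indicator (shell n) x * (indicator (norm_group \<theta>) x *
          (LINT t|dx. indicator (pideal (- A) \<inter> {t. \<theta> - t\<^sup>2 \<in> pideal (n - C)}) t * phase x t))) =
        (LINT x|dx. indicator (shell n) x * (indicator (norm_group \<theta>) x *
          (LINT t|dx. indicator (pideal (shell_start n)) t * phase x t)))"
      by (intro Bochner_Integration.integral_cong refl) (simp add: indicator_def)
    then show ?thesis using shell_integral[of A n C] by (simp add: mock_term_def)
  qed
  have "has_bochner_integral \<nu> (\<lambda>p. indicator (pideal (- A) \<times> pideal ?M \<times> pideal (- C)) p * kernel p +
      (\<Sum>n\<in>{- B..<?M}. indicator (pideal (- A) \<times> shell n \<times> pideal (- C)) p * kernel p))
      (0 + (\<Sum>n\<in>{- B..<?M}. mock_term n))"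
    by (intro has_bochner_integral_add has_bochner_integral_sum orbit_tail_integral C A shell_term)
  moreover have "indicator (pideal (- A) \<times> pideal ?M \<times> pideal (- C)) p * kernel p +
      (\<Sum>n\<in>{- B..<?M}. indicator (pideal (- A) \<times> shell n \<times> pideal (- C)) p * kernel p) =
      indicator (pideal (- A) \<times> pideal (- B) \<times> pideal (- C)) p * kernel p" for p
  proof -
    obtain a b c where p: "p = (a, b, c)" by (cases p)
    have "- B \<le> ?M" using BC theta by simp
    from indicator_pideal_split[OF this, of b] show ?thesis
      by (simp only: p indicator_times fst_conv snd_conv distrib_left distrib_right sum_distrib_left sum_distrib_right)
  qed
  ultimately show ?thesis by (simp add: has_bochner_integral_iff)
qed

lemma truncated_orbit_integral_limit:
  assumes "\<And>A B C. k \<le> A \<Longrightarrow> k \<le> B \<Longrightarrow> k \<le> C \<Longrightarrow>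
      (LINT p|\<nu>. indicator (pideal (- A) \<times> pideal (- B) \<times> pideal (- C)) p * kernel p) = v"
  shows "v = (\<Sum>\<^sub>\<infinity>n. mock_term n)"
proof -
  define k0 where "k0 = max k (max 0 (1 - m))"
  have partial: "(\<Sum>n\<in>{- B..<C + val \<theta> + 1}. mock_term n) = v" if "k0 \<le> B" "k0 \<le> C" for B C
  proof -
    \<comment> \<open>The three bounds vary independently, so \<open>A\<close> may be taken as large
      as \<open>B\<close> requires.\<close>
    define A where "A = max k0 (- shell_start (- B))"
    have "(LINT p|\<nu>. indicator (pideal (- A) \<times> pideal (- B) \<times> pideal (- C)) p * kernel p) = v"
      using that by (intro assms) (auto simp: A_def k0_def)
    moreover have "0 \<le> k0" "1 - m \<le> k0" "k0 \<le> A" by (auto simp: k0_def A_def)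
    ultimately show ?thesis using that truncated_orbit_integral[of C A B] by (auto simp: A_def)
  qed
  have zero: "mock_term n = 0" if "n \<notin> {- k0..<k0 + val \<theta> + 1}" for n
  proof (cases "n < - k0")
    case True
    \<comment> \<open>Two consecutive values of \<open>B\<close> isolate the term \<open>n\<close>;
      in the other case two consecutive values of \<open>C\<close> do.\<close>
    have "{n..<k0 + val \<theta> + 1} = insert n {n + 1..<k0 + val \<theta> + 1}" using True theta by (auto simp: k0_def)
    then have "(\<Sum>n\<in>{n..<k0 + val \<theta> + 1}. mock_term n) = mock_term n + (\<Sum>n\<in>{n + 1..<k0 + val \<theta> + 1}. mock_term n)"
      by simp
    then show ?thesis using partial[of "- n" k0] partial[of "- (n + 1)" k0] True by (simp add: add.commute)
  next
    case False
    then have n: "k0 + val \<theta> + 1 \<le> n" using that by auto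
    have "0 \<le> k0" by (simp add: k0_def)
    then have "{- k0..<n + 1} = insert n {- k0..<n}" using n theta by auto
    then have "(\<Sum>n\<in>{- k0..<n + 1}. mock_term n) = mock_term n + (\<Sum>n\<in>{- k0..<n}. mock_term n)" by simp
    then show ?thesis using partial[of k0 "n - val \<theta>"] partial[of k0 "n - val \<theta> - 1"] n by simp
  qed
  have "(\<Sum>\<^sub>\<infinity>n. mock_term n) = (\<Sum>\<^sub>\<infinity>n\<in>{- k0..<k0 + val \<theta> + 1}. mock_term n)"
    using zero by (intro infsum_cong_neutral) auto
  then show ?thesis using partial[of k0 k0] by simp
qed

end

section \<open>The special linear group and its coadjoint orbits\<close>

definition mat2 :: "'k \<Rightarrow> 'k \<Rightarrow> 'k \<Rightarrow> 'k \<Rightarrow> 'k::zero ^ 2 ^ 2" where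
  "mat2 a b c d = vector [vector [a, b], vector [c, d]]"

lemma mat2_nth [simp]:
  "mat2 a b c d $ 1 $ 1 = a" "mat2 a b c d $ 1 $ 2 = b"
  "mat2 a b c d $ 2 $ 1 = c" "mat2 a b c d $ 2 $ 2 = d"
  by (simp_all add: mat2_def)

lemma mat2_eq_iff: "A = B \<longleftrightarrow> A $ 1 $ 1 = B $ 1 $ 1 \<and> A $ 1 $ 2 = B $ 1 $ 2 \<and>
    A $ 2 $ 1 = B $ 2 $ 1 \<and> A $ 2 $ 2 = (B :: 'k ^ 2 ^ 2) $ 2 $ 2"
  by (auto simp: vec_eq_iff forall_2)

lemma mult_nth_2: "(A ** B) $ i $ j = A $ i $ 1 * B $ 1 $ j + A $ i $ 2 * (B :: 'k::semiring_1 ^ 2 ^ 2) $ 2 $ j"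
  by (simp add: matrix_matrix_mult_def sum_2)

lemma trace_2: "trace (A :: 'k::semiring_1 ^ 2 ^ 2) = A $ 1 $ 1 + A $ 2 $ 2"
  by (simp add: trace_def sum_2)

lemma SL2_iff: "g \<in> SL2 \<longleftrightarrow> g $ 1 $ 1 * g $ 2 $ 2 - g $ 1 $ 2 * g $ 2 $ 1 = 1"
  by (simp add: SL2_def det_2)

lemma sl2_iff: "W \<in> sl2 \<longleftrightarrow> W $ 2 $ 2 = - (W $ 1 $ 1 :: 'k::field)"
  by (simp add: sl2_def trace_2 add_eq_0_iff)

definition adj2 :: "'k::ring_1 ^ 2 ^ 2 \<Rightarrow> 'k ^ 2 ^ 2" where
  "adj2 g = mat2 (g $ 2 $ 2) (- g $ 1 $ 2) (- g $ 2 $ 1) (g $ 1 $ 1)"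

lemma mat_1_nth_2 [simp]:
  "(mat 1 :: 'k::semiring_1 ^ 2 ^ 2) $ 1 $ 1 = 1" "(mat 1 :: 'k ^ 2 ^ 2) $ 1 $ 2 = 0"
  "(mat 1 :: 'k ^ 2 ^ 2) $ 2 $ 1 = 0" "(mat 1 :: 'k ^ 2 ^ 2) $ 2 $ 2 = 1"
  by (simp_all add: mat_def)

lemma adj2_inverse:
  assumes "g \<in> (SL2 :: ('k::field ^ 2 ^ 2) set)"
  shows "g ** adj2 g = mat 1" "adj2 g ** g = mat 1"
  using assms by (simp_all add: mat2_eq_iff mult_nth_2 adj2_def SL2_iff mult.commute)

lemma matrix_inv_SL2:
  assumes "g \<in> (SL2 :: ('k::field ^ 2 ^ 2) set)"
  shows "matrix_inv g = adj2 g"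
proof -
  have "g ** matrix_inv g = mat 1 \<and> matrix_inv g ** g = mat 1"
    unfolding matrix_inv_def by (rule someI[of _ "adj2 g"]) (simp add: adj2_inverse[OF assms])
  then have "matrix_inv g = (adj2 g ** g) ** matrix_inv g" "adj2 g = adj2 g ** (g ** matrix_inv g)"
    using adj2_inverse[OF assms] by simp_all
  then show ?thesis by (simp add: matrix_mul_assoc)
qed

lemma SL2_mult: "g \<in> SL2 \<Longrightarrow> h \<in> SL2 \<Longrightarrow> g ** h \<in> (SL2 :: ('k::field ^ 2 ^ 2) set)"
  by (simp add: SL2_def det_mul)

lemma SL2_adj2: "g \<in> SL2 \<Longrightarrow> adj2 g \<in> (SL2 :: ('k::field ^ 2 ^ 2) set)"
  by (simp add: SL2_iff adj2_def mult.commute)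

lemma SL2_integers_iff: "g \<in> SL2_integers \<longleftrightarrow> g \<in> SL2 \<and> g $ 1 $ 1 \<in> pideal 0 \<and> g $ 1 $ 2 \<in> pideal 0 \<and>
    g $ 2 $ 1 \<in> pideal 0 \<and> g $ 2 $ 2 \<in> pideal 0"
  by (auto simp: SL2_integers_def forall_2 integer_ring_eq)

lemma SL2_integers_mult: "g \<in> SL2_integers \<Longrightarrow> h \<in> SL2_integers \<Longrightarrow> g ** h \<in> SL2_integers"
  by (auto simp: SL2_integers_iff SL2_mult mult_nth_2 intro!: pideal_add pideal_mult'[of _ 0 _ 0])

lemma SL2_integers_adj2: "g \<in> SL2_integers \<Longrightarrow> adj2 g \<in> SL2_integers"
  by (auto simp: SL2_integers_iff SL2_adj2) (auto simp: adj2_def)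

definition mat_act :: "'k ^ 2 ^ 2 \<Rightarrow> 'k \<times> 'k \<times> 'k \<Rightarrow> 'k::comm_ring_1 \<times> 'k \<times> 'k" where
  "mat_act g = sl2_act (g $ 1 $ 1) (g $ 1 $ 2) (g $ 2 $ 1) (g $ 2 $ 2)"

lemma mat_act_mult: "mat_act (g ** h) p = mat_act g (mat_act h p)"
  by (simp add: mat_act_def sl2_act_def Let_def mult_nth_2 power2_eq_square algebra_simps)

lemma mat_act_one [simp]: "mat_act (mat 1) p = p"
  by (simp add: mat_act_def sl2_act_def)

lemma mat_act_adj2 [simp]:
  "g \<in> SL2 \<Longrightarrow> mat_act (adj2 g) (mat_act g p) = (p :: 'k::field \<times> 'k \<times> 'k)"
  "g \<in> SL2 \<Longrightarrow> mat_act g (mat_act (adj2 g) p) = p"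
  by (simp_all add: mat_act_mult[symmetric] adj2_inverse)

text \<open>The coordinates of \<open>g \<surd>\<theta> g^-1\<close>, those of
  \<open>\<surd>\<theta>\<close> itself being \<open>(0, 1, \<theta>)\<close>.\<close>

definition orbit_point :: "'k \<Rightarrow> 'k ^ 2 ^ 2 \<Rightarrow> 'k::comm_ring_1 \<times> 'k \<times> 'k" where
  "orbit_point \<theta> g = mat_act g (0, 1, \<theta>)"

lemma orbit_point_eq: "orbit_point \<theta> g =
    (\<theta> * (g $ 1 $ 2 * g $ 2 $ 2) - g $ 1 $ 1 * g $ 2 $ 1,
     (g $ 1 $ 1)\<^sup>2 - (g $ 1 $ 2)\<^sup>2 * \<theta>, \<theta> * (g $ 2 $ 2)\<^sup>2 - (g $ 2 $ 1)\<^sup>2)"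
  by (simp add: orbit_point_def mat_act_def sl2_act_def mult.commute)

lemma orbit_point_equation:
  assumes "g \<in> SL2" "orbit_point \<theta> g = (a, b, c)"
  shows "a\<^sup>2 + b * c = (\<theta> :: 'k::field)"
proof -
  have "a\<^sup>2 + b * c = \<theta> * (g $ 1 $ 1 * g $ 2 $ 2 - g $ 1 $ 2 * g $ 2 $ 1)\<^sup>2"
  proof -
    have abc: "a = \<theta> * (g $ 1 $ 2 * g $ 2 $ 2) - g $ 1 $ 1 * g $ 2 $ 1"
      "b = (g $ 1 $ 1)\<^sup>2 - (g $ 1 $ 2)\<^sup>2 * \<theta>" "c = \<theta> * (g $ 2 $ 2)\<^sup>2 - (g $ 2 $ 1)\<^sup>2"
      using assms(2) by (simp_all add: orbit_point_eq)
    show ?thesis unfolding abc by (simp add: power2_eq_square algebra_simps)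
  qed
  then show ?thesis using assms(1) by (simp add: SL2_iff)
qed

text \<open>The trace of the product with \<open>W \<in> sl2\<close> of the matrix with rows \<open>(a, b)\<close> and \<open>(c, -a)\<close>.\<close>

definition orbit_pairing :: "'k \<times> 'k \<times> 'k \<Rightarrow> 'k ^ 2 ^ 2 \<Rightarrow> 'k::comm_ring_1" where
  "orbit_pairing p W = 2 * fst p * W $ 1 $ 1 + fst (snd p) * W $ 2 $ 1 + snd (snd p) * W $ 1 $ 2"

lemma coAd_eq_pairing:
  fixes \<beta> \<theta> :: "'k::field"
  assumes g: "g \<in> SL2" and W: "W \<in> sl2"
  shows "coAd g (trace_functional (torus_elt \<beta> \<theta>)) W = \<beta> * orbit_pairing (orbit_point \<theta> g) W"
proof -
  have W': "W $ 2 $ 2 = - W $ 1 $ 1" using W by (simp add: sl2_iff)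
  have "adj2 g ** W ** g \<in> sl2"
    by (simp add: sl2_iff mult_nth_2 adj2_def W' algebra_simps)
  then have "coAd g (trace_functional (torus_elt \<beta> \<theta>)) W = trace (torus_elt \<beta> \<theta> ** (adj2 g ** W ** g))"
    using W by (simp add: coAd_def trace_functional_def matrix_inv_SL2[OF g])
  then show ?thesis
    by (simp add: trace_2 mult_nth_2 adj2_def W' torus_elt_def orbit_pairing_def orbit_point_eq
        power2_eq_square algebra_simps)
qed

lemma trace_functional_torus:
  assumes "W \<in> sl2"
  shows "trace_functional (torus_elt \<beta> \<theta>) W = \<beta> * orbit_pairing (0, 1, \<theta>) W"
  using assms by (simp add: trace_functional_def trace_2 mult_nth_2 torus_elt_def orbit_pairing_def algebra_simps)

lemma orbit_pairing_inject:
  assumes "(2::'k::field) \<noteq> 0" "\<And>W. W \<in> sl2 \<Longrightarrow> orbit_pairing p W = orbit_pairing p' (W :: 'k ^ 2 ^ 2)"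
  shows "p = p'"
  using assms(2)[of "mat2 1 0 0 (- 1)"] assms(2)[of "mat2 0 1 0 0"] assms(2)[of "mat2 0 0 1 0"] assms(1)
  by (auto simp: sl2_iff orbit_pairing_def prod_eq_iff)

text \<open>The trace pairing separates points when 2 is invertible, so fixing the functional means
  fixing the point; cosets therefore correspond to points of the orbit.\<close>

lemma centraliser_torus:
  assumes "(2::'k::field) \<noteq> 0" "\<beta> \<noteq> 0"
  shows "centraliser (trace_functional (torus_elt \<beta> \<theta>)) = {g \<in> SL2. orbit_point \<theta> g = (0, 1, \<theta> :: 'k)}"
proof -
  let ?X = "trace_functional (torus_elt \<beta> \<theta>)"
  have "coAd g ?X = ?X \<longleftrightarrow> orbit_point \<theta> g = (0, 1, \<theta>)" if g: "g \<in> SL2" for g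
  proof
    assume eq: "coAd g ?X = ?X"
    show "orbit_point \<theta> g = (0, 1, \<theta>)"
    proof (rule orbit_pairing_inject[OF assms(1)])
      fix W :: "'k ^ 2 ^ 2" assume W: "W \<in> sl2"
      show "orbit_pairing (orbit_point \<theta> g) W = orbit_pairing (0, 1, \<theta>) W"
        using coAd_eq_pairing[OF g W, of \<beta> \<theta>] trace_functional_torus[OF W, of \<beta> \<theta>] eq assms(2) by simp
    qed
  next
    assume eq: "orbit_point \<theta> g = (0, 1, \<theta>)"
    show "coAd g ?X = ?X"
    proof
      fix W
      show "coAd g ?X W = ?X W"
      proof (cases "W \<in> sl2")
        case True
        then show ?thesis using coAd_eq_pairing[OF g True] trace_functional_torus[OF True] eq by simp
      next
        case False
        then show ?thesis by (simp add: coAd_def trace_functional_def)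
      qed
    qed
  qed
  then show ?thesis by (auto simp: centraliser_def)
qed

lemma translate_one [simp]: "translate (mat 1) c = c"
  by (simp add: translate_def)

lemma translate_translate: "translate g (translate h c) = translate (g ** h) c"
  by (auto simp: translate_def image_image matrix_mul_assoc)

section \<open>From cosets to points of the orbit\<close>

locale torus_coset =
  fixes \<theta> :: "'k::nonarch_local_field" and H :: "('k ^ 2 ^ 2) set"
  assumes H_eq: "H = {g \<in> SL2. orbit_point \<theta> g = (0, 1, \<theta>)}"
begin

text \<open>The representative is the same \<open>SOME\<close> as in
  \<open>orbital_integral\<close>, so the integrand there is directly a function of
  \<open>coset_point\<close>.\<close>

definition coset_point :: "('k ^ 2 ^ 2) set \<Rightarrow> 'k \<times> 'k \<times> 'k" where
  "coset_point c = orbit_point \<theta> (SOME g. g \<in> c)"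

lemma coset_representative:
  assumes "g \<in> SL2"
  shows "(SOME g'. g' \<in> translate g H) \<in> SL2"
    "orbit_point \<theta> (SOME g'. g' \<in> translate g H) = orbit_point \<theta> g"
proof -
  have "mat 1 \<in> H" by (simp add: H_eq SL2_iff orbit_point_def)
  then have "g \<in> translate g H" by (auto simp: translate_def intro!: image_eqI[of _ _ "mat 1"])
  then have "(SOME g'. g' \<in> translate g H) \<in> translate g H" by (rule someI)
  then obtain h where "h \<in> H" "(SOME g'. g' \<in> translate g H) = g ** h" by (auto simp: translate_def)
  then show "(SOME g'. g' \<in> translate g H) \<in> SL2"
    "orbit_point \<theta> (SOME g'. g' \<in> translate g H) = orbit_point \<theta> g"
    using assms by (auto simp: H_eq SL2_mult orbit_point_def mat_act_mult)
qed

lemma coset_point_translate: "g \<in> SL2 \<Longrightarrow> coset_point (translate g H) = orbit_point \<theta> g"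
  by (simp add: coset_point_def coset_representative)

lemma coset_point_act:
  assumes "g \<in> SL2" "c \<in> cosets H"
  shows "coset_point (translate g c) = mat_act g (coset_point c)" "translate g c \<in> cosets H"
proof -
  obtain h where h: "h \<in> SL2" "c = translate h H" using assms(2) by (auto simp: cosets_def)
  then show "coset_point (translate g c) = mat_act g (coset_point c)"
    using assms(1) by (simp add: translate_translate coset_point_translate SL2_mult orbit_point_def mat_act_mult)
  show "translate g c \<in> cosets H"
    using h assms(1) by (auto simp: translate_translate cosets_def SL2_mult)
qed

text \<open>Elements with the same orbit point differ by the stabiliser: \<open>coset_point\<close>
  is injective.\<close>

lemma translate_eqI:
  assumes "g \<in> SL2" "k \<in> SL2" "orbit_point \<theta> k = orbit_point \<theta> g"
  shows "translate k H = translate g H"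
proof -
  have *: "translate g H \<subseteq> translate k H"
    if "g \<in> SL2" "k \<in> SL2" "orbit_point \<theta> k = orbit_point \<theta> g" for g k
  proof
    fix x assume "x \<in> translate g H"
    then obtain h where h: "h \<in> SL2" "orbit_point \<theta> h = (0, 1, \<theta>)" "x = g ** h"
      by (auto simp: translate_def H_eq)
    have "orbit_point \<theta> (adj2 k ** x) = mat_act (adj2 k) (orbit_point \<theta> g)"
      using h by (simp add: orbit_point_def mat_act_mult)
    also have "\<dots> = (0, 1, \<theta>)" unfolding that(3)[symmetric] using that(2) by (simp add: orbit_point_def)
    finally have "adj2 k ** x \<in> H" using that h by (simp add: H_eq SL2_mult SL2_adj2)
    moreover have "k ** (adj2 k ** x) = x"
      using adj2_inverse[OF that(2)] by (simp add: matrix_mul_assoc)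
    ultimately show "x \<in> translate k H" by (metis image_eqI translate_def)
  qed
  show ?thesis using *[of g k] *[of k g] assms by auto
qed

end

lemma continuous_on_orbit_point: "continuous_on UNIV (orbit_point (\<theta>::'k::nonarch_local_field))"
  unfolding orbit_point_eq[abs_def] by (intro continuous_on_Pair continuous_intros)

locale torus_coset_measure = torus_coset \<theta> H for \<theta> :: "'k::nonarch_local_field" and H +
  fixes \<mu> :: "('k ^ 2 ^ 2) set measure"
  assumes two: "(2::'k) \<notin> maximal_ideal" and inv_mu: "invariant_measure H \<mu>"
begin

definition orbit_image :: "('k \<times> 'k \<times> 'k) measure" where
  "orbit_image = distr \<mu> borel coset_point"

lemma space_mu: "space \<mu> = cosets H" using inv_mu by (simp add: invariant_measure_def)

lemma coset_point_meas: "coset_point \<in> borel_measurable \<mu>"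
proof (rule borel_measurableI)
  fix S :: "('k \<times> 'k \<times> 'k) set" assume S: "open S"
  have "{g \<in> SL2. translate g H \<in> coset_point -` S \<inter> cosets H} = SL2 \<inter> orbit_point \<theta> -` S"
    by (auto simp: coset_point_translate cosets_def)
  moreover have "openin (top_of_set SL2) (SL2 \<inter> orbit_point \<theta> -` S)"
    using S by (intro openin_open_Int open_vimage continuous_on_orbit_point)
  ultimately have "openin (coset_topology H) (coset_point -` S \<inter> cosets H)"
    by (simp add: openin_coset_topology)
  then show "coset_point -` S \<inter> space \<mu> \<in> sets \<mu>"
    using inv_mu by (auto simp: invariant_measure_def)
qed

lemma orbit_image_invariant:
  assumes "g1 * g4 - g2 * g3 = 1"
  shows "distr orbit_image borel (sl2_act g1 g2 g3 g4) = orbit_image"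
proof (rule measure_eqI)
  let ?g = "mat2 g1 g2 g3 g4"
  have g: "?g \<in> SL2" and act: "sl2_act g1 g2 g3 g4 = mat_act ?g"
    using assms by (simp_all add: SL2_iff mat_act_def)
  have meas: "sl2_act g1 g2 g3 g4 \<in> measurable borel borel"
    using borel_measurable_continuous_onI[OF continuous_on_sl2_act] .
  fix S assume S: "S \<in> sets (distr orbit_image borel (sl2_act g1 g2 g3 g4))"
  then have S': "S \<in> sets borel" by simp
  let ?D = "coset_point -` S \<inter> cosets H"
  let ?D' = "coset_point -` (sl2_act g1 g2 g3 g4 -` S) \<inter> cosets H"
  have D': "?D' \<in> sets \<mu>"
    using measurable_sets[OF coset_point_meas, of "sl2_act g1 g2 g3 g4 -` S"] measurable_sets[OF meas S']
    by (simp add: space_mu)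
  \<comment> \<open>Invariance of \<open>\<mu>\<close> speaks of images under translation, that of
    \<open>orbit_image\<close> of preimages under the action; this equation converts one into the
    other.\<close>
  have img: "translate ?g ` ?D' = ?D"
  proof (intro equalityI subsetI)
    fix c assume "c \<in> translate ?g ` ?D'"
    then show "c \<in> ?D" using coset_point_act[OF g] act by auto
  next
    fix c assume "c \<in> ?D"
    then have c: "c \<in> cosets H" "coset_point c \<in> S" by auto
    have "translate ?g (translate (adj2 ?g) c) = c"
      by (simp add: translate_translate adj2_inverse[OF g])
    moreover have "translate (adj2 ?g) c \<in> ?D'"
      using coset_point_act[OF SL2_adj2[OF g] c(1)] c(2) g by (simp add: act)
    ultimately show "c \<in> translate ?g ` ?D'" by (rule image_eqI[OF sym])
  qed
  have "emeasure \<mu> (translate ?g ` ?D') = emeasure \<mu> ?D'"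
    using inv_mu g D' unfolding invariant_measure_def by blast
  then have eq: "emeasure \<mu> ?D = emeasure \<mu> ?D'" by (simp only: img)
  show "emeasure (distr orbit_image borel (sl2_act g1 g2 g3 g4)) S = emeasure orbit_image S"
    using S' meas measurable_sets[OF meas S'] coset_point_meas eq
    by (simp add: orbit_image_def emeasure_distr space_mu)
qed (simp add: orbit_image_def)

lemma orbit_image_AE:
  "AE p in orbit_image. (fst p)\<^sup>2 + fst (snd p) * snd (snd p) = \<theta> \<and>
      (fst (snd p) \<noteq> 0 \<longrightarrow> fst (snd p) \<in> norm_group \<theta>)"
proof -
  let ?P = "\<lambda>p. (fst p)\<^sup>2 + fst (snd p) * snd (snd p) = \<theta> \<and>
      (fst (snd p) \<noteq> 0 \<longrightarrow> fst (snd p) \<in> norm_group \<theta>)"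
  \<comment> \<open>Openness of the norm group makes the condition Borel, as its transfer through
    \<open>distr\<close> requires.\<close>
  have N: "open (norm_group \<theta> :: 'k set)"
    unfolding open_iff_vball using norm_group_vball[OF two] by (metis norm_group_iff subsetI)
  have "{p. ?P p} = {p. (fst p)\<^sup>2 + fst (snd p) * snd (snd p) = \<theta>} \<inter>
      ({p. fst (snd p) = 0} \<union> (\<lambda>p. fst (snd p)) -` norm_group \<theta>)" by auto
  moreover have "closed {p :: 'k \<times> 'k \<times> 'k. (fst p)\<^sup>2 + fst (snd p) * snd (snd p) = \<theta>}"
    "closed {p :: 'k \<times> 'k \<times> 'k. fst (snd p) = 0}"
    by (intro closed_Collect_eq continuous_intros)+
  moreover have "open ((\<lambda>p :: 'k \<times> 'k \<times> 'k. fst (snd p)) -` norm_group \<theta>)"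
    by (intro open_vimage N continuous_intros)
  ultimately have meas: "{p \<in> space borel. ?P p} \<in> sets borel" by (simp add: sets.Un sets.Int)
  have "?P (coset_point c)" if "c \<in> cosets H" for c
  proof -
    obtain g where g: "g \<in> SL2" "coset_point c = orbit_point \<theta> g"
      using \<open>c \<in> cosets H\<close> by (auto simp: cosets_def coset_point_translate)
    have "fst (snd (orbit_point \<theta> g)) \<in> norm_group \<theta>" if "fst (snd (orbit_point \<theta> g)) \<noteq> 0"
      using that by (auto simp: orbit_point_eq norm_group_iff)
    then show ?thesis
      using orbit_point_equation[OF g(1), of \<theta> "fst (coset_point c)" "fst (snd (coset_point c))" "snd (snd (coset_point c))"] g(2)
      by simp
  qed
  then show ?thesis
    unfolding orbit_image_def AE_distr_iff[OF coset_point_meas meas] by (intro AE_I2) (simp add: space_mu)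
qed

end

section \<open>Integral points of the orbit\<close>

lemma mat_act_integral:
  assumes k: "k \<in> SL2_integers" and p: "p \<in> integral_triples"
  shows "mat_act k (p :: 'k::discrete_valued_field \<times> 'k \<times> 'k) \<in> integral_triples"
proof -
  obtain a b c where abc: "p = (a, b, c)" by (cases p)
  have mult: "x * y \<in> pideal 0" if "x \<in> pideal 0" "y \<in> pideal 0" for x y :: 'k
    by (rule pideal_mult'[OF that]) simp
  have "2 \<in> (pideal 0 :: 'k set)" using pideal_add[OF one_in_pideal one_in_pideal] by simp
  then show ?thesis using k p
    by (auto simp: abc mat_act_def sl2_act_def integral_triples_def SL2_integers_iff power2_eq_square
        intro!: pideal_add pideal_diff mult)
qed

text \<open>The norm form is anisotropic: if \<open>y\<close> were not integral, division by
  \<open>y^2\<close> would bring \<open>(x / y)^2\<close> closer to \<open>\<theta>\<close> than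
  \<open>nonsplit_off_diagonal\<close> allows.\<close>

lemma nonsplit_norm_integral:
  assumes cases: "nonsquare_unit \<theta> \<or> uniformiser (\<theta> :: 'k::nonarch_local_field)"
    and xy: "x\<^sup>2 - y\<^sup>2 * \<theta> \<in> pideal 0"
  shows "x \<in> pideal 0" "y \<in> pideal 0"
proof -
  have th: "\<theta> \<noteq> 0" "0 \<le> val \<theta>" "val \<theta> \<le> 1"
    using cases by (auto simp: nonsquare_unit_def uniformiser_def)
  show y: "y \<in> pideal 0"
  proof (rule ccontr)
    assume "y \<notin> pideal 0"
    then have y: "y \<noteq> 0" "val y < 0" by (auto simp: pideal_def)
    have "y\<^sup>2 * ((x / y)\<^sup>2 - \<theta>) = x\<^sup>2 - y\<^sup>2 * \<theta>" using y by (simp add: power_divide field_simps)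
    then have "(x / y)\<^sup>2 - \<theta> \<in> pideal (- 2 * val y)"
      using pideal_mult_iff[of "y\<^sup>2" "(x / y)\<^sup>2 - \<theta>" 0] xy y by (simp add: val_power2)
    then have "(x / y)\<^sup>2 - \<theta> \<in> pideal (val \<theta> + 1)"
      by (rule pideal_mono[rotated]) (use y th in simp)
    then have "(\<theta> - (x / y)\<^sup>2) * 1 \<in> pideal (val \<theta> + 1)"
      using pideal_diff_commute[of \<theta>] by simp
    from nonsplit_off_diagonal[OF cases _ this, of "x / y"] show False by simp
  qed
  have "y * y * \<theta> \<in> pideal 0"
    using th by (intro pideal_mult'[OF pideal_mult[OF y y], of _ 0]) (auto simp: pideal_def)
  then have "x\<^sup>2 - y\<^sup>2 * \<theta> + y\<^sup>2 * \<theta> \<in> pideal 0"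
    by (intro pideal_add[OF xy]) (simp add: power2_eq_square)
  then have "x\<^sup>2 \<in> pideal 0" by simp
  then show "x \<in> pideal 0" unfolding pideal_square_iff by (auto simp: pideal_def)
qed

lemma integral_orbit_unit:
  assumes two: "(2::'k::nonarch_local_field) \<notin> maximal_ideal"
    and theta_cases: "\<theta> = 1 \<or> nonsquare_unit \<theta> \<or> uniformiser (\<theta> :: 'k)"
    and g: "g \<in> SL2" and p: "orbit_point \<theta> g = (a, b, c)" and int: "(a, b, c) \<in> integral_triples"
    and b: "b \<in> shell 0"
  shows "\<exists>k\<in>SL2_integers. orbit_point \<theta> k = (a, b, c)"
proof -
  note two' = val_two[OF two]
  have abc: "a \<in> pideal 0" "b \<in> pideal 0" "c \<in> pideal 0" using int by (auto simp: integral_triples_def)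
  have b': "b \<noteq> 0" "val b = 0" using b by (auto simp: shell_def)
  have div: "x / b \<in> pideal 0" if "x \<in> pideal 0" for x
    using b' that by (cases "x = 0") (auto simp: pideal_def val_divide)
  have mult: "x * y \<in> pideal 0" if "x \<in> pideal 0" "y \<in> pideal 0" for x y :: 'k
    by (rule pideal_mult'[OF that]) simp
  have th: "\<theta> \<in> pideal 0" using theta_cases by (auto simp: nonsquare_unit_def uniformiser_def pideal_def)
  have "\<exists>x y. x \<in> pideal 0 \<and> y \<in> pideal 0 \<and> b = x\<^sup>2 - y\<^sup>2 * \<theta>"
  proof (cases "\<theta> = 1")
    case True
    have half: "x / 2 \<in> pideal 0" if "x \<in> pideal 0" for x :: 'k
      using two' that by (cases "x = 0") (auto simp: pideal_def val_divide)
    have "b = ((b + 1) / 2)\<^sup>2 - ((b - 1) / 2)\<^sup>2 * \<theta>"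
      unfolding True by (rule split_norm[OF two'(1)])
    moreover have "(b + 1) / 2 \<in> pideal 0" "(b - 1) / 2 \<in> pideal 0"
      using pideal_add[OF abc(2) one_in_pideal] pideal_diff[OF abc(2) one_in_pideal] half by auto
    ultimately show ?thesis by blast
  next
    case False
    have "b = (g $ 1 $ 1)\<^sup>2 - (g $ 1 $ 2)\<^sup>2 * \<theta>" using p by (simp add: orbit_point_eq)
    then show ?thesis using nonsplit_norm_integral[of \<theta> "g $ 1 $ 1" "g $ 1 $ 2"] False theta_cases abc(2) by blast
  qed
  then obtain x y where xy: "x \<in> pideal 0" "y \<in> pideal 0" "b = x\<^sup>2 - y\<^sup>2 * \<theta>" by blast
  \<comment> \<open>The first row has norm \<open>b\<close>; the second solves the two linear
    equations saying that the determinant is 1 and the first orbit coordinate is \<open>a\<close>, a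
    system of determinant \<open>b\<close>.\<close>
  define k where "k = mat2 x y ((\<theta> * y - a * x) / b) ((x - a * y) / b)"
  have "x * (x - a * y) - y * (\<theta> * y - a * x) = b"
    unfolding xy(3) by (simp add: power2_eq_square algebra_simps)
  then have "(x * (x - a * y) - y * (\<theta> * y - a * x)) / b = 1" using b' by simp
  then have k: "k \<in> SL2"
    using diff_divide_distrib[of "x * (x - a * y)" "y * (\<theta> * y - a * x)" b] by (simp add: SL2_iff k_def)
  obtain a' b'' c' where k_pt: "orbit_point \<theta> k = (a', b'', c')" by (cases "orbit_point \<theta> k")
  have b'': "b'' = b" using k_pt xy(3) by (simp add: orbit_point_eq k_def)
  have "\<theta> * (y * (x - a * y)) - x * (\<theta> * y - a * x) = a * b"
    unfolding xy(3) by (simp add: power2_eq_square algebra_simps)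
  then have "(\<theta> * (y * (x - a * y)) - x * (\<theta> * y - a * x)) / b = a" using b' by simp
  then have a': "a' = a"
    using k_pt diff_divide_distrib[of "\<theta> * (y * (x - a * y))" "x * (\<theta> * y - a * x)" b]
    by (simp add: orbit_point_eq k_def)
  have "a\<^sup>2 + b * c' = \<theta>" "a\<^sup>2 + b * c = \<theta>"
    using orbit_point_equation[OF k k_pt] orbit_point_equation[OF g p] a' b'' by auto
  then have "b * c' = b * c" by (metis add_left_cancel)
  then have "c' = c" using b' by simp
  moreover have "k \<in> SL2_integers"
    using k xy(1,2) div[OF pideal_diff[OF mult[OF th xy(2)] mult[OF abc(1) xy(1)]]]
      div[OF pideal_diff[OF xy(1) mult[OF abc(1) xy(2)]]]
    by (simp add: SL2_integers_iff k_def)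
  ultimately show ?thesis using k_pt a' b'' by auto
qed

text \<open>Where \<open>b\<close> is not a unit, the Weyl element or the upper unipotent with entry
  1 makes it one; the point is then reached by \<open>integral_orbit_unit\<close> and moved back
  inside the integral group.\<close>

lemma integral_orbit:
  assumes two: "(2::'k::nonarch_local_field) \<notin> maximal_ideal"
    and theta_cases: "\<theta> = 1 \<or> nonsquare_unit \<theta> \<or> uniformiser (\<theta> :: 'k)"
    and g: "g \<in> SL2" and int: "orbit_point \<theta> g \<in> integral_triples"
  shows "\<exists>k\<in>SL2_integers. orbit_point \<theta> k = orbit_point \<theta> g"
proof -
  obtain a b c where p: "orbit_point \<theta> g = (a, b, c)" by (cases "orbit_point \<theta> g")
  have eq: "a\<^sup>2 + b * c = \<theta>" by (rule orbit_point_equation[OF g p])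
  have abc: "a \<in> pideal 0" "b \<in> pideal 0" "c \<in> pideal 0"
    using int by (auto simp: integral_triples_def p)
  have conj: ?thesis
    if h: "h \<in> SL2_integers" and unit: "fst (snd (mat_act h (a, b, c))) \<in> shell 0" for h
  proof -
    have hS: "h \<in> SL2" using h by (simp add: SL2_integers_iff)
    obtain a' b' c' where p': "mat_act h (a, b, c) = (a', b', c')" by (cases "mat_act h (a, b, c)")
    have "orbit_point \<theta> (h ** g) = (a', b', c')"
      using p by (simp add: orbit_point_def mat_act_mult p')
    moreover have "(a', b', c') \<in> integral_triples"
      using mat_act_integral[OF h, of "(a, b, c)"] int p p' by simp
    ultimately obtain k where k: "k \<in> SL2_integers" "orbit_point \<theta> k = (a', b', c')"
      using integral_orbit_unit[OF two theta_cases SL2_mult[OF hS g]] unit p' by auto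
    have "orbit_point \<theta> (adj2 h ** k) = mat_act (adj2 h) (mat_act h (a, b, c))"
      using k(2) p' by (simp add: orbit_point_def mat_act_mult)
    also have "\<dots> = orbit_point \<theta> g" using hS p by simp
    finally show ?thesis using SL2_integers_mult[OF SL2_integers_adj2[OF h] k(1)] by blast
  qed
  consider "b \<in> shell 0" | "c \<in> shell 0" | "b \<in> pideal 1" "c \<in> pideal 1"
    using abc by (auto simp: shell_eq)
  then show ?thesis
  proof cases
    case 1
    then show ?thesis using integral_orbit_unit[OF two theta_cases g p] int p by simp
  next
    case 2
    have "- c \<in> shell 0" using 2 by (simp add: shell_def)
    then show ?thesis
      by (intro conj[of "mat2 0 1 (- 1) 0"])
        (auto simp: SL2_integers_iff SL2_iff mat_act_def sl2_act_def one_in_pideal)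
  next
    case 3
    have bc: "b * c \<in> pideal 2" using pideal_mult[OF 3] by simp
    have "\<theta> = 1"
    proof (rule ccontr)
      assume "\<theta> \<noteq> 1"
      then have cases: "nonsquare_unit \<theta> \<or> uniformiser \<theta>" using theta_cases by blast
      then have "val \<theta> + 1 \<le> 2" by (auto simp: nonsquare_unit_def uniformiser_def)
      then show False using nonsplit_off_diagonal[OF cases eq] pideal_mono[OF _ bc] by blast
    qed
    then have "a\<^sup>2 - 1 = a\<^sup>2 - (a\<^sup>2 + b * c)" using eq by simp
    then have "a\<^sup>2 - 1 = - (b * c)" by simp
    then have a2: "a\<^sup>2 - 1 \<in> pideal 1" using pideal_mono[OF _ bc, of 1] by simp
    have "a\<^sup>2 \<in> vball (val (1::'k) + 1) 1" using a2 by (simp add: vball_iff)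
    then have "a\<^sup>2 \<noteq> 0" "val (a\<^sup>2) = 0" using vball_val[of 1 "a\<^sup>2"] by auto
    then have "a \<noteq> 0" "val a = 0" using val_power2[of a] by auto
    then have m: "- 2 * a \<noteq> 0" "val (- 2 * a) = 0" using val_two[OF two] by (auto simp: val_mult)
    have "b - c \<in> pideal (val (- 2 * a) + 1)" using pideal_diff[OF 3] m by simp
    \<comment> \<open>This sum is the new \<open>b\<close> after the upper unipotent; it is a unit
      because \<open>a\<close> is one while \<open>b\<close> and \<open>c\<close> are not.\<close>
    from val_add_eq[OF m(1) this] m(2) have "- 2 * a + (b - c) \<in> shell 0" by (simp add: shell_def)
    then show ?thesis
      by (intro conj[of "mat2 1 1 0 1"])
        (auto simp: SL2_integers_iff SL2_iff mat_act_def sl2_act_def one_in_pideal algebra_simps)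
  qed
qed

text \<open>Ties the volume in coordinates to the normalisation hypothesis: the preimage of the
  integral points consists of the cosets of \<open>SL2_integers\<close>.\<close>

lemma (in torus_coset_measure) emeasure_integral_triples:
  assumes theta_cases: "\<theta> = 1 \<or> nonsquare_unit \<theta> \<or> uniformiser \<theta>"
  shows "emeasure orbit_image integral_triples =
    emeasure \<mu> ((\<lambda>g. translate g H) ` SL2_integers)"
proof -
  have "open (integral_triples :: ('k \<times> 'k \<times> 'k) set)"
    unfolding integral_triples_def by (intro open_Times) auto
  then have "emeasure orbit_image integral_triples = emeasure \<mu> (coset_point -` integral_triples \<inter> cosets H)"
    using coset_point_meas by (simp add: orbit_image_def emeasure_distr space_mu)
  also have "coset_point -` integral_triples \<inter> cosets H = (\<lambda>g. translate g H) ` SL2_integers"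
  proof (intro equalityI subsetI)
    fix c assume "c \<in> coset_point -` integral_triples \<inter> cosets H"
    then obtain g where g: "g \<in> SL2" "c = translate g H" "orbit_point \<theta> g \<in> integral_triples"
      by (auto simp: cosets_def coset_point_translate)
    obtain k where k: "k \<in> SL2_integers" "orbit_point \<theta> k = orbit_point \<theta> g"
      using integral_orbit[OF two theta_cases g(1,3)] by blast
    then have "translate k H = c"
      using translate_eqI[of g k] g by (auto simp: SL2_integers_iff)
    then show "c \<in> (\<lambda>g. translate g H) ` SL2_integers" using k by blast
  next
    fix c assume "c \<in> (\<lambda>g. translate g H) ` SL2_integers"
    then obtain k where k: "k \<in> SL2_integers" "c = translate k H" by blast
    have th: "\<theta> \<in> pideal 0" using theta_cases by (auto simp: nonsquare_unit_def uniformiser_def pideal_def)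
    have "orbit_point \<theta> k \<in> integral_triples"
      unfolding orbit_point_def using th
      by (intro mat_act_integral k) (simp add: integral_triples_def one_in_pideal)
    then show "c \<in> coset_point -` integral_triples \<inter> cosets H"
      using k by (auto simp: SL2_integers_iff coset_point_translate cosets_def)
  qed
  finally show ?thesis .
qed

section \<open>Lattices in the Lie algebra\<close>

lemma continuous_on_mat2 [continuous_intros]:
  fixes f1 f2 f3 f4 :: "'a::topological_space \<Rightarrow> 'k::{zero, topological_space}"
  assumes "continuous_on S f1" "continuous_on S f2" "continuous_on S f3" "continuous_on S f4"
  shows "continuous_on S (\<lambda>x. mat2 (f1 x) (f2 x) (f3 x) (f4 x))"
proof -
  have "mat2 (f1 x) (f2 x) (f3 x) (f4 x) =
      (\<chi> i j. if i = 1 then (if j = 1 then f1 x else f2 x) else (if j = 1 then f3 x else f4 x))" for x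
    by (simp add: vec_eq_iff forall_2)
  moreover have "continuous_on S (\<lambda>x. if i = 1 then (if j = 1 then f1 x else f2 x) else (if j = 1 then f3 x else f4 x))"
    for i j :: 2
    using assms by (cases "i = 1"; cases "j = 1") auto
  ultimately show ?thesis by (simp only:) (intro continuous_on_vec_lambda)
qed

lemma continuous_on_plus_mat:
  "continuous_on UNIV ((+) (A :: 'k::nonarch_local_field ^ 2 ^ 2))"
proof -
  have "(+) A = (\<lambda>B. mat2 (A $ 1 $ 1 + B $ 1 $ 1) (A $ 1 $ 2 + B $ 1 $ 2)
      (A $ 2 $ 1 + B $ 2 $ 1) (A $ 2 $ 2 + B $ 2 $ 2))"
    by (auto simp: mat2_eq_iff)
  then show ?thesis by (simp only:) (intro continuous_intros)
qed

text \<open>The radii are separate because the dual box needs independent bounds \<open>A\<close>,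
  \<open>B\<close>, \<open>C\<close>; the fourth entry is fixed by trace zero.\<close>

definition sl2_lattice :: "int \<Rightarrow> int \<Rightarrow> int \<Rightarrow> 'k::discrete_valued_field ^ 2 ^ 2 \<Rightarrow> ('k ^ 2 ^ 2) set" where
  "sl2_lattice i j l Y = {W \<in> sl2. W $ 1 $ 1 \<in> vball i (Y $ 1 $ 1) \<and> W $ 1 $ 2 \<in> vball j (Y $ 1 $ 2) \<and>
     W $ 2 $ 1 \<in> vball l (Y $ 2 $ 1)}"

lemma compact_sl2_lattice: "compact (sl2_lattice i j l (Y :: 'k::nonarch_local_field ^ 2 ^ 2))"
proof -
  let ?S = "vball i (Y $ 1 $ 1) \<times> vball j (Y $ 1 $ 2) \<times> vball l (Y $ 2 $ 1)"
  let ?f = "\<lambda>p. mat2 (fst p) (fst (snd p)) (snd (snd p)) (- fst p)"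
  have "sl2_lattice i j l Y = ?f ` ?S"
  proof (intro equalityI subsetI)
    fix W assume "W \<in> sl2_lattice i j l Y"
    then show "W \<in> ?f ` ?S"
      by (intro image_eqI[of _ _ "(W $ 1 $ 1, W $ 1 $ 2, W $ 2 $ 1)"])
        (auto simp: sl2_lattice_def sl2_iff mat2_eq_iff)
  qed (auto simp: sl2_lattice_def sl2_iff)
  moreover have "continuous_on ?S ?f" by (intro continuous_intros)
  ultimately show ?thesis by (simp add: compact_continuous_image compact_Times compact_vball)
qed

lemma open_entry_vball: "open {W :: 'k::nonarch_local_field ^ 2 ^ 2. W $ a $ b \<in> vball i x}"
proof -
  have "open ((\<lambda>W :: 'k ^ 2 ^ 2. W $ a $ b) -` vball i x)" by (intro open_vimage continuous_intros) auto
  then show ?thesis by (simp add: vimage_def)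
qed

lemma openin_sl2_lattice: "openin (top_of_set sl2) (sl2_lattice i j l (Y :: 'k::nonarch_local_field ^ 2 ^ 2))"
proof -
  have "sl2_lattice i j l Y = sl2 \<inter> ({W. W $ 1 $ 1 \<in> vball i (Y $ 1 $ 1)} \<inter> {W. W $ 1 $ 2 \<in> vball j (Y $ 1 $ 2)} \<inter>
      {W. W $ 2 $ 1 \<in> vball l (Y $ 2 $ 1)})"
    by (auto simp: sl2_lattice_def)
  then show ?thesis by (simp only:) (intro openin_open_Int open_Int open_entry_vball)
qed

lemma sl2_lattice_subset_sl2: "sl2_lattice i j l Y \<subseteq> sl2"
  by (auto simp: sl2_lattice_def)

lemma plus_image_sl2_lattice:
  assumes "A \<in> sl2"
  shows "(+) A ` sl2_lattice i j l Y = sl2_lattice i j l (A + Y)"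
proof (intro equalityI subsetI)
  fix W assume "W \<in> sl2_lattice i j l (A + Y)"
  then show "W \<in> (+) A ` sl2_lattice i j l Y"
    using assms by (intro image_eqI[of _ _ "W - A"]) (auto simp: sl2_lattice_def sl2_iff vball_iff algebra_simps)
qed (use assms in \<open>auto simp: sl2_lattice_def sl2_iff vball_iff algebra_simps\<close>)

lemma sl2_lattice_test_function:
  "indicator (sl2_lattice i j l Y) \<in> (test_functions :: ('k::nonarch_local_field ^ 2 ^ 2 \<Rightarrow> complex) set)"
proof -
  let ?L = "sl2_lattice i j l Y"
  have "\<exists>U. openin (top_of_set sl2) U \<and> x \<in> U \<and> (\<forall>y\<in>U. indicator ?L y = (indicator ?L x :: complex))"
    if "x \<in> sl2" for x
  proof (cases "x \<in> ?L")
    case True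
    then show ?thesis using openin_sl2_lattice by (intro exI[of _ ?L]) auto
  next
    case False
    have "closed ?L" using compact_sl2_lattice by (rule compact_imp_closed)
    then have "openin (top_of_set sl2) (sl2 \<inter> - ?L)" by (intro openin_open_Int) auto
    then show ?thesis using False that by (intro exI[of _ "sl2 \<inter> - ?L"]) auto
  qed
  moreover have "{Z \<in> sl2. indicator ?L Z \<noteq> (0::complex)} = ?L"
    by (auto simp: indicator_def dest: subsetD[OF sl2_lattice_subset_sl2])
  ultimately show ?thesis
    using compact_sl2_lattice[of i j l Y]
    by (simp add: test_functions_def locally_constant_on_def closure_closed compact_imp_closed)
qed

lemma open_matrix_sl2_lattice:
  fixes V :: "('k::nonarch_local_field ^ 2 ^ 2) set"
  assumes "open V" "Y \<in> V" "Y \<in> sl2"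
  shows "\<exists>k. \<forall>i\<ge>k. \<forall>j\<ge>k. \<forall>l\<ge>k. sl2_lattice i j l Y \<subseteq> V"
proof -
  let ?f = "\<lambda>p :: 'k \<times> 'k \<times> 'k. mat2 (fst p) (fst (snd p)) (snd (snd p)) (- fst p)"
  have f: "?f (W $ 1 $ 1, W $ 1 $ 2, W $ 2 $ 1) = W" if "W \<in> sl2" for W
    using that by (simp add: mat2_eq_iff sl2_iff)
  have "open (?f -` V)" using assms(1) by (intro open_vimage continuous_intros)
  moreover have "(Y $ 1 $ 1, Y $ 1 $ 2, Y $ 2 $ 1) \<in> ?f -` V" using f[OF assms(3)] assms(2) by simp
  ultimately obtain A B where AB: "open A" "open B" "(Y $ 1 $ 1, Y $ 1 $ 2, Y $ 2 $ 1) \<in> A \<times> B" "A \<times> B \<subseteq> ?f -` V"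
    by (rule open_prod_elim)
  then have "(Y $ 1 $ 2, Y $ 2 $ 1) \<in> B" by simp
  with AB(2) obtain C D where CD: "open C" "open D" "(Y $ 1 $ 2, Y $ 2 $ 1) \<in> C \<times> D" "C \<times> D \<subseteq> B"
    by (rule open_prod_elim)
  have "\<exists>n. vball n (Y $ 1 $ 1) \<subseteq> A" "\<exists>n. vball n (Y $ 1 $ 2) \<subseteq> C" "\<exists>n. vball n (Y $ 2 $ 1) \<subseteq> D"
    using AB CD by (auto simp: open_iff_vball)
  then obtain n1 n2 n3 where n: "vball n1 (Y $ 1 $ 1) \<subseteq> A" "vball n2 (Y $ 1 $ 2) \<subseteq> C" "vball n3 (Y $ 2 $ 1) \<subseteq> D"
    by blast
  show ?thesis
  proof (intro exI[of _ "max n1 (max n2 n3)"] allI impI)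
    fix i j l assume k: "max n1 (max n2 n3) \<le> i" "max n1 (max n2 n3) \<le> j" "max n1 (max n2 n3) \<le> l"
    show "sl2_lattice i j l Y \<subseteq> V"
    proof
      fix W assume W: "W \<in> sl2_lattice i j l Y"
      then have "W $ 1 $ 1 \<in> A" "W $ 1 $ 2 \<in> C" "W $ 2 $ 1 \<in> D"
        using n k vball_subset[of n1 i "Y $ 1 $ 1"] vball_subset[of n2 j "Y $ 1 $ 2"] vball_subset[of n3 l "Y $ 2 $ 1"]
        by (auto simp: sl2_lattice_def)
      then have "?f (W $ 1 $ 1, W $ 1 $ 2, W $ 2 $ 1) \<in> V" using AB(4) CD(4) by blast
      then show "W \<in> V" using f[of W] W by (auto simp: sl2_lattice_def)
    qed
  qed
qed

text \<open>The characteristic polynomial is \<open>T^2 + det W\<close> with derivative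
  \<open>2 T\<close>; subtracting \<open>T / 2\<close> times the derivative leaves the non-zero
  constant \<open>det W\<close>.\<close>

lemma sl2_rss_det:
  fixes W :: "'k::field ^ 2 ^ 2"
  assumes two: "(2::'k) \<noteq> 0" and W: "W \<in> sl2" "det W \<noteq> 0"
  shows "W \<in> sl2_rss"
proof -
  have W': "W $ 2 $ 2 = - W $ 1 $ 1" using W by (simp add: sl2_iff)
  let ?d = "det W"
  have cp: "char_poly2 W = [:?d, 0, 1:]"
    by (simp add: char_poly2_def det_2 W' power2_eq_square algebra_simps)
  have pd: "pderiv (char_poly2 W) = [:0, 2:]" by (simp add: cp pderiv_pCons)
  have "coprime [:?d, 0, 1:] [:0, 2:]"
  proof (rule coprimeI)
    fix c assume c: "c dvd [:?d, 0, 1:]" "c dvd [:0, 2:]"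
    have "[:?d, 0, 1:] - [:0, 1 / 2:] * [:0, 2:] = [:?d:]" using two by simp
    moreover have "c dvd [:?d, 0, 1:] - [:0, 1 / 2:] * [:0, 2:]"
      using c by (intro dvd_diff dvd_mult)
    ultimately have "c dvd [:?d:]" by simp
    moreover have "[:?d:] dvd 1" using W(2) by (simp add: is_unit_const_poly_iff dvd_field_iff)
    ultimately show "is_unit c" by (rule dvd_trans)
  qed
  then show ?thesis using W(1) by (simp add: sl2_rss_def cp pd[unfolded cp])
qed

lemma locally_constant_rss:
  fixes F :: "'k::nonarch_local_field ^ 2 ^ 2 \<Rightarrow> complex"
  assumes two: "(2::'k) \<noteq> 0" and F: "locally_constant_on sl2_rss F" and Y: "Y \<in> sl2" "det Y \<noteq> 0"
  shows "\<exists>k. \<forall>i\<ge>k. \<forall>j\<ge>k. \<forall>l\<ge>k. \<forall>W\<in>sl2_lattice i j l Y. F W = F Y"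
proof -
  have "\<exists>U. openin (top_of_set sl2_rss) U \<and> Y \<in> U \<and> (\<forall>W\<in>U. F W = F Y)"
    using F sl2_rss_det[OF two Y] unfolding locally_constant_on_def by (rule bspec)
  then obtain U where U: "openin (top_of_set sl2_rss) U" "Y \<in> U" "\<forall>W\<in>U. F W = F Y"
    by blast
  then obtain V where V: "open V" "U = sl2_rss \<inter> V" by (auto simp: openin_open)
  \<comment> \<open>Avoiding \<open>det = 0\<close> keeps a whole lattice coset inside
    \<open>sl2_rss\<close>, where \<open>F\<close> is locally constant.\<close>
  let ?D = "(\<lambda>W :: 'k ^ 2 ^ 2. W $ 1 $ 1 * W $ 2 $ 2 - W $ 1 $ 2 * W $ 2 $ 1) -` (- {0})"
  have "open ?D" by (intro open_vimage continuous_intros)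
  then have "open (V \<inter> ?D)" using V by (intro open_Int)
  moreover have "Y \<in> V \<inter> ?D" using U V Y by (simp add: det_2)
  ultimately have "\<exists>k. \<forall>i\<ge>k. \<forall>j\<ge>k. \<forall>l\<ge>k. sl2_lattice i j l Y \<subseteq> V \<inter> ?D"
    by (rule open_matrix_sl2_lattice[OF _ _ Y(1)])
  then obtain k where k: "\<forall>i\<ge>k. \<forall>j\<ge>k. \<forall>l\<ge>k. sl2_lattice i j l Y \<subseteq> V \<inter> ?D" ..
  show ?thesis
  proof (intro exI[of _ k] allI impI ballI)
    fix i j l W assume i: "k \<le> i" "k \<le> j" "k \<le> l" and W: "W \<in> sl2_lattice i j l Y"
    have "W \<in> V \<inter> ?D" using k i W by blast
    then have "W \<in> V" "det W \<noteq> 0" by (auto simp: det_2)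
    moreover have "W \<in> sl2" using W by (simp add: sl2_lattice_def)
    ultimately have "W \<in> U" using sl2_rss_det[OF two] V(2) by blast
    with U(3) show "F W = F Y" by (rule bspec)
  qed
qed

section \<open>Haar measure of lattices in \<open>sl2\<close> and orthogonality of
  characters\<close>

context
  fixes dY :: "('k::nonarch_local_field ^ 2 ^ 2) measure"
  assumes haar: "haar_measure_on sl2 dY"
begin

lemma space_dY: "space dY = sl2" and sets_dY: "sets dY = sets (restrict_space borel sl2)"
  and dY_translate: "A \<in> sl2 \<Longrightarrow> S \<in> sets dY \<Longrightarrow> emeasure dY ((+) A ` S) = emeasure dY S"
  and dY_compact: "compact C \<Longrightarrow> C \<subseteq> sl2 \<Longrightarrow> emeasure dY C < \<infinity>"
  and dY_nonzero: "emeasure dY sl2 \<noteq> 0"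
  using haar by (simp_all add: haar_measure_on_def)

lemma sl2_lattice_sets: "sl2_lattice i j l Y \<in> sets dY"
proof -
  have "closed (sl2_lattice i j l Y)" by (rule compact_imp_closed[OF compact_sl2_lattice])
  then have "sl2 \<inter> sl2_lattice i j l Y \<in> sets (restrict_space borel sl2)"
    unfolding sets_restrict_space by (intro imageI) auto
  moreover have "sl2 \<inter> sl2_lattice i j l Y = sl2_lattice i j l Y" using sl2_lattice_subset_sl2 by blast
  ultimately show ?thesis by (simp add: sets_dY)
qed

lemma emeasure_sl2_lattice_finite: "emeasure dY (sl2_lattice i j l Y) < \<infinity>"
  by (intro dY_compact compact_sl2_lattice sl2_lattice_subset_sl2)

text \<open>Countably many translates cover \<open>sl2\<close>, so a null lattice would make the
  whole Haar measure zero.\<close>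

lemma emeasure_sl2_lattice_nonzero:
  assumes Y: "Y \<in> sl2"
  shows "emeasure dY (sl2_lattice i j l Y) \<noteq> 0"
proof
  assume zero: "emeasure dY (sl2_lattice i j l Y) = 0"
  have null: "emeasure dY (sl2_lattice i j l W) = 0" if "W \<in> sl2" for W
  proof -
    have "W - Y \<in> sl2" using that Y by (simp add: sl2_iff)
    then have "emeasure dY ((+) (W - Y) ` sl2_lattice i j l Y) = emeasure dY (sl2_lattice i j l Y)"
      by (intro dY_translate sl2_lattice_sets)
    then show ?thesis using plus_image_sl2_lattice[OF \<open>W - Y \<in> sl2\<close>, of i j l Y] zero by simp
  qed
  let ?I = "range (vball i) \<times> range (vball j) \<times> range (vball l) :: ('k set \<times> 'k set \<times> 'k set) set"
  let ?S = "\<lambda>p. {W \<in> sl2. W $ 1 $ 1 \<in> fst p \<and> W $ 1 $ 2 \<in> fst (snd p) \<and> W $ 2 $ 1 \<in> snd (snd p)}"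
  have eq: "?S (vball i x, vball j y, vball l z) = sl2_lattice i j l (mat2 x y z (- x))" for x y z
    by (auto simp: sl2_lattice_def)
  have "?S p \<in> null_sets dY" if p_in: "p \<in> ?I" for p
  proof -
    obtain x y z where p: "p = (vball i x, vball j y, vball l z)" using p_in by auto
    have "mat2 x y z (- x) \<in> sl2" by (simp add: sl2_iff)
    then show ?thesis unfolding p eq using null sl2_lattice_sets by (auto simp: null_sets_def)
  qed
  then have "(\<Union>p\<in>?I. ?S p) \<in> null_sets dY"
    by (intro null_sets_UN') (auto intro!: countable_SIGMA countable_vballs)
  moreover have "(\<Union>p\<in>?I. ?S p) = sl2"
  proof (intro equalityI subsetI)
    fix W :: "'k ^ 2 ^ 2" assume "W \<in> sl2"
    then show "W \<in> (\<Union>p\<in>?I. ?S p)"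
      by (intro UN_I[of "(vball i (W $ 1 $ 1), vball j (W $ 1 $ 2), vball l (W $ 2 $ 1))"]) auto
  qed auto
  ultimately show False using dY_nonzero by (simp add: null_sets_def)
qed

text \<open>Orthogonality of characters: a value other than 1 on the lattice kills the integral, and
  otherwise \<open>f\<close> is constant on the coset.\<close>

lemma sl2_lattice_fourier:
  fixes f :: "'k ^ 2 ^ 2 \<Rightarrow> complex"
  assumes Y: "Y \<in> sl2" and f: "continuous_on UNIV f"
    and add: "\<And>V W. f (V + W) = f V * f W"
  shows "(LINT W|dY. indicator (sl2_lattice i j l Y) W * f W) =
    complex_of_real (measure dY (sl2_lattice i j l Y)) *
      (f Y * (if \<forall>W\<in>sl2_lattice i j l 0. f W = 1 then 1 else 0))"
proof (cases "\<forall>W\<in>sl2_lattice i j l 0. f W = 1")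
  case True
  have eq: "indicator (sl2_lattice i j l Y) W * f W = indicator (sl2_lattice i j l Y) W * f Y" for W
  proof (cases "W \<in> sl2_lattice i j l Y")
    case W: True
    then have "W - Y \<in> sl2_lattice i j l 0" using Y by (auto simp: sl2_lattice_def sl2_iff vball_iff)
    then show ?thesis using True add[of "W - Y" Y] by simp
  qed simp
  have "(LINT W|dY. indicator (sl2_lattice i j l Y) W * f Y) =
      complex_of_real (measure dY (sl2_lattice i j l Y)) * f Y"
    by (rule has_bochner_integral_integral_eq
        [OF has_bochner_integral_indicator_times[OF sl2_lattice_sets emeasure_sl2_lattice_finite]])
  then show ?thesis unfolding eq using True by simp
next
  case False
  then obtain A where A: "A \<in> sl2_lattice i j l 0" "f A \<noteq> 1" by blast
  then have A': "A \<in> sl2" by (simp add: sl2_lattice_def)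
  have "(LINT W|dY. indicator (sl2_lattice i j l Y) W * f W) = 0"
  proof (rule additive_character_integral_eq_0[OF haar A' continuous_on_plus_mat continuous_on_plus_mat _ _ _ A(2)])
    show "A + W \<in> sl2 \<longleftrightarrow> W \<in> sl2" for W using A' by (simp add: sl2_iff)
    have "f \<in> borel_measurable (restrict_space borel sl2)"
      by (intro measurable_restrict_space1 borel_measurable_continuous_onI f)
    then have "f \<in> borel_measurable dY" by (simp add: measurable_cong_sets[OF sets_dY refl])
    then show "(\<lambda>W. indicator (sl2_lattice i j l Y) W * f W) \<in> borel_measurable dY"
      by (intro borel_measurable_times borel_measurable_indicator sl2_lattice_sets)
    fix W :: "'k ^ 2 ^ 2" assume W: "W \<in> sl2"
    have "A $ 1 $ 1 \<in> pideal i" "A $ 1 $ 2 \<in> pideal j" "A $ 2 $ 1 \<in> pideal l"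
      using A(1) by (auto simp: sl2_lattice_def vball_zero)
    moreover have "x + y - z \<in> pideal n \<longleftrightarrow> y - z \<in> pideal n" if "x \<in> pideal n" for x y z :: 'k and n
      using pideal_diff_iff[OF that, of "x + y - z"] by (simp add: algebra_simps)
    ultimately have "A + W \<in> sl2_lattice i j l Y \<longleftrightarrow> W \<in> sl2_lattice i j l Y"
      using A' W by (auto simp: sl2_lattice_def sl2_iff vball_iff)
    then show "indicator (sl2_lattice i j l Y) (A + W) * f (A + W) =
        f A * (indicator (sl2_lattice i j l Y) W * f W)"
      by (simp add: indicator_def add)
  qed
  then show ?thesis unfolding if_not_P[OF False] by simp
qed

end

section \<open>The Fourier transform of the orbital integral\<close>

lemma orbit_pairing_add: "orbit_pairing p (V + W) = orbit_pairing p V + orbit_pairing p W"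
  by (simp add: orbit_pairing_def algebra_simps)

lemma orbit_pairing_torus_elt:
  "orbit_pairing p (torus_elt s \<theta>') = s * (fst (snd p) * \<theta>' + snd (snd p))"
  by (simp add: orbit_pairing_def torus_elt_def algebra_simps)

lemma continuous_on_orbit_pairing:
  "continuous_on UNIV (orbit_pairing (p :: 'k::nonarch_local_field \<times> 'k \<times> 'k))"
  unfolding orbit_pairing_def[abs_def] by (intro continuous_intros)

text \<open>The radii come in the order \<open>A\<close>, \<open>C\<close>, \<open>B\<close>, since
  \<open>b\<close> pairs with the lower left entry and \<open>c\<close> with the upper right one.
  The summand \<open>val s\<close> comes from the division by \<open>s\<close>, which undoes the
  factor \<open>s\<close> in \<open>\<psi>\<close>.\<close>

lemma (in orbit_phase) lattice_annihilator:
  assumes s: "s \<noteq> 0"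
  shows "(\<forall>W\<in>sl2_lattice (A + m + val s) (C + m + val s) (B + m + val s) 0. \<psi> (orbit_pairing p W / s) = 1) \<longleftrightarrow>
    p \<in> pideal (- A) \<times> pideal (- B) \<times> pideal (- C)"
proof -
  let ?L = "sl2_lattice (A + m + val s) (C + m + val s) (B + m + val s) (0 :: 'k ^ 2 ^ 2)"
  note two' = val_two[OF two]
  obtain a b c where p: "p = (a, b, c)" by (cases p)
  have div: "x / s \<in> pideal m" if "x \<in> pideal (m + val s)" for x
    using s that by (cases "x = 0") (auto simp: pideal_def val_divide)
  have witness: "\<exists>u. u \<in> pideal (n + m + val s) \<and> \<psi> (x * u / s) \<noteq> 1" if "x \<notin> pideal (- n)" for x n
  proof -
    obtain z where z: "z \<noteq> 0" "val z = m - 1" "\<psi> z \<noteq> 1" by (rule psi_witness)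
    have x: "x \<noteq> 0" "val x < - n" using that by (auto simp: pideal_def)
    have "z * s / x \<in> pideal (n + m + val s)" using x z s by (simp add: pideal_def val_divide val_mult)
    moreover have "x * (z * s / x) / s = z" using x s by simp
    ultimately show ?thesis using z(3) by (intro exI[of _ "z * s / x"]) simp
  qed
  show ?thesis
  proof
    assume "p \<in> pideal (- A) \<times> pideal (- B) \<times> pideal (- C)"
    then have abc: "a \<in> pideal (- A)" "b \<in> pideal (- B)" "c \<in> pideal (- C)" by (auto simp: p)
    have a2: "2 * a \<in> pideal (- A)" by (rule pideal_mult'[OF _ abc(1), of 2 0]) (auto simp: pideal_def two')
    show "\<forall>W\<in>?L. \<psi> (orbit_pairing p W / s) = 1"
    proof
      fix W :: "'k ^ 2 ^ 2" assume "W \<in> ?L"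
      then have W: "W $ 1 $ 1 \<in> pideal (A + m + val s)" "W $ 1 $ 2 \<in> pideal (C + m + val s)"
        "W $ 2 $ 1 \<in> pideal (B + m + val s)"
        by (auto simp: sl2_lattice_def vball_zero)
      have "2 * a * W $ 1 $ 1 + b * W $ 2 $ 1 + c * W $ 1 $ 2 \<in> pideal (m + val s)"
        by (intro pideal_add pideal_mult'[OF a2 W(1)] pideal_mult'[OF abc(2) W(3)] pideal_mult'[OF abc(3) W(2)]) auto
      then show "\<psi> (orbit_pairing p W / s) = 1" by (intro psi_trivial div) (simp add: p orbit_pairing_def)
    qed
  next
    assume *: "\<forall>W\<in>?L. \<psi> (orbit_pairing p W / s) = 1"
    have "2 * a \<in> pideal (- A)"
    proof (rule ccontr)
      assume "2 * a \<notin> pideal (- A)"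
      then obtain u where u: "u \<in> pideal (A + m + val s)" "\<psi> (2 * a * u / s) \<noteq> 1" using witness by blast
      have "mat2 u 0 0 (- u) \<in> ?L"
        using u(1) by (simp add: sl2_lattice_def sl2_iff vball_iff)
      from bspec[OF * this] show False using u(2) by (simp add: p orbit_pairing_def)
    qed
    then have "a \<in> pideal (- A)" using pideal_mult_iff[of 2 a "- A"] two' by simp
    moreover have "b \<in> pideal (- B)"
    proof (rule ccontr)
      assume "b \<notin> pideal (- B)"
      then obtain u where u: "u \<in> pideal (B + m + val s)" "\<psi> (b * u / s) \<noteq> 1" using witness by blast
      have "mat2 0 0 u 0 \<in> ?L"
        using u(1) by (simp add: sl2_lattice_def sl2_iff vball_iff)
      from bspec[OF * this] show False using u(2) by (simp add: p orbit_pairing_def)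
    qed
    moreover have "c \<in> pideal (- C)"
    proof (rule ccontr)
      assume "c \<notin> pideal (- C)"
      then obtain u where u: "u \<in> pideal (C + m + val s)" "\<psi> (c * u / s) \<noteq> 1" using witness by blast
      have "mat2 0 u 0 0 \<in> ?L"
        using u(1) by (simp add: sl2_lattice_def sl2_iff vball_iff)
      from bspec[OF * this] show False using u(2) by (simp add: p orbit_pairing_def)
    qed
    ultimately show "p \<in> pideal (- A) \<times> pideal (- B) \<times> pideal (- C)" by (simp add: p)
  qed
qed

theorem proposition11p2:
  fixes \<Phi> :: "'k::nonarch_local_field \<Rightarrow> complex"
    and dx :: "'k measure"
    and dY :: "('k ^ 2 ^ 2) measure"
    and \<mu> :: "('k ^ 2 ^ 2) set measure"
    and F :: "'k ^ 2 ^ 2 \<Rightarrow> complex"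
    and \<epsilon> \<pi> \<theta> \<theta>' \<beta> s :: 'k
    and q :: nat
    and X :: "'k functional"
    and Y :: "'k ^ 2 ^ 2"
  assumes q: "q = card (residue_field :: 'k set set)"
    and residual_char: "(2 :: 'k) \<notin> maximal_ideal"
    and eps: "nonsquare_unit \<epsilon>"
    and unif: "uniformiser \<pi>"
    and char: "nontrivial_additive_character \<Phi>"
    and haar_k: "haar_measure_on UNIV dx" "emeasure dx integer_ring = 1"
    and haar_g: "haar_measure_on sl2 dY"
    and theta: "\<theta> \<in> {1, \<epsilon>, \<pi>}"
    and nonzero: "\<beta> \<noteq> 0" "s \<noteq> 0" "\<theta>' \<noteq> 0"
    and X: "X = trace_functional (torus_elt \<beta> \<theta>)"
    and Y: "Y = torus_elt s \<theta>'"
    and invariant: "invariant_measure (centraliser X) \<mu>"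
    and normalised:
      "emeasure \<mu> ((\<lambda>g. translate g (centraliser X)) ` SL2_integers) =
         ennreal (if \<theta> = 1 then (real q + 1) / real q
                  else if \<theta> = \<epsilon> then (real q - 1) / real q
                  else 1 / 2 * ((real q)\<^sup>2 - 1) / (real q)\<^sup>2)"
    and F: "represents_orbital_fourier \<Phi> dY \<mu> X F"
  shows "F Y = mock_fourier \<Phi> dx \<beta> \<theta> s \<theta>'"
proof -
  note two' = val_two[OF residual_char]
  define \<psi> where "\<psi> = (\<lambda>y. \<Phi> (\<beta> * s * y))"
  have Phi: "continuous_on UNIV \<Phi>" "\<And>x. cmod (\<Phi> x) = 1" "\<And>x y. \<Phi> (x + y) = \<Phi> x * \<Phi> y" "\<exists>x. \<Phi> x \<noteq> 1"
    using char by (auto simp: nontrivial_additive_character_def)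
  have theta_cases: "\<theta> = 1 \<or> nonsquare_unit \<theta> \<or> uniformiser \<theta>" using theta eps unif by auto
  then have th: "\<theta> \<noteq> 0" "0 \<le> val \<theta>" by (auto simp: nonsquare_unit_def uniformiser_def)
  interpret haar_field dx "real q" using haar_k q by unfold_locales auto
  have psi: "nontrivial_additive_character \<psi>"
    unfolding nontrivial_additive_character_def
  proof (intro conjI allI)
    have "continuous_on UNIV (\<Phi> \<circ> (\<lambda>y. \<beta> * s * y))"
      by (intro continuous_on_compose continuous_intros continuous_on_subset[OF Phi(1)]) auto
    then show "continuous_on UNIV \<psi>" by (simp add: \<psi>_def comp_def)
    obtain x where "\<Phi> x \<noteq> 1" using Phi(4) by blast
    then show "\<exists>y. \<psi> y \<noteq> 1" using nonzero by (intro exI[of _ "x / (\<beta> * s)"]) (simp add: \<psi>_def)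
  qed (simp_all add: \<psi>_def Phi distrib_left)
  then obtain m where m: "\<And>x. x \<in> pideal m \<Longrightarrow> \<psi> x = 1" "\<exists>z\<in>pideal (m - 1). \<psi> z \<noteq> 1"
    using conductor_exists[OF haar_field_axioms] by blast
  interpret torus_coset_measure \<theta> "centraliser X" \<mu>
    using centraliser_torus[OF two'(1) nonzero(1), of \<theta>] residual_char invariant
    by unfold_locales (simp_all add: X)
  interpret orbit_measure dx "real q" orbit_image \<theta>
    using residual_char orbit_image_AE orbit_image_invariant by unfold_locales (simp_all add: orbit_image_def)
  have points: "emeasure orbit_image integral_triples =
     ennreal (if \<theta> = 1 then (real q + 1) / real q
                  else if \<theta> = \<epsilon> then (real q - 1) / real q
                  else 1 / 2 * ((real q)\<^sup>2 - 1) / (real q)\<^sup>2)"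
    using emeasure_integral_triples[OF theta_cases] normalised by (simp only:)
  have kappa: "kappa 1 = 1"
  proof -
    consider "\<theta> = 1" | "\<theta> \<noteq> 1" "\<theta> = \<epsilon>" | "\<theta> \<noteq> 1" "\<theta> \<noteq> \<epsilon>" "\<theta> = \<pi>" using theta by blast
    then show ?thesis
    proof cases
      case 1
      then show ?thesis using kappa_split points by simp
    next
      case 2
      then show ?thesis using kappa_unramified eps points by simp
    next
      case 3
      then show ?thesis using kappa_ramified unif points by simp
    qed
  qed
  interpret orbit_fourier dx "real q" \<psi> m \<theta> \<theta>' orbit_image
    using psi m th theta_cases kappa points residual_char
    by unfold_locales (auto simp: nontrivial_additive_character_def)
  have Y_sl2: "Y \<in> sl2" by (simp add: Y sl2_iff torus_elt_def)
  have "det Y \<noteq> 0" using nonzero by (simp add: Y det_2 torus_elt_def)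
  moreover have "locally_constant_on sl2_rss F" using F by (simp add: represents_orbital_fourier_def)
  ultimately have "\<exists>k. \<forall>i\<ge>k. \<forall>j\<ge>k. \<forall>l\<ge>k. \<forall>W\<in>sl2_lattice i j l Y. F W = F Y"
    using locally_constant_rss[OF two'(1) _ Y_sl2] by blast
  then obtain k where k: "\<forall>i\<ge>k. \<forall>j\<ge>k. \<forall>l\<ge>k. \<forall>W\<in>sl2_lattice i j l Y. F W = F Y" ..
  have "F Y = (\<Sum>\<^sub>\<infinity>n. mock_term n)"
  \<comment> \<open>The shift by \<open>m + val s\<close> converts lower bounds for the dual box
    into lattice radii of at least \<open>k\<close>.\<close>
  proof (rule truncated_orbit_integral_limit[symmetric, where k = "k - m - val s", THEN sym])
    fix A B C assume "k - m - val s \<le> A" "k - m - val s \<le> B" "k - m - val s \<le> C"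
    then have ABC: "k \<le> A + m + val s" "k \<le> C + m + val s" "k \<le> B + m + val s" by auto
    let ?L = "sl2_lattice (A + m + val s) (C + m + val s) (B + m + val s)"
    let ?R = "pideal (- A) \<times> pideal (- B) \<times> pideal (- C) :: ('k \<times> 'k \<times> 'k) set"
    let ?v = "complex_of_real (measure dY (?L Y))"
    \<comment> \<open>The lattice volume appears on both sides and can be cancelled once it is
      neither zero nor infinite.\<close>
    have vol: "?v \<noteq> 0"
      using emeasure_sl2_lattice_finite[OF haar_g] emeasure_sl2_lattice_nonzero[OF haar_g Y_sl2]
      by (auto simp: measure_def enn2real_eq_0_iff less_top)
    have eq: "F W * indicator (?L Y) W = indicator (?L Y) W * F Y" for W
      using k ABC by (cases "W \<in> ?L Y") simp_all
    have left: "(LINT W|dY. F W * indicator (?L Y) W) = ?v * F Y"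
      unfolding eq
      by (rule has_bochner_integral_integral_eq[OF has_bochner_integral_indicator_times
            [OF sl2_lattice_sets[OF haar_g] emeasure_sl2_lattice_finite[OF haar_g]]])
    have fourier: "fourier \<Phi> dY (indicator (?L Y)) (coAd (SOME g. g \<in> c) X) =
        ?v * (indicator ?R (coset_point c) * kernel (coset_point c))" if c_in: "c \<in> cosets (centraliser X)" for c
    proof -
      let ?p = "coset_point c"
      define f where "f = (\<lambda>W. \<Phi> (\<beta> * orbit_pairing ?p W))"
      obtain g where g: "g \<in> SL2" "c = translate g (centraliser X)" using c_in by (auto simp: cosets_def)
      have "fourier \<Phi> dY (indicator (?L Y)) (coAd (SOME g. g \<in> c) X) = (LINT W|dY. indicator (?L Y) W * f W)"
        unfolding fourier_def
        using coAd_eq_pairing[OF coset_representative(1)[OF g(1)], of _ \<beta> \<theta>] g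
        by (intro Bochner_Integration.integral_cong refl)
          (simp add: f_def X space_dY[OF haar_g] coset_point_def)
      also have "\<dots> = ?v * (f Y * (if \<forall>W\<in>?L 0. f W = 1 then 1 else 0))"
      proof (rule sl2_lattice_fourier[OF haar_g Y_sl2])
        have "continuous_on UNIV (\<Phi> \<circ> (\<lambda>W. \<beta> * orbit_pairing ?p W))"
          by (intro continuous_on_compose continuous_on_mult' continuous_on_const continuous_on_orbit_pairing
              continuous_on_subset[OF Phi(1)]) auto
        then show "continuous_on UNIV f" by (simp add: f_def comp_def)
        show "f (V + W) = f V * f W" for V W
          by (simp add: f_def orbit_pairing_add distrib_left Phi(3))
      qed
      also have "f Y = kernel ?p"
        unfolding kernel_def f_def Y orbit_pairing_torus_elt by (simp add: \<psi>_def mult.assoc)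
      also have "(\<forall>W\<in>?L 0. f W = 1) \<longleftrightarrow> ?p \<in> ?R"
        using lattice_annihilator[OF nonzero(2), of A C B ?p] nonzero(2) by (simp add: f_def \<psi>_def)
      finally show ?thesis by (cases "?p \<in> ?R") simp_all
    qed
    have meas: "(\<lambda>p. indicator ?R p * kernel p) \<in> borel_measurable borel"
      using truncated_kernel_meas[of ?R] by (simp add: open_Times measurable_cong_sets[OF sets_nu refl])
    have "?v * F Y = orbital_integral \<mu> X (fourier \<Phi> dY (indicator (?L Y)))"
      using F sl2_lattice_test_function[of "A + m + val s" "C + m + val s" "B + m + val s" Y] left
      by (simp add: represents_orbital_fourier_def)
    also have "\<dots> = (LINT c|\<mu>. ?v * (indicator ?R (coset_point c) * kernel (coset_point c)))"
      unfolding orbital_integral_def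
      by (intro Bochner_Integration.integral_cong refl fourier) (simp add: space_mu)
    also have "\<dots> = ?v * (LINT p|orbit_image. indicator ?R p * kernel p)"
      unfolding orbit_image_def integral_distr[OF coset_point_meas meas] by simp
    finally show "(LINT p|orbit_image. indicator ?R p * kernel p) = F Y" using vol by simp
  qed
  also have "\<dots> = mock_fourier \<Phi> dx \<beta> \<theta> s \<theta>'"
    unfolding mock_fourier_def
  proof (rule infsum_cong[symmetric])
    fix n
    show "(LINT x:shell n|mult_measure dx. indicator (quad_norm \<theta> ` quad_units \<theta>) x *
        (\<Sum>\<^sub>\<infinity>l. LINT t:shell l|dx. \<Phi> (\<beta> * s * (x * \<theta>' + inverse x * \<theta> - inverse x * t\<^sup>2)))) = mock_term n"
      using mock_fourier_term[of n] unfolding phase_def norm_group_def by (simp only: \<psi>_def)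
  qed
  finally show ?thesis .
qed

end
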